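(* Let $l \in \{1,\ldots,m+2\}$ and let $\Sigma \subseteq \mathbb{R}^n$ be a compact set such that (i) there exist $R_{\mathrm{Ahl}} > 0$ and $A_{\mathrm{Ahl}} > 0$ with $\mathcal{H}^m(\Sigma \cap \mathbb{B}(x,r)) \ge A_{\mathrm{Ahl}} r^m$ for all $x \in \Sigma$ and all $0< r \le R_{\mathrm{Ahl}}$; (ii) there exist $R_{\theta\beta} > 0$ and $M_{\theta\beta} > 1$ with $\theta_m^{\Sigma}(x,r) \le M_{\theta\beta}\, \beta_m^{\Sigma}(x,r)$ for all $x \in \Sigma$ and all $0< r \le R_{\theta\beta}$. If $\mathcal{E}_p^l(\Sigma) < \infty$ for some $p > ml$, then $\Sigma$ is a closed, embedded ($m$-dimensional) manifold of class $C^{1,\lambda/\kappa}$, where $\kappa = (p+ml)(m+1)$ and $\lambda = p - ml$.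
   Context: Here $1 \le m \le n$ are integers, $\mathcal{H}^s$ is the $s$-dimensional Hausdorff measure, $\mathbb{B}(x,r)$ and $\overline{\mathbb{B}}(x,r)$ are the open and closed balls in $\mathbb{R}^n$, $G(n,m)$ is the Grassmannian of $m$-dimensional linear subspaces of $\mathbb{R}^n$, and $\bigtriangleup(x_0,\ldots,x_k)$ is the convex hull of $\{x_0,\ldots,x_k\}$. A closed manifold is a compact manifold without boundary; embedded means a submanifold of $\mathbb{R}^n$. For $x_0,\ldots,x_{m+1} \in \mathbb{R}^n$ set $$\mathcal{K}(x_0,\ldots,x_{m+1}) = \frac{\mathcal{H}^{m+1}(\bigtriangleup(x_0,\ldots,x_{m+1}))}{\mathrm{diam}(x_0,\ldots,x_{m+1})^{m+2}}$$ (with value $0$ if all points coincide). For $p>0$ and $l \in \{1,\ldots,m+2\}$, $$\mathcal{E}_p^l(\Sigma) = \int_{\Sigma^l} \sup_{x_l,\ldots,x_{m+1} \in \Sigma} \mathcal{K}(x_0,\ldots,x_{m+1})^p \, d\mathcal{H}^{ml}_{x_0,\ldots,x_{l-1}}$$ (if $l=m+2$ there is no supremum). For $x\in\Sigma$, $r>0$, $$\beta_m^{\Sigma}(x,r) = \frac1r \inf_{H \in G(n,m)} \ \sup_{z \in \Sigma \cap \overline{\mathbb{B}}(x,r)} \mathrm{dist}(z, x+H),$$ $$\theta_m^{\Sigma}(x,r) = \frac1r \inf_{H \in G(n,m)} d_{\mathcal{H}}\big(\Sigma \cap \overline{\mathbb{B}}(x,r), (x+H)\cap \overline{\mathbb{B}}(x,r)\big),$$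 where $d_{\mathcal{H}}(E,F) = \sup_{y\in E}\mathrm{dist}(y,F) + \sup_{y \in F}\mathrm{dist}(y,E)$. *)

theory Defs
  imports "HOL-Analysis.Analysis"
begin

section \<open>Hausdorff measures\<close>

text \<open>
  Hausdorff measures are needed on \<open>\<real>\<^sup>n\<close> and on \<open>(\<real>\<^sup>n)\<^sup>l\<close>, where \<open>l\<close> is a number and not a type.
  They are therefore defined for an explicit carrier \<open>S\<close> and distance function \<open>d\<close>.
\<close>

definition ediam :: "('b \<Rightarrow> 'b \<Rightarrow> real) \<Rightarrow> 'b set \<Rightarrow> ennreal" where
  "ediam d U = (SUP x\<in>U. SUP y\<in>U. ennreal (d x y))"

text \<open>
  The weight \<open>\<omega>\<^sub>s (diam U / 2)\<^sup>s\<close> is normalised so that the \<open>s\<close>-dimensional measure on \<open>\<real>\<^sup>s\<close>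
  is Lebesgue measure. Only integer dimensions occur. The convention \<open>0 ^ 0 = 1\<close>, together with the
  separate case of the empty set, gives the counting measure for \<open>s = 0\<close>.
\<close>

definition hausdorff_weight :: "('b \<Rightarrow> 'b \<Rightarrow> real) \<Rightarrow> nat \<Rightarrow> 'b set \<Rightarrow> ennreal" where
  "hausdorff_weight d s U =
     (if U = {} then 0 else ennreal (unit_ball_vol (real s)) * (ediam d U / 2) ^ s)"

definition delta_covers ::
    "('b \<Rightarrow> 'b \<Rightarrow> real) \<Rightarrow> 'b set \<Rightarrow> real \<Rightarrow> 'b set \<Rightarrow> (nat \<Rightarrow> 'b set) set" where
  "delta_covers d S \<delta> A = {C. (\<forall>i. C i \<subseteq> S \<and> ediam d (C i) \<le> ennreal \<delta>) \<and> A \<subseteq> (\<Union>i. C i)}"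

definition hausdorff_outer ::
    "('b \<Rightarrow> 'b \<Rightarrow> real) \<Rightarrow> 'b set \<Rightarrow> nat \<Rightarrow> 'b set \<Rightarrow> ennreal" where
  "hausdorff_outer d S s A =
     (SUP \<delta>\<in>{0<..}. INF C\<in>delta_covers d S \<delta> A. \<Sum>i. hausdorff_weight d s (C i))"

text \<open>
  The associated measure lives on the Caratheodory-measurable subsets of \<open>S\<close>. The two lemmas
  below show that \<^const>\<open>measure_of\<close> does not degenerate here.
\<close>

definition hausdorff_measure ::
    "('b \<Rightarrow> 'b \<Rightarrow> real) \<Rightarrow> 'b set \<Rightarrow> nat \<Rightarrow> 'b measure" where
  "hausdorff_measure d S s =
     measure_of S (lambda_system S (Pow S) (hausdorff_outer d S s)) (hausdorff_outer d S s)"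

lemma outer_measure_space_hausdorff_outer:
  "outer_measure_space (Pow S) (hausdorff_outer d S s)"
proof -
  let ?p = "\<lambda>\<delta> A. INF C\<in>delta_covers d S \<delta> A. \<Sum>i. hausdorff_weight d s (C i)"
  have empty: "?p \<delta> {} = 0" for \<delta>
  proof -
    have "(\<lambda>_. {}) \<in> delta_covers d S \<delta> {}"
      by (simp add: delta_covers_def ediam_def bot_ennreal)
    then have "?p \<delta> {} \<le> (\<Sum>i::nat. hausdorff_weight d s {})"
      by (rule INF_lower2) simp
    then show ?thesis
      by (simp add: hausdorff_weight_def)
  qed
  have mono: "?p \<delta> A \<le> ?p \<delta> B" if "A \<subseteq> B" for \<delta> A B
    using that by (intro INF_superset_mono) (auto simp: delta_covers_def)
  have sub: "?p \<delta> (\<Union>i. A i) \<le> (\<Sum>i. ?p \<delta> (A i))" for \<delta> and A :: "nat \<Rightarrow> _"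
  proof (cases "(\<Sum>i. ?p \<delta> (A i)) = \<infinity>")
    case False
    have fin: "?p \<delta> (A i) < \<infinity>" for i
      using False ennreal_suminf_lessD[of "\<lambda>i. ?p \<delta> (A i)" top i]
      by (auto simp: less_top)
    show ?thesis
    proof (rule ennreal_le_epsilon)
      fix e :: real assume "0 < e"
      define h where "h i = ennreal (e * (1/2) ^ Suc i)" for i
      have hpos: "0 < h i" for i
        using \<open>0 < e\<close> by (simp add: h_def ennreal_zero_less_mult_iff)
      have "\<exists>C\<in>delta_covers d S \<delta> (A i).
              (\<Sum>j. hausdorff_weight d s (C j)) < ?p \<delta> (A i) + h i" for i
      proof -
        have "?p \<delta> (A i) < ?p \<delta> (A i) + h i"
          using fin[of i] hpos[of i]
          by (metis ennreal_add_left_cancel_less add.right_neutral infinity_ennreal_def less_irrefl)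
        then show ?thesis
          by (simp only: INF_less_iff)
      qed
      then obtain C where C: "\<And>i. C i \<in> delta_covers d S \<delta> (A i)"
        and less: "\<And>i. (\<Sum>j. hausdorff_weight d s (C i j)) < ?p \<delta> (A i) + h i"
        by metis
      define D where "D k = (case prod_decode k of (i, j) \<Rightarrow> C i j)" for k
      have "(\<Union>i. A i) \<subseteq> (\<Union>k. D k)"
      proof
        fix x assume "x \<in> (\<Union>i. A i)"
        then obtain i j where "x \<in> C i j"
          using C by (fastforce simp: delta_covers_def)
        then have "x \<in> D (prod_encode (i, j))"
          by (simp add: D_def)
        then show "x \<in> (\<Union>k. D k)" by blast
      qed
      then have "D \<in> delta_covers d S \<delta> (\<Union>i. A i)"
        using C by (auto simp: delta_covers_def D_def split: prod.splits)
      then have "?p \<delta> (\<Union>i. A i) \<le> (\<Sum>k. hausdorff_weight d s (D k))"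
        by (rule INF_lower)
      also have "\<dots> = (\<Sum>i. \<Sum>j. hausdorff_weight d s (C i j))"
        using suminf_ennreal_2dimen[of "\<lambda>i. \<Sum>j. hausdorff_weight d s (C i j)"
            "\<lambda>(i, j). hausdorff_weight d s (C i j)"]
        by (simp add: D_def case_prod_beta)
      also have "\<dots> \<le> (\<Sum>i. ?p \<delta> (A i) + h i)"
        by (intro suminf_le less_imp_le less) auto
      also have "\<dots> = (\<Sum>i. ?p \<delta> (A i)) + (\<Sum>i. h i)"
        by (simp add: suminf_add)
      also have "(\<Sum>i. h i) = ennreal e"
        unfolding h_def
        using sums_mult[OF power_half_series, of e] \<open>0 < e\<close>
        by (intro suminf_ennreal_eq) auto
      finally show "?p \<delta> (\<Union>i. A i) \<le> (\<Sum>i. ?p \<delta> (A i)) + ennreal e" .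
    qed
  qed simp
  have "positive (Pow S) (hausdorff_outer d S s)"
    using empty by (simp add: positive_def hausdorff_outer_def)
  moreover have "increasing (Pow S) (hausdorff_outer d S s)"
    unfolding increasing_def hausdorff_outer_def using mono by (intro ballI impI SUP_mono) auto
  moreover have "countably_subadditive (Pow S) (hausdorff_outer d S s)"
    unfolding countably_subadditive_def
  proof (intro allI impI)
    fix A :: "nat \<Rightarrow> _"
    show "hausdorff_outer d S s (\<Union>i. A i) \<le> (\<Sum>i. hausdorff_outer d S s (A i))"
      unfolding hausdorff_outer_def
    proof (rule SUP_least)
      fix \<delta> :: real assume "\<delta> \<in> {0<..}"
      have "(\<Sum>i. ?p \<delta> (A i)) \<le> (\<Sum>i. SUP \<delta>\<in>{0<..}. ?p \<delta> (A i))"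
        using \<open>\<delta> \<in> {0<..}\<close> by (intro suminf_le SUP_upper) auto
      with sub[of \<delta> A] show "?p \<delta> (\<Union>i. A i) \<le> (\<Sum>i. SUP \<delta>\<in>{0<..}. ?p \<delta> (A i))"
        by (rule order_trans)
    qed
  qed
  ultimately show ?thesis
    by (simp add: outer_measure_space_def)
qed

lemma
  shows space_hausdorff_measure: "space (hausdorff_measure d S s) = S"
    and sets_hausdorff_measure:
      "sets (hausdorff_measure d S s) = lambda_system S (Pow S) (hausdorff_outer d S s)"
    and emeasure_hausdorff_measure:
      "A \<in> sets (hausdorff_measure d S s) \<Longrightarrow>
         emeasure (hausdorff_measure d S s) A = hausdorff_outer d S s A"
proof -
  let ?L = "lambda_system S (Pow S) (hausdorff_outer d S s)"
  have M: "measure_space S ?L (hausdorff_outer d S s)"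
    by (rule sigma_algebra.caratheodory_lemma
        [OF sigma_algebra_Pow outer_measure_space_hausdorff_outer])
  then have sa: "sigma_algebra S ?L"
    by (simp add: measure_space_def)
  then have L: "?L \<subseteq> Pow S"
    by (auto simp: lambda_system_def)
  show "space (hausdorff_measure d S s) = S"
    using L by (simp add: hausdorff_measure_def space_measure_of)
  show sets: "sets (hausdorff_measure d S s) = ?L"
    using sa by (simp add: hausdorff_measure_def sigma_algebra.sets_measure_of_eq)
  show "emeasure (hausdorff_measure d S s) A = hausdorff_outer d S s A"
    if "A \<in> sets (hausdorff_measure d S s)"
    using M that unfolding sets by (intro emeasure_measure_of[OF hausdorff_measure_def L])
      (auto simp: measure_space_def hausdorff_measure_def sigma_algebra.sets_measure_of_eq[OF sa])
qed

abbreviation hausdorff :: "nat \<Rightarrow> 'a::metric_space set \<Rightarrow> ennreal" where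
  "hausdorff s \<equiv> hausdorff_outer dist UNIV s"

text \<open>
  A point \<open>(x\<^sub>0, \<dots>, x\<^sub>l\<^sub>-\<^sub>1)\<close> of \<open>(\<real>\<^sup>n)\<^sup>l\<close> is an extensional function on \<open>{..<l}\<close>, and \<open>(\<real>\<^sup>n)\<^sup>l\<close>
  carries the Euclidean distance of \<open>\<real>\<^sup>n\<^sup>l\<close>.
\<close>

definition tuple_dist :: "nat \<Rightarrow> (nat \<Rightarrow> 'a::metric_space) \<Rightarrow> (nat \<Rightarrow> 'a) \<Rightarrow> real" where
  "tuple_dist l x y = L2_set (\<lambda>i. dist (x i) (y i)) {..<l}"

definition hausdorff_tuples :: "nat \<Rightarrow> nat \<Rightarrow> (nat \<Rightarrow> 'a::metric_space) measure" where
  "hausdorff_tuples l s = hausdorff_measure (tuple_dist l) ({..<l} \<rightarrow>\<^sub>E UNIV) s"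

section \<open>Menger-type curvature energies\<close>

text \<open>
  The simplex is a bounded set of affine dimension at most \<open>m + 1\<close>, so its Hausdorff measure is
  finite and \<^const>\<open>enn2real\<close> loses nothing. If all points coincide, the quotient is
  \<open>0\<close> because of division by zero.
\<close>

definition menger_curv :: "nat \<Rightarrow> (nat \<Rightarrow> 'a::euclidean_space) \<Rightarrow> real" where
  "menger_curv m x =
     enn2real (hausdorff (m + 1) (convex hull (x ` {..m + 1}))) / diameter (x ` {..m + 1}) ^ (m + 2)"

text \<open>
  For \<open>x \<in> \<Sigma>\<^sup>l\<close>, the supremum over \<open>x\<^sub>l, \<dots>, x\<^sub>m\<^sub>+\<^sub>1 \<in> \<Sigma>\<close> is taken over all extensions \<open>y\<close> of \<open>x\<close> to
  an \<open>(m + 2)\<close>-tuple in \<open>\<Sigma>\<close>; for \<open>l = m + 2\<close> the only extension is \<open>x\<close> itself.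
\<close>

definition menger_energy :: "nat \<Rightarrow> nat \<Rightarrow> real \<Rightarrow> 'a::euclidean_space set \<Rightarrow> ennreal" where
  "menger_energy m l p \<Sigma> =
     (\<integral>\<^sup>+ x \<in> {..<l} \<rightarrow>\<^sub>E \<Sigma>.
        (SUP y \<in> {y \<in> {..m + 1} \<rightarrow>\<^sub>E \<Sigma>. \<forall>i<l. y i = x i}. ennreal (menger_curv m y powr p))
      \<partial>hausdorff_tuples l (m * l))"

section \<open>Flatness numbers\<close>

definition grassmannian :: "nat \<Rightarrow> 'a::euclidean_space set set" where
  "grassmannian m = {H. subspace H \<and> dim H = m}"

definition beta_number :: "nat \<Rightarrow> 'a::euclidean_space set \<Rightarrow> 'a \<Rightarrow> real \<Rightarrow> real" where
  "beta_number m \<Sigma> x r =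
     1 / r * (INF H\<in>grassmannian m. SUP z\<in>\<Sigma> \<inter> cball x r. infdist z ((+) x ` H))"

text \<open>The sum of the two one-sided distances, rather than their maximum.\<close>

definition hausdorff_distance :: "'a::metric_space set \<Rightarrow> 'a set \<Rightarrow> real" where
  "hausdorff_distance E F = (SUP y\<in>E. infdist y F) + (SUP y\<in>F. infdist y E)"

definition theta_number :: "nat \<Rightarrow> 'a::euclidean_space set \<Rightarrow> 'a \<Rightarrow> real \<Rightarrow> real" where
  "theta_number m \<Sigma> x r =
     1 / r * (INF H\<in>grassmannian m. hausdorff_distance (\<Sigma> \<inter> cball x r) ((+) x ` H \<inter> cball x r))"

section \<open>Submanifolds of Hoelder class\<close>

text \<open>Maps of class \<open>C\<^sup>1\<close> on an open set \<open>U\<close> whose derivative is locally \<open>\<alpha>\<close>-Hoelder continuous.\<close>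

definition C1_holder_on ::
    "real \<Rightarrow> 'a::real_normed_vector set \<Rightarrow> ('a \<Rightarrow> 'b::real_normed_vector) \<Rightarrow> bool" where
  "C1_holder_on \<alpha> U f \<longleftrightarrow>
     (\<exists>f' :: 'a \<Rightarrow> 'a \<Rightarrow>\<^sub>L 'b.
        (\<forall>x\<in>U. (f has_derivative blinfun_apply (f' x)) (at x)) \<and>
        continuous_on U f' \<and>
        (\<forall>x\<in>U. \<exists>r>0. \<exists>C. \<forall>y\<in>U \<inter> ball x r. \<forall>z\<in>U \<inter> ball x r.
            norm (f' y - f' z) \<le> C * dist y z powr \<alpha>))"

text \<open>
  Embedded submanifolds (without boundary) of \<open>\<real>\<^sup>n\<close>, by slice charts: near each of its points,
  \<open>M\<close> is mapped onto an open piece of an \<open>m\<close>-dimensional linear subspace by a diffeomorphism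
  between open sets of \<open>\<real>\<^sup>n\<close> that is of class \<open>C\<^sup>1\<^sup>,\<^sup>\<alpha>\<close> together with its inverse.
\<close>

definition embedded_submanifold_C1_holder ::
    "nat \<Rightarrow> real \<Rightarrow> 'a::euclidean_space set \<Rightarrow> bool" where
  "embedded_submanifold_C1_holder m \<alpha> M \<longleftrightarrow>
     (\<forall>x\<in>M. \<exists>U V :: 'a set. \<exists>\<Phi> \<Psi> :: 'a \<Rightarrow> 'a. \<exists>H\<in>grassmannian m.
        open U \<and> x \<in> U \<and> open V \<and> homeomorphism U V \<Phi> \<Psi> \<and>
        C1_holder_on \<alpha> U \<Phi> \<and> C1_holder_on \<alpha> V \<Psi> \<and>
        \<Phi> ` (M \<inter> U) = H \<inter> V)"

definition closed_embedded_manifold_C1_holder ::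
    "nat \<Rightarrow> real \<Rightarrow> 'a::euclidean_space set \<Rightarrow> bool" where
  "closed_embedded_manifold_C1_holder m \<alpha> M \<longleftrightarrow>
     compact M \<and> embedded_submanifold_C1_holder m \<alpha> M"

end

theory Submission
  imports Defs
begin

text \<open>
  If \<open>\<beta>(x, r)\<close> is not small, the greedy choice of points \<open>x = x\<^sub>0, x\<^sub>1, \<dots>, x\<^sub>m\<^sub>+\<^sub>1\<close> of \<open>\<Sigma>\<close> in the ball yields
  a simplex all of whose heights are at least about \<open>\<beta> r\<close>. Moving the vertices by a small multiple of \<open>\<beta> r\<close>
  keeps the curvature above a multiple of \<open>\<beta>\<^sup>m\<^sup>+\<^sup>1 / r\<close>, and by Ahlfors regularity the moved vertices fill
  a set of measure at least a multiple of \<open>(\<beta> r)\<^sup>m\<^sup>l\<close>. Finiteness of the energy therefore gives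
  \<open>\<beta>(x, r) \<le> C r\<^sup>\<alpha>\<close>, and condition (ii) turns this into \<open>\<theta>(x, r) \<le> C r\<^sup>\<alpha>\<close>. Measures of products are bounded
  from below by \<open>H\<^sup>s\<^sup>+\<^sup>t(A \<times> B) \<ge> c H\<^sup>s(A) H\<^sup>t(B)\<close>; for intervals this also bounds the measure of a simplex.

  The decay of \<open>\<theta>\<close> makes the approximating planes converge geometrically along dyadic scales, uniformly near
  a given point. So \<open>\<Sigma>\<close> lies in cones over a fixed plane, hence locally in the graph of a Lipschitz
  function. Its domain is a full ball of the plane: at the point of \<open>\<Sigma>\<close> whose projection is nearest to
  a missing one, flatness at a smaller scale would produce a still nearer projection. The approximating
  planes converge to the derivative, with a Taylor estimate that makes the function \<open>C\<^sup>1\<^sup>,\<^sup>\<alpha>\<close>.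
\<close>

section \<open>Weighted coverings and products\<close>

text \<open>A covering of a product need not consist of products, and the Hausdorff measure on
  tuples is not given as a product measure. Slicing a covering of the product over the points of one
  factor yields weights there rather than a covering, whence a weighted form of Vitali's covering
  lemma. It loses a constant factor, which is harmless since only the powers of \<beta> and
  \<open>r\<close> matter. The integrand of the energy is a supremum over extensions, whose
  measurability is left open: the energy is compared with a multiple of the indicator of a box of
  tuples, so only the box has to be measurable. This is what Caratheodory's criterion is for. Decay
  of \<beta> alone would allow holes in \<Sigma>. The half of \<theta> that measures how far the
  plane is from \<Sigma> is what makes the projection to a plane onto. All approximating planes near
  a point are compared with one fixed plane; the tilt stays bounded because it is summable over the
  dyadic scales, and this is where a positive exponent, that is \<open>p > m l\<close>,
  enters.\<close>

definition hausdorff_content ::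
    "('b \<Rightarrow> 'b \<Rightarrow> real) \<Rightarrow> 'b set \<Rightarrow> real \<Rightarrow> nat \<Rightarrow> 'b set \<Rightarrow> ennreal" where
  "hausdorff_content d S \<delta> s A = (INF C\<in>delta_covers d S \<delta> A. \<Sum>i. hausdorff_weight d s (C i))"

lemma hausdorff_outer_eq_SUP:
  "hausdorff_outer d S s A = (SUP \<delta>\<in>{0<..}. hausdorff_content d S \<delta> s A)"
  by (simp add: hausdorff_outer_def hausdorff_content_def)

lemma hausdorff_content_le_outer:
  "0 < \<delta> \<Longrightarrow> hausdorff_content d S \<delta> s A \<le> hausdorff_outer d S s A"
  unfolding hausdorff_outer_eq_SUP by (rule SUP_upper) simp

lemma less_hausdorff_outerE:
  assumes "a < hausdorff_outer d S s A"
  obtains \<delta> where "0 < \<delta>" "a < hausdorff_content d S \<delta> s A"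
  using assms unfolding hausdorff_outer_eq_SUP less_SUP_iff by auto

lemma hausdorff_content_antimono:
  assumes "\<delta> \<le> \<delta>'"
  shows "hausdorff_content d S \<delta>' s A \<le> hausdorff_content d S \<delta> s A"
proof -
  have "ediam d U \<le> ennreal \<delta>'" if "ediam d U \<le> ennreal \<delta>" for U
    using that assms by (meson ennreal_leI order_trans)
  then have "delta_covers d S \<delta> A \<subseteq> delta_covers d S \<delta>' A"
    by (auto simp: delta_covers_def)
  then show ?thesis
    unfolding hausdorff_content_def by (rule INF_superset_mono) auto
qed

lemma hausdorff_content_mono:
  "A \<subseteq> B \<Longrightarrow> hausdorff_content d S \<delta> s A \<le> hausdorff_content d S \<delta> s B"
  unfolding hausdorff_content_def
  by (rule INF_superset_mono) (auto simp: delta_covers_def)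

lemma hausdorff_outer_mono:
  "A \<subseteq> B \<Longrightarrow> hausdorff_outer d S s A \<le> hausdorff_outer d S s B"
  unfolding hausdorff_outer_eq_SUP by (intro SUP_mono) (auto intro: hausdorff_content_mono)

lemma hausdorff_content_le_suminf:
  assumes "\<And>i. C i \<subseteq> S" "\<And>i. ediam d (C i) \<le> ennreal \<delta>" "A \<subseteq> (\<Union>i. C i)"
  shows "hausdorff_content d S \<delta> s A \<le> (\<Sum>i. hausdorff_weight d s (C i))"
  unfolding hausdorff_content_def
  using assms by (intro INF_lower) (auto simp: delta_covers_def)

lemma ediam_empty [simp]: "ediam d {} = 0"
  by (simp add: ediam_def bot_ennreal)

lemma hausdorff_weight_empty [simp]: "hausdorff_weight d s {} = 0"
  by (simp add: hausdorff_weight_def)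

lemma ediam_le_iff:
  assumes "0 \<le> e"
  shows "ediam d U \<le> ennreal e \<longleftrightarrow> (\<forall>x\<in>U. \<forall>y\<in>U. d x y \<le> e)"
  using assms by (auto simp: ediam_def SUP_le_iff ennreal_le_iff)

lemma hausdorff_content_le_finite:
  assumes "finite I" "\<And>i. i \<in> I \<Longrightarrow> G i \<subseteq> S" "\<And>i. i \<in> I \<Longrightarrow> ediam d (G i) \<le> ennreal \<delta>"
    and "A \<subseteq> (\<Union>i\<in>I. G i)"
  shows "hausdorff_content d S \<delta> s A \<le> (\<Sum>i\<in>I. hausdorff_weight d s (G i))"
proof -
  obtain h where h: "bij_betw h {..<card I} I"
    using assms(1) by (metis bij_betw_from_nat_into_finite)
  \<comment> \<open>Coverings are indexed by all naturals; padding with empty sets is free because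
    their weight is 0 even in dimension 0.\<close>
  define C where "C i = (if i < card I then G (h i) else {})" for i
  have hI: "h i \<in> I" if "i < card I" for i
    using h that by (auto simp: bij_betw_def)
  have "A \<subseteq> (\<Union>i. C i)"
  proof
    fix x assume "x \<in> A"
    then obtain i where i: "i \<in> I" "x \<in> G i"
      using assms(4) by blast
    then obtain j where "j < card I" "h j = i"
      using h by (metis bij_betw_def imageE lessThan_iff)
    then have "x \<in> C j" using i by (simp add: C_def)
    then show "x \<in> (\<Union>i. C i)" by blast
  qed
  then have "hausdorff_content d S \<delta> s A \<le> (\<Sum>i. hausdorff_weight d s (C i))"
    using assms hI by (intro hausdorff_content_le_suminf) (auto simp: C_def)
  also have "\<dots> = (\<Sum>i<card I. hausdorff_weight d s (C i))"
    by (rule suminf_finite) (auto simp: C_def)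
  also have "\<dots> = (\<Sum>i<card I. hausdorff_weight d s (G (h i)))"
    by (simp add: C_def)
  also have "\<dots> = (\<Sum>i\<in>I. hausdorff_weight d s (G i))"
    using h by (rule sum.reindex_bij_betw)
  finally show ?thesis .
qed

lemma hausdorff_weight_eq:
  assumes "U \<noteq> {}" "ediam d U = ennreal e" "0 \<le> e"
  shows "hausdorff_weight d s U = ennreal (unit_ball_vol (real s) * (e / 2) ^ s)"
proof -
  have "ennreal e / 2 = ennreal (e / 2)"
    using assms(3) by (metis divide_ennreal ennreal_numeral zero_less_numeral zero_le_numeral)
  then show ?thesis
    using assms by (simp add: hausdorff_weight_def ennreal_mult ennreal_power)
qed

lemma hausdorff_weight_le:
  assumes "ediam d U \<le> ennreal e" "0 \<le> e"
  shows "hausdorff_weight d s U \<le> ennreal (unit_ball_vol (real s) * (e / 2) ^ s)"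
proof -
  have "ediam d U / 2 \<le> ennreal e / 2"
    using assms(1) by (intro divide_right_mono_ennreal)
  also have "ennreal e / 2 = ennreal (e / 2)"
    using assms(2) by (metis divide_ennreal ennreal_numeral zero_less_numeral zero_le_numeral)
  finally have "(ediam d U / 2) ^ s \<le> ennreal (e / 2) ^ s"
    by (rule power_mono) simp
  then show ?thesis
    using assms by (simp add: hausdorff_weight_def ennreal_mult ennreal_power mult_left_mono)
qed

lemma ediam_ball_le:
  assumes "0 \<le> r"
  shows "ediam dist (ball x r) \<le> ennreal (2 * r)"
proof -
  have "\<forall>y\<in>ball x r. \<forall>z\<in>ball x r. dist y z \<le> 2 * r"
  proof (intro ballI)
    fix y z assume "y \<in> ball x r" "z \<in> ball x r"
    then have "dist x y < r" "dist x z < r" by simp_all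
    then show "dist y z \<le> 2 * r"
      using dist_triangle3[of y z x] by linarith
  qed
  moreover have "0 \<le> 2 * r" using assms by simp
  ultimately show ?thesis
    using ediam_le_iff by blast
qed

text \<open>
  A family of balls with multiplicities covering each point \<open>M\<close> times contains \<open>M\<close> Vitali subfamilies:
  as the balls of a Vitali subfamily are disjoint, removing it lowers the multiplicity of the covering
  by at most one.
\<close>

lemma hausdorff_content_multiplicity:
  fixes B :: "'a::euclidean_space set" and y :: "nat \<Rightarrow> 'a" and mult :: "nat \<Rightarrow> nat"
  assumes e: "\<And>i. i < N \<Longrightarrow> 0 < e i \<and> e i \<le> \<delta>"
    and "\<And>z. z \<in> B \<Longrightarrow> M \<le> (\<Sum>i<N. if z \<in> ball (y i) (e i) then mult i else 0)"
  shows "of_nat M * hausdorff_content dist UNIV (10 * \<delta>) t B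
    \<le> ennreal (unit_ball_vol (real t) * (\<Sum>i<N. real (mult i) * (5 * e i) ^ t))"
  using assms(2)
proof (induction M arbitrary: mult)
  case 0
  then show ?case by simp
next
  case (Suc M)
  \<comment> \<open>Vitali is applied only to balls of positive multiplicity; since the chosen
    \<open>C\<close> lies in \<open>J\<close>, the truncated subtraction in \<open>mult'\<close>
    below is exact on \<open>C\<close>.\<close>
  define J where "J = {i. i < N \<and> 0 < mult i}"
  have "B \<subseteq> (\<Union>i\<in>J. ball (y i) (e i))"
  proof
    fix z assume "z \<in> B"
    from Suc.prems[OF this] have "(\<Sum>i<N. if z \<in> ball (y i) (e i) then mult i else 0) \<noteq> 0"
      by linarith
    then obtain i where "i \<in> {..<N}" "(if z \<in> ball (y i) (e i) then mult i else 0) \<noteq> 0"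
      by (rule sum.not_neutral_contains_not_neutral)
    then show "z \<in> (\<Union>i\<in>J. ball (y i) (e i))"
      by (auto simp: J_def split: if_splits)
  qed
  moreover have "\<And>i. i \<in> J \<Longrightarrow> 0 < e i \<and> e i \<le> \<delta>"
    using e by (auto simp: J_def)
  ultimately obtain C where C: "C \<subseteq> J"
    "pairwise (\<lambda>i j. disjnt (ball (y i) (e i)) (ball (y j) (e j))) C"
    "B \<subseteq> (\<Union>i\<in>C. ball (y i) (5 * e i))"
    by (rule Vitali_covering_lemma_balls)
  have finC: "finite C" using C(1) by (rule finite_subset) (auto simp: J_def)
  have eC: "0 < e i" "e i \<le> \<delta>" "0 < mult i" "i < N" if "i \<in> C" for i
    using that C(1) e by (auto simp: J_def)
  define mult' where "mult' i = mult i - (if i \<in> C then 1 else 0)" for i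
  have "M \<le> (\<Sum>i<N. if z \<in> ball (y i) (e i) then mult' i else 0)" if "z \<in> B" for z
  proof -
    have "(\<Sum>i<N. if i \<in> C \<and> z \<in> ball (y i) (e i) then 1 else 0::nat)
        = card ({..<N} \<inter> {i. i \<in> C \<and> z \<in> ball (y i) (e i)})"
      by (simp only: sum.If_cases[OF finite_lessThan]) simp
    also have "\<dots> = card {i. i < N \<and> i \<in> C \<and> z \<in> ball (y i) (e i)}"
      by (rule arg_cong[where f=card]) auto
    also have "\<dots> \<le> 1"
    proof -
      have "\<And>i j. i \<in> {i. i < N \<and> i \<in> C \<and> z \<in> ball (y i) (e i)} \<Longrightarrow>
          j \<in> {i. i < N \<and> i \<in> C \<and> z \<in> ball (y i) (e i)} \<Longrightarrow> i = j"
        using C(2) by (auto simp: pairwise_def disjnt_iff)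
      moreover have "finite {i. i < N \<and> i \<in> C \<and> z \<in> ball (y i) (e i)}"
        by simp
      ultimately show ?thesis
        unfolding One_nat_def by (simp only: card_le_Suc0_iff_eq) blast
    qed
    finally have le1: "(\<Sum>i<N. if i \<in> C \<and> z \<in> ball (y i) (e i) then 1 else 0::nat) \<le> 1" .
    have "Suc M \<le> (\<Sum>i<N. if z \<in> ball (y i) (e i) then mult i else 0)"
      using Suc.prems that by blast
    also have "\<dots> = (\<Sum>i<N. (if z \<in> ball (y i) (e i) then mult' i else 0)
        + (if i \<in> C \<and> z \<in> ball (y i) (e i) then 1 else 0))"
      using eC(3) by (intro sum.cong) (auto simp: mult'_def Suc_leI)
    finally show ?thesis using le1 by (simp add: sum.distrib)
  qed
  from Suc.IH[OF this] have IH: "of_nat M * hausdorff_content dist UNIV (10 * \<delta>) t B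
    \<le> ennreal (unit_ball_vol (real t) * (\<Sum>i<N. real (mult' i) * (5 * e i) ^ t))" .
  \<comment> \<open>Vitali enlarges the radii five times, so the diameters are at most
    \<open>10 * \<delta>\<close>.\<close>
  have "hausdorff_content dist UNIV (10 * \<delta>) t B
      \<le> (\<Sum>i\<in>C. hausdorff_weight dist t (ball (y i) (5 * e i)))"
  proof (rule hausdorff_content_le_finite[OF finC _ _ C(3)])
    fix i assume "i \<in> C"
    then show "ediam dist (ball (y i) (5 * e i)) \<le> ennreal (10 * \<delta>)"
      using eC[of i] ediam_ball_le[of "5 * e i" "y i"]
      by (simp add: ennreal_leI order_trans[of _ "ennreal (10 * e i)"])
  qed auto
  also have "\<dots> \<le> (\<Sum>i\<in>C. ennreal (unit_ball_vol (real t) * (5 * e i) ^ t))"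
  proof (rule sum_mono)
    fix i assume "i \<in> C"
    then show "hausdorff_weight dist t (ball (y i) (5 * e i)) \<le> ennreal (unit_ball_vol (real t) * (5 * e i) ^ t)"
      using hausdorff_weight_le[OF ediam_ball_le[of "5 * e i" "y i"]] eC[of i] by simp
  qed
  also have "\<dots> = ennreal (unit_ball_vol (real t) * (\<Sum>i\<in>C. (5 * e i) ^ t))"
    unfolding sum_distrib_left using eC(1) by (intro sum_ennreal) (simp add: less_imp_le)
  also have "(\<Sum>i\<in>C. (5 * e i) ^ t) = (\<Sum>i<N. if i \<in> C then (5 * e i) ^ t else 0)"
    using eC(4) by (simp add: sum.If_cases Int_absorb1 subset_iff)
  finally have 1: "hausdorff_content dist UNIV (10 * \<delta>) t B
      \<le> ennreal (unit_ball_vol (real t) * (\<Sum>i<N. if i \<in> C then (5 * e i) ^ t else 0))" .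
  have nn: "0 \<le> (\<Sum>i<N. if i \<in> C then (5 * e i) ^ t else 0)" "0 \<le> (\<Sum>i<N. real (mult' i) * (5 * e i) ^ t)"
    using e by (intro sum_nonneg; simp add: less_imp_le)+
  have "of_nat (Suc M) * hausdorff_content dist UNIV (10 * \<delta>) t B
    \<le> ennreal (unit_ball_vol (real t) * (\<Sum>i<N. real (mult' i) * (5 * e i) ^ t))
     + ennreal (unit_ball_vol (real t) * (\<Sum>i<N. if i \<in> C then (5 * e i) ^ t else 0))"
    using add_mono[OF IH 1] by (simp add: distrib_right add.commute)
  also have "\<dots> = ennreal (unit_ball_vol (real t) *
     (\<Sum>i<N. real (mult' i) * (5 * e i) ^ t + (if i \<in> C then (5 * e i) ^ t else 0)))"
    using nn by (subst ennreal_plus[symmetric]) (auto simp: sum.distrib distrib_left)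
  also have "(\<Sum>i<N. real (mult' i) * (5 * e i) ^ t + (if i \<in> C then (5 * e i) ^ t else 0))
     = (\<Sum>i<N. real (mult i) * (5 * e i) ^ t)"
    using eC(3) by (intro sum.cong) (auto simp: mult'_def of_nat_diff Suc_leI algebra_simps)
  finally show ?case .
qed

text \<open>Real weights reduce to multiplicities by rounding \<open>M * w i\<close> up to an
  integer and dividing by \<open>M\<close>. The rounding costs at most \<open>S / M\<close>, which
  is below \<epsilon> for large \<open>M\<close>.\<close>

lemma hausdorff_content_weighted:
  fixes B :: "'a::euclidean_space set" and y :: "nat \<Rightarrow> 'a"
  assumes e: "\<And>i. i < N \<Longrightarrow> 0 < e i \<and> e i \<le> \<delta>" and w: "\<And>i. i < N \<Longrightarrow> 0 \<le> w i"
    and cov: "\<And>z. z \<in> B \<Longrightarrow> 1 \<le> (\<Sum>i<N. if z \<in> ball (y i) (e i) then w i else 0)"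
  shows "hausdorff_content dist UNIV (10 * \<delta>) t B
    \<le> ennreal (unit_ball_vol (real t) * (\<Sum>i<N. w i * (5 * e i) ^ t))"
proof (rule ennreal_le_epsilon)
  fix \<epsilon> :: real assume "0 < \<epsilon>"
  define S where "S = unit_ball_vol (real t) * (\<Sum>i<N. (5 * e i) ^ t)"
  have e0: "0 \<le> (5 * e i) ^ t" if "i < N" for i
    using e[OF that] by simp
  have S: "0 \<le> S"
    unfolding S_def by (intro mult_nonneg_nonneg sum_nonneg e0) auto
  obtain M :: nat where M: "S / \<epsilon> < real M"
    using reals_Archimedean2 by blast
  then have M0: "0 < real M" using S \<open>0 < \<epsilon>\<close> by (meson divide_nonneg_pos le_less_trans)
  define mult where "mult i = nat \<lceil>real M * w i\<rceil>" for i
  have m1: "real M * w i \<le> real (mult i)" for i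
    unfolding mult_def by linarith
  have m2: "real (mult i) \<le> real M * w i + 1" if "i < N" for i
  proof -
    have "0 \<le> real M * w i" using w that by simp
    then show ?thesis unfolding mult_def by linarith
  qed
  have "M \<le> (\<Sum>i<N. if z \<in> ball (y i) (e i) then mult i else 0)" if "z \<in> B" for z
  proof -
    have "real M \<le> real M * (\<Sum>i<N. if z \<in> ball (y i) (e i) then w i else 0)"
      using cov[OF that] M0 by simp
    also have "\<dots> \<le> (\<Sum>i<N. if z \<in> ball (y i) (e i) then real (mult i) else 0)"
      unfolding sum_distrib_left using m1 by (intro sum_mono) auto
    also have "\<dots> = real (\<Sum>i<N. if z \<in> ball (y i) (e i) then mult i else 0)"
      unfolding of_nat_sum by (intro sum.cong) auto
    finally show ?thesis by linarith
  qed
  then have "of_nat M * hausdorff_content dist UNIV (10 * \<delta>) t B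
    \<le> ennreal (unit_ball_vol (real t) * (\<Sum>i<N. real (mult i) * (5 * e i) ^ t))"
    by (intro hausdorff_content_multiplicity[OF e]) auto
  also have "\<dots> \<le> ennreal (real M * (unit_ball_vol (real t) * (\<Sum>i<N. w i * (5 * e i) ^ t) + \<epsilon>))"
  proof (rule ennreal_leI)
    have "(\<Sum>i<N. real (mult i) * (5 * e i) ^ t) \<le> (\<Sum>i<N. (real M * w i + 1) * (5 * e i) ^ t)"
      using m2 e by (intro sum_mono mult_right_mono) (auto simp: less_imp_le)
    also have "\<dots> = real M * (\<Sum>i<N. w i * (5 * e i) ^ t) + (\<Sum>i<N. (5 * e i) ^ t)"
      by (simp add: sum.distrib sum_distrib_left algebra_simps)
    finally have "unit_ball_vol (real t) * (\<Sum>i<N. real (mult i) * (5 * e i) ^ t)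
       \<le> unit_ball_vol (real t) * (real M * (\<Sum>i<N. w i * (5 * e i) ^ t) + (\<Sum>i<N. (5 * e i) ^ t))"
      by (intro mult_left_mono) auto
    also have "\<dots> = real M * (unit_ball_vol (real t) * (\<Sum>i<N. w i * (5 * e i) ^ t)) + S"
      by (simp add: S_def algebra_simps)
    also have "S \<le> real M * \<epsilon>"
      using M \<open>0 < \<epsilon>\<close> by (simp add: field_simps)
    finally show "unit_ball_vol (real t) * (\<Sum>i<N. real (mult i) * (5 * e i) ^ t)
      \<le> real M * (unit_ball_vol (real t) * (\<Sum>i<N. w i * (5 * e i) ^ t) + \<epsilon>)"
      by (simp add: distrib_left)
  qed
  also have "\<dots> = of_nat M * ennreal (unit_ball_vol (real t) * (\<Sum>i<N. w i * (5 * e i) ^ t) + \<epsilon>)"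
    by (simp add: ennreal_mult'  ennreal_of_nat_eq_real_of_nat)
  finally have "hausdorff_content dist UNIV (10 * \<delta>) t B
     \<le> ennreal (unit_ball_vol (real t) * (\<Sum>i<N. w i * (5 * e i) ^ t) + \<epsilon>)"
    using M0 by (simp add: ennreal_mult_le_mult_iff)
  also have "\<dots> = ennreal (unit_ball_vol (real t) * (\<Sum>i<N. w i * (5 * e i) ^ t)) + ennreal \<epsilon>"
    using \<open>0 < \<epsilon>\<close>
    by (intro ennreal_plus mult_nonneg_nonneg sum_nonneg e0 w) auto
  finally show "hausdorff_content dist UNIV (10 * \<delta>) t B
    \<le> ennreal (unit_ball_vol (real t) * (\<Sum>i<N. w i * (5 * e i) ^ t)) + ennreal \<epsilon>" .
qed

text \<open>Turns a diameter \<open>d\<close>, possibly 0, into the radius of an open ball that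
  contains all points at distance at most \<open>d\<close>, at an arbitrarily small cost in the
  radius and in its power.\<close>

lemma power_less_add:
  fixes d \<eta> \<delta> :: real
  assumes "0 < \<eta>" "0 < \<delta>"
  shows "\<exists>e>d. e \<le> d + \<delta> \<and> e ^ k \<le> d ^ k + \<eta>"
proof -
  have "isCont (\<lambda>x. x ^ k) d" by (intro continuous_intros)
  then obtain \<tau> where \<tau>: "\<tau> > 0" "\<And>x. dist x d < \<tau> \<Longrightarrow> dist (x ^ k) (d ^ k) < \<eta>"
    using assms(1) unfolding continuous_at_eps_delta by metis
  have "dist (d + min (\<tau> / 2) \<delta>) d < \<tau>"
    using \<tau>(1) assms by (auto simp: dist_real_def)
  from \<tau>(2)[OF this] show ?thesis
    using \<tau>(1) assms by (intro exI[of _ "d + min (\<tau> / 2) \<delta>"]) (auto simp: dist_real_def)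
qed

section \<open>Lower bounds for the Hausdorff measure of products\<close>

lemma
  shows dist_last_le_tuple_dist: "dist (x l) (y l) \<le> tuple_dist (Suc l) x y"
    and tuple_dist_restrict_le: "tuple_dist l (restrict x {..<l}) (restrict y {..<l}) \<le> tuple_dist (Suc l) x y"
proof -
  show "dist (x l) (y l) \<le> tuple_dist (Suc l) x y"
    unfolding tuple_dist_def by (rule member_le_L2_set[where i = l]) auto
  have "L2_set (\<lambda>i. dist (restrict x {..<l} i) (restrict y {..<l} i)) {..<l} = L2_set (\<lambda>i. dist (x i) (y i)) {..<l}"
    by (rule L2_set_cong) auto
  then show "tuple_dist l (restrict x {..<l}) (restrict y {..<l}) \<le> tuple_dist (Suc l) x y"
    by (auto simp: tuple_dist_def L2_set_def)
qed

text \<open>A point that reaches weight 1 after finitely many balls does so on the intersection of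
  those of them that contain it, which is open. Compactness then makes the number of balls uniform,
  as the weighted Vitali argument handles finite families only.\<close>

lemma compact_weighted_finite:
  fixes B :: "'a::metric_space set" and y :: "nat \<Rightarrow> 'a"
  assumes "compact B" "\<And>i. 0 \<le> w i"
    and cov: "\<And>z. z \<in> B \<Longrightarrow> \<exists>N. 1 \<le> (\<Sum>i<N. if z \<in> ball (y i) (e i) then w i else 0 :: real)"
  shows "\<exists>N. \<forall>z\<in>B. 1 \<le> (\<Sum>i<N. if z \<in> ball (y i) (e i) then w i else 0)"
proof -
  obtain n where n: "\<And>z. z \<in> B \<Longrightarrow> 1 \<le> (\<Sum>i<n z. if z \<in> ball (y i) (e i) then w i else 0)"
    using cov by metis
  define U where "U z = (\<Inter>i\<in>{i. i < n z \<and> z \<in> ball (y i) (e i)}. ball (y i) (e i))" for z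
  have "open (U z)" for z
    unfolding U_def by (intro open_INT) auto
  moreover have "B \<subseteq> (\<Union>z\<in>B. U z)"
    by (auto simp: U_def)
  ultimately obtain Z where Z: "Z \<subseteq> B" "finite Z" "B \<subseteq> (\<Union>z\<in>Z. U z)"
    using assms(1) by (metis compactE_image)
  obtain N where N: "\<And>z. z \<in> Z \<Longrightarrow> n z \<le> N"
    using Z(2) by (meson finite_nat_set_iff_bounded_le finite_imageI imageI)
  have "1 \<le> (\<Sum>i<N. if x \<in> ball (y i) (e i) then w i else 0)" if xB: "x \<in> B" for x
  proof -
    obtain z where z: "z \<in> Z" "x \<in> U z" using xB Z by blast
    have "1 \<le> (\<Sum>i<n z. if z \<in> ball (y i) (e i) then w i else 0)"
      using n z(1) Z(1) by blast
    also have "\<dots> \<le> (\<Sum>i<n z. if x \<in> ball (y i) (e i) then w i else 0)"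
      using z(2) assms(2) by (intro sum_mono) (auto simp: U_def)
    also have "\<dots> \<le> (\<Sum>i<N. if x \<in> ball (y i) (e i) then w i else 0)"
      using N[OF z(1)] assms(2) by (intro sum_mono2) auto
    finally show ?thesis .
  qed
  then show ?thesis by (intro exI[of _ N]) blast
qed

text \<open>
  Every fibre over a point of \<open>B\<close> of a covering of the product covers \<open>A\<close>. Hence the projections to
  \<open>B\<close> of the sets \<open>C\<^sub>i\<close> of the covering, with the weights \<open>(diam C\<^sub>i)\<^sup>s / a\<close>, form a weighted covering of \<open>B\<close>.
\<close>

lemma hausdorff_outer_tuples_Suc:
  fixes A :: "(nat \<Rightarrow> 'a::euclidean_space) set" and B :: "'a set"
  assumes A: "A \<subseteq> {..<l} \<rightarrow>\<^sub>E UNIV" and B: "compact B" and ab: "0 < a" "0 < b"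
    and HA: "ennreal a < hausdorff_outer (tuple_dist l) ({..<l} \<rightarrow>\<^sub>E UNIV) s A"
    and HB: "ennreal b < hausdorff t B"
    and K: "K = unit_ball_vol (real t) * (unit_ball_vol (real s) * 5 ^ t / 2 ^ s)"
  shows "ennreal (unit_ball_vol (real (s + t)) / (2 ^ (s + t + 1) * K) * (a * b)) \<le>
    hausdorff_outer (tuple_dist (Suc l)) ({..<Suc l} \<rightarrow>\<^sub>E UNIV) (s + t)
      {x \<in> {..<Suc l} \<rightarrow>\<^sub>E UNIV. restrict x {..<l} \<in> A \<and> x l \<in> B}"
proof -
  let ?d = "tuple_dist (Suc l) :: (nat \<Rightarrow> 'a) \<Rightarrow> _" and ?S = "{..<Suc l} \<rightarrow>\<^sub>E UNIV :: (nat \<Rightarrow> 'a) set"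
  let ?X = "{x \<in> {..<Suc l} \<rightarrow>\<^sub>E UNIV. restrict x {..<l} \<in> A \<and> x l \<in> B}"
  have Kpos: "0 < K" unfolding K by simp
  obtain \<delta>1 where \<delta>1: "0 < \<delta>1" "ennreal a < hausdorff_content (tuple_dist l) ({..<l} \<rightarrow>\<^sub>E UNIV) \<delta>1 s A"
    using HA by (rule less_hausdorff_outerE)
  obtain \<delta>2 where \<delta>2: "0 < \<delta>2" "ennreal b < hausdorff_content dist UNIV \<delta>2 t B"
    using HB by (rule less_hausdorff_outerE)
  \<comment> \<open>The radii \<open>e i\<close> below are at most \<open>2 * \<delta>\<close>:
    slices must be admissible for \<delta>1, and Vitali's balls, of diameter at most
    \<open>20 * \<delta>\<close>, for \<delta>2.\<close>
  define \<delta> where "\<delta> = min (\<delta>1 / 2) (\<delta>2 / 20)"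
  have \<delta>: "0 < \<delta>" "2 * \<delta> \<le> \<delta>1" "20 * \<delta> \<le> \<delta>2" using \<delta>1(1) \<delta>2(1) by (auto simp: \<delta>_def)
  \<comment> \<open>Bounds the total cost of enlarging the diameters of the covering; with this
    value half of \<open>a * b\<close> is left at the end.\<close>
  define \<eta> where "\<eta> = a * b / (2 * K)"
  have \<eta>: "0 < \<eta>" "K * \<eta> = a * b / 2" using ab Kpos by (auto simp: \<eta>_def)
  have "ennreal (unit_ball_vol (real (s + t)) / (2 ^ (s + t + 1) * K) * (a * b))
      \<le> (\<Sum>i. hausdorff_weight ?d (s + t) (C i))"
    if C: "C \<in> delta_covers ?d ?S \<delta> ?X" for C
  proof -
    define d where "d i = enn2real (ediam ?d (C i))" for i
    have ed_le: "ediam ?d (C i) \<le> ennreal \<delta>" for i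
      using C by (auto simp: delta_covers_def)
    have CS: "C i \<subseteq> ?S" for i using C by (auto simp: delta_covers_def)
    have cov: "?X \<subseteq> (\<Union>i. C i)" using C by (auto simp: delta_covers_def)
    have ed: "ediam ?d (C i) = ennreal (d i)" for i
      using ed_le[of i] unfolding d_def
      by (metis ennreal_enn2real ennreal_less_top le_less_trans)
    have d0: "0 \<le> d i" for i by (simp add: d_def)
    have d\<delta>: "d i \<le> \<delta>" for i using ed_le[of i] \<delta>(1) by (simp add: ed)
    have dC: "?d x x' \<le> d i" if "x \<in> C i" "x' \<in> C i" for x x' i
      using ediam_le_iff[OF d0[of i], of ?d "C i"] ed that by simp
    have "\<exists>e>d i. e \<le> d i + \<delta> \<and> e ^ (s + t) \<le> d i ^ (s + t) + \<eta> * (1 / 2) ^ Suc i" for i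
      using \<eta>(1) \<delta>(1) by (intro power_less_add) auto
    then obtain e where e: "\<And>i. d i < e i" "\<And>i. e i \<le> d i + \<delta>"
       "\<And>i. e i ^ (s + t) \<le> d i ^ (s + t) + \<eta> * (1 / 2) ^ Suc i" by metis
    have e0: "0 < e i" for i using e(1)[of i] d0[of i] by linarith
    have e2: "e i \<le> 2 * \<delta>" for i using e(2)[of i] d\<delta>[of i] by linarith
    \<comment> \<open>For empty \<open>C i\<close> the centre is arbitrary and the weight below is
      0. Otherwise the ball around \<open>y i\<close> contains the last entry of every tuple in
      \<open>C i\<close>, as its radius exceeds the diameter.\<close>
    define y where "y i = (SOME x. x \<in> C i) l" for i
    \<comment> \<open>A bound for the weight of any slice of \<open>C i\<close>, as a fraction of
      the lower bound \<open>a\<close> for the content of \<open>A\<close>.\<close>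
    define w where "w i = (if C i = {} then 0 else unit_ball_vol (real s) * (e i / 2) ^ s / a)" for i
    have w0: "0 \<le> w i" for i using e0[of i] ab by (auto simp: w_def)
    have "\<exists>N. 1 \<le> (\<Sum>i<N. if z \<in> ball (y i) (e i) then w i else 0)" if z: "z \<in> B" for z
    proof -
      \<comment> \<open>The slice of \<open>C i\<close> over the last entry \<open>z\<close>. It is
        empty unless \<open>z\<close> lies in the ball around \<open>y i\<close>, and the slices
        over \<open>z\<close> together cover \<open>A\<close>.\<close>
      define G where "G i = (\<lambda>x. restrict x {..<l}) ` {x \<in> C i. x l = z}" for i
      have G_le: "hausdorff_weight (tuple_dist l) s (G i)
          \<le> ennreal (if z \<in> ball (y i) (e i) then a * w i else 0)"
        and Ge: "ediam (tuple_dist l) (G i) \<le> ennreal (e i)" for i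
      proof -
        have "\<forall>x\<in>G i. \<forall>x'\<in>G i. tuple_dist l x x' \<le> e i"
        proof (intro ballI)
          fix x x' assume "x \<in> G i" "x' \<in> G i"
          then obtain u u' where u: "u \<in> C i" "u' \<in> C i" "x = restrict u {..<l}" "x' = restrict u' {..<l}"
            by (auto simp: G_def)
          then show "tuple_dist l x x' \<le> e i"
            using tuple_dist_restrict_le[of l u u'] dC[of u i u'] e(1)[of i] by simp
        qed
        then show Ge: "ediam (tuple_dist l) (G i) \<le> ennreal (e i)"
          using ediam_le_iff less_imp_le[OF e0] by blast
        show "hausdorff_weight (tuple_dist l) s (G i)
          \<le> ennreal (if z \<in> ball (y i) (e i) then a * w i else 0)"
        proof (cases "G i = {}")
          case False
          then obtain x where x: "x \<in> C i" "x l = z" by (auto simp: G_def)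
          from x(1) have "(SOME x. x \<in> C i) \<in> C i"
            unfolding some_in_eq by blast
          with x have "dist (y i) z \<le> d i"
            unfolding y_def by (metis dC dist_last_le_tuple_dist order_trans)
          then have "z \<in> ball (y i) (e i)" using e(1)[of i] by simp
          then show ?thesis
            using hausdorff_weight_le[OF Ge less_imp_le[OF e0]] x ab by (auto simp: w_def)
        qed simp
      qed
      have "ennreal a < hausdorff_content (tuple_dist l) ({..<l} \<rightarrow>\<^sub>E UNIV) \<delta>1 s A" by (rule \<delta>1)
      also have "\<dots> \<le> (\<Sum>i. hausdorff_weight (tuple_dist l) s (G i))"
      proof (rule hausdorff_content_le_suminf)
        show "G i \<subseteq> {..<l} \<rightarrow>\<^sub>E UNIV" for i
          by (auto simp: G_def PiE_def)
        show "ediam (tuple_dist l) (G i) \<le> ennreal \<delta>1" for i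
          using Ge[of i] e2[of i] \<delta>(2) by (meson ennreal_leI order_trans)
        show "A \<subseteq> (\<Union>i. G i)"
        proof
          fix \<alpha> assume \<alpha>: "\<alpha> \<in> A"
          then have ext: "\<alpha> \<in> {..<l} \<rightarrow>\<^sub>E UNIV" using A by blast
          have r: "restrict (\<alpha>(l := z)) {..<l} = \<alpha>"
            using ext by (auto simp: fun_eq_iff PiE_def extensional_def)
          have "\<alpha>(l := z) \<in> ?X"
            using \<alpha> z r ext by (auto simp: PiE_def extensional_def)
          then obtain i where "\<alpha>(l := z) \<in> C i" using cov by blast
          then have "\<alpha> \<in> G i" unfolding G_def using r by (intro image_eqI[where x="\<alpha>(l := z)"]) auto
          then show "\<alpha> \<in> (\<Union>i. G i)" by blast
        qed
      qed
      also have "\<dots> \<le> (\<Sum>i. ennreal (if z \<in> ball (y i) (e i) then a * w i else 0))"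
        by (intro suminf_le G_le) auto
      \<comment> \<open>Strictness of the bound by \<open>a\<close> is what makes a finite partial
        sum suffice.\<close>
      finally obtain N where "ennreal a < (\<Sum>i<N. ennreal (if z \<in> ball (y i) (e i) then a * w i else 0))"
        unfolding suminf_eq_SUP less_SUP_iff by auto
      also have "\<dots> = ennreal (\<Sum>i<N. if z \<in> ball (y i) (e i) then a * w i else 0)"
        using w0 ab by (intro sum_ennreal) auto
      finally have "a < (\<Sum>i<N. if z \<in> ball (y i) (e i) then a * w i else 0)"
        using ab by (simp add: ennreal_less_iff)
      also have "\<dots> = a * (\<Sum>i<N. if z \<in> ball (y i) (e i) then w i else 0)"
        unfolding sum_distrib_left by (intro sum.cong) auto
      finally show ?thesis using ab by (intro exI[of _ N]) auto
    qed
    then obtain N where N: "\<And>z. z \<in> B \<Longrightarrow> 1 \<le> (\<Sum>i<N. if z \<in> ball (y i) (e i) then w i else 0)"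
      using compact_weighted_finite[OF B, of w y e] w0 by blast
    define W where "W i = (if C i = {} then 0 else unit_ball_vol (real (s + t)) * (d i / 2) ^ (s + t))" for i
    have W: "hausdorff_weight ?d (s + t) (C i) = ennreal (W i)" for i
      using hausdorff_weight_eq[OF _ ed d0] by (auto simp: W_def)
    have W0: "0 \<le> W i" for i using d0[of i] by (simp add: W_def)
    have "ennreal b < hausdorff_content dist UNIV \<delta>2 t B" by (rule \<delta>2)
    also have "\<dots> \<le> hausdorff_content dist UNIV (10 * (2 * \<delta>)) t B"
      using \<delta>(3) by (intro hausdorff_content_antimono) auto
    also have "\<dots> \<le> ennreal (unit_ball_vol (real t) * (\<Sum>i<N. w i * (5 * e i) ^ t))"
      using e0 e2 w0 N by (intro hausdorff_content_weighted) auto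
    finally have "b < unit_ball_vol (real t) * (\<Sum>i<N. w i * (5 * e i) ^ t)"
      using ab by (simp add: ennreal_less_iff)
    then have "a * b < unit_ball_vol (real t) * (\<Sum>i<N. a * (w i * (5 * e i) ^ t))"
      using ab by (simp add: sum_distrib_left[symmetric] mult.left_commute)
    also have "\<dots> \<le> unit_ball_vol (real t) * (\<Sum>i<N. (unit_ball_vol (real s) * 5 ^ t / 2 ^ s) *
        (2 ^ (s + t) / unit_ball_vol (real (s + t)) * W i + \<eta> * (1 / 2) ^ Suc i))"
    proof (intro mult_left_mono sum_mono)
      fix i
      show "a * (w i * (5 * e i) ^ t) \<le> (unit_ball_vol (real s) * 5 ^ t / 2 ^ s) *
        (2 ^ (s + t) / unit_ball_vol (real (s + t)) * W i + \<eta> * (1 / 2) ^ Suc i)"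
      proof (cases "C i = {}")
        case True
        then show ?thesis using \<eta>(1) by (simp add: w_def W_def)
      next
        case False
        have nz: "unit_ball_vol (real (s + t)) \<noteq> 0"
          using unit_ball_vol_pos[of "real (s + t)"] by linarith
        have "a * (w i * (5 * e i) ^ t) = (unit_ball_vol (real s) * 5 ^ t / 2 ^ s) * e i ^ (s + t)"
          using False ab by (simp add: w_def power_add power_mult_distrib power_divide)
        also have "\<dots> \<le> (unit_ball_vol (real s) * 5 ^ t / 2 ^ s) * (d i ^ (s + t) + \<eta> * (1 / 2) ^ Suc i)"
          using e(3)[of i] by (intro mult_left_mono) auto
        also have "d i ^ (s + t) = 2 ^ (s + t) / unit_ball_vol (real (s + t)) * W i"
          using False nz by (simp add: W_def power_divide)
        finally show ?thesis .
      qed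
    qed simp
    also have "\<dots> = K * (2 ^ (s + t) / unit_ball_vol (real (s + t)) * (\<Sum>i<N. W i) + \<eta> * (\<Sum>i<N. (1 / 2) ^ Suc i))"
      unfolding K by (simp only: sum_distrib_left[symmetric] sum.distrib mult.assoc)
    also have "\<dots> \<le> K * (2 ^ (s + t) / unit_ball_vol (real (s + t)) * (\<Sum>i<N. W i) + \<eta> * 1)"
    proof -
      have "(\<Sum>i<N. (1 / 2) ^ Suc i) \<le> (1::real)"
        using sum_le_suminf[OF sums_summable[OF power_half_series], of "{..<N}"] sums_unique[OF power_half_series]
        by simp
      then show ?thesis using Kpos \<eta>(1) by (intro mult_left_mono add_left_mono) auto
    qed
    also have "\<dots> = K * (2 ^ (s + t) / unit_ball_vol (real (s + t)) * (\<Sum>i<N. W i)) + a * b / 2"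
      using \<eta>(2) by (simp add: distrib_left)
    finally have 1: "a * b / 2 < K * (2 ^ (s + t) / unit_ball_vol (real (s + t)) * (\<Sum>i<N. W i))"
      by linarith
    have "unit_ball_vol (real (s + t)) / (2 ^ (s + t + 1) * K) * (a * b) \<le> (\<Sum>i<N. W i)"
      using 1 Kpos unit_ball_vol_pos[of "real (s + t)"] by (simp add: field_simps)
    then have "ennreal (unit_ball_vol (real (s + t)) / (2 ^ (s + t + 1) * K) * (a * b)) \<le> (\<Sum>i<N. ennreal (W i))"
      using W0 by (subst sum_ennreal) (auto intro: ennreal_leI)
    also have "\<dots> \<le> (\<Sum>i. ennreal (W i))"
      by (intro sum_le_suminf) auto
    finally show ?thesis by (simp add: W)
  qed
  then have "ennreal (unit_ball_vol (real (s + t)) / (2 ^ (s + t + 1) * K) * (a * b))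
     \<le> hausdorff_content ?d ?S \<delta> (s + t) ?X"
    unfolding hausdorff_content_def by (rule INF_greatest)
  also have "\<dots> \<le> hausdorff_outer ?d ?S (s + t) ?X"
    by (rule hausdorff_content_le_outer[OF \<delta>(1)])
  finally show ?thesis .
qed

text \<open>Base case of the induction over the number of factors: with \<open>0 ^ 0 = 1\<close>
  every non-empty set has 0-dimensional weight 1, and some set of the covering contains
  \<open>x\<close>.\<close>

lemma hausdorff_outer_0_ge:
  assumes "x \<in> A"
  shows "1 \<le> hausdorff_outer d S 0 A"
proof -
  have "1 \<le> hausdorff_content d S 1 0 A"
    unfolding hausdorff_content_def
  proof (rule INF_greatest)
    fix C assume "C \<in> delta_covers d S 1 A"
    then obtain i :: nat where "x \<in> C i" using assms by (auto simp: delta_covers_def)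
    then have "1 = hausdorff_weight d 0 (C i)"
      by (auto simp: hausdorff_weight_def)
    also have "\<dots> = (\<Sum>j\<in>{i}. hausdorff_weight d 0 (C j))" by simp
    also have "\<dots> \<le> (\<Sum>j. hausdorff_weight d 0 (C j))"
      by (rule sum_le_suminf) auto
    finally show "1 \<le> (\<Sum>j. hausdorff_weight d 0 (C j))" .
  qed
  then show ?thesis using hausdorff_content_le_outer[of 1 d S 0 A] by simp
qed

text \<open>Induction on \<open>l\<close>, splitting off the last factor. The order of quantifiers
  matters: the constant does not depend on the sets or on \<open>b\<close>, so the same one serves
  at all small radii later.\<close>

lemma hausdorff_outer_tuples_box:
  "\<exists>c>0. \<forall>(B :: nat \<Rightarrow> 'a::euclidean_space set) b.
     (\<forall>i<l. compact (B i) \<and> 0 < b i \<and> ennreal (b i) < hausdorff m (B i)) \<longrightarrow>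
     ennreal (c * (\<Prod>i<l. b i)) \<le> hausdorff_outer (tuple_dist l) ({..<l} \<rightarrow>\<^sub>E UNIV) (m * l) (PiE {..<l} B)"
proof (induction l)
  case 0
  show ?case
    using hausdorff_outer_0_ge[of "\<lambda>_. undefined"] by (intro exI[of _ 1]) auto
next
  case (Suc l)
  then obtain c where c: "0 < c" "\<And>(B :: nat \<Rightarrow> 'a set) b.
     (\<forall>i<l. compact (B i) \<and> 0 < b i \<and> ennreal (b i) < hausdorff m (B i)) \<Longrightarrow>
     ennreal (c * (\<Prod>i<l. b i)) \<le> hausdorff_outer (tuple_dist l) ({..<l} \<rightarrow>\<^sub>E UNIV) (m * l) (PiE {..<l} B)"
    by blast
  define K where "K = unit_ball_vol (real m) * (unit_ball_vol (real (m * l)) * 5 ^ m / 2 ^ (m * l))"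
  \<comment> \<open>Half of \<open>c\<close> is given up in each step, since the product estimate
    needs strict lower bounds.\<close>
  define c' where "c' = unit_ball_vol (real (m * l + m)) / (2 ^ (m * l + m + 1) * K) * (c / 2)"
  have "0 < c'" using c(1) unit_ball_vol_pos[of "real (m * l + m)"]
    unfolding c'_def K_def by (intro mult_pos_pos divide_pos_pos) auto
  moreover have "ennreal (c' * (\<Prod>i<Suc l. b i))
      \<le> hausdorff_outer (tuple_dist (Suc l)) ({..<Suc l} \<rightarrow>\<^sub>E UNIV) (m * Suc l) (PiE {..<Suc l} B)"
    if B: "\<forall>i<Suc l. compact (B i) \<and> 0 < b i \<and> ennreal (b i) < hausdorff m (B i)" for B :: "nat \<Rightarrow> 'a set" and b
  proof -
    have p: "0 < (\<Prod>i<l. b i)" using B by (intro prod_pos) auto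
    have "ennreal (c / 2 * (\<Prod>i<l. b i)) < ennreal (c * (\<Prod>i<l. b i))"
      using c(1) p by (intro ennreal_lessI) auto
    also have "\<dots> \<le> hausdorff_outer (tuple_dist l) ({..<l} \<rightarrow>\<^sub>E UNIV) (m * l) (PiE {..<l} B)"
      using B by (intro c(2)) auto
    finally have "ennreal (unit_ball_vol (real (m * l + m)) / (2 ^ (m * l + m + 1) * K) * ((c / 2 * (\<Prod>i<l. b i)) * b l)) \<le>
      hausdorff_outer (tuple_dist (Suc l)) ({..<Suc l} \<rightarrow>\<^sub>E UNIV) (m * l + m)
      {x \<in> {..<Suc l} \<rightarrow>\<^sub>E UNIV. restrict x {..<l} \<in> PiE {..<l} B \<and> x l \<in> B l}"
      using B p c(1) by (intro hausdorff_outer_tuples_Suc[OF _ _ _ _ _ _ K_def]) (auto simp: PiE_mono)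
    also have "{x \<in> {..<Suc l} \<rightarrow>\<^sub>E UNIV. restrict x {..<l} \<in> PiE {..<l} B \<and> x l \<in> B l} = PiE {..<Suc l} B"
    proof (rule set_eqI)
      fix x :: "nat \<Rightarrow> 'a"
      have "restrict x {..<l} \<in> PiE {..<l} B \<longleftrightarrow> (\<forall>i<l. x i \<in> B i)"
        unfolding restrict_PiE_iff by blast
      then show "x \<in> {x \<in> {..<Suc l} \<rightarrow>\<^sub>E UNIV. restrict x {..<l} \<in> PiE {..<l} B \<and> x l \<in> B l}
          \<longleftrightarrow> x \<in> PiE {..<Suc l} B"
        unfolding PiE_iff lessThan_Suc by auto
    qed
    finally show ?thesis by (simp add: c'_def algebra_simps)
  qed
  ultimately show ?case by blast
qed

section \<open>Caratheodory's criterion\<close>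

text \<open>\<open>countably_subadditive\<close> speaks of disjoint families only; passing to
  \<open>disjointed A\<close> and using monotonicity removes this restriction.\<close>

lemma hausdorff_outer_subadditive_suminf:
  assumes "\<And>i. A i \<subseteq> S" "B \<subseteq> (\<Union>i. A i)"
  shows "hausdorff_outer d S s B \<le> (\<Sum>i. hausdorff_outer d S s (A i))"
proof -
  have "countably_subadditive (Pow S) (hausdorff_outer d S s)"
    using outer_measure_space_hausdorff_outer by (auto simp: outer_measure_space_def)
  moreover have dA: "disjointed A i \<subseteq> A i" for i by (rule disjointed_subset)
  then have "range (disjointed A) \<subseteq> Pow S" "(\<Union>i. disjointed A i) \<in> Pow S"
    using assms(1) by blast+
  ultimately have "hausdorff_outer d S s (\<Union>i. disjointed A i) \<le> (\<Sum>i. hausdorff_outer d S s (disjointed A i))"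
    using disjoint_family_disjointed[of A] unfolding countably_subadditive_def by blast
  also have "\<dots> \<le> (\<Sum>i. hausdorff_outer d S s (A i))"
    by (intro suminf_le hausdorff_outer_mono dA) auto
  finally show ?thesis
    using order_trans[OF hausdorff_outer_mono[OF assms(2)]] by (simp add: UN_disjointed_eq)
qed

lemma hausdorff_outer_empty [simp]: "hausdorff_outer d S s {} = 0"
  using outer_measure_space_hausdorff_outer[of S d s]
  by (auto simp: outer_measure_space_def positive_def)

lemma hausdorff_outer_Un_le:
  assumes "A \<subseteq> S" "B \<subseteq> S"
  shows "hausdorff_outer d S s (A \<union> B) \<le> hausdorff_outer d S s A + hausdorff_outer d S s B"
proof -
  let ?C = "\<lambda>i::nat. if i = 0 then A else if i = 1 then B else {}"
  have "hausdorff_outer d S s (A \<union> B) \<le> (\<Sum>i. hausdorff_outer d S s (?C i))"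
  proof (rule hausdorff_outer_subadditive_suminf)
    have "A \<subseteq> ?C 0" "B \<subseteq> ?C 1" by auto
    then show "A \<union> B \<subseteq> (\<Union>i. ?C i)" by blast
  qed (use assms in auto)
  also have "\<dots> = (\<Sum>i<2. hausdorff_outer d S s (?C i))"
    by (rule suminf_finite) auto
  also have "\<dots> = hausdorff_outer d S s A + hausdorff_outer d S s B"
    by (simp add: numeral_2_eq_2)
  finally show ?thesis .
qed

text \<open>A covering set of diameter at most \<delta> < \<eta> meets at most one of the two sets,
  so the covering splits into two.\<close>

lemma hausdorff_content_separated:
  assumes "\<delta> < \<eta>" "0 < \<delta>" and sep: "\<And>x y. x \<in> E \<Longrightarrow> y \<in> F \<Longrightarrow> \<eta> \<le> d x y"
  shows "hausdorff_content d S \<delta> s E + hausdorff_content d S \<delta> s F \<le> hausdorff_content d S \<delta> s (E \<union> F)"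
  unfolding hausdorff_content_def[of d S \<delta> s "E \<union> F"]
proof (rule INF_greatest)
  fix C assume C: "C \<in> delta_covers d S \<delta> (E \<union> F)"
  define G where "G X i = (if C i \<inter> X = {} then {} else C i)" for X i
  have "hausdorff_content d S \<delta> s X \<le> (\<Sum>i. hausdorff_weight d s (G X i))" if XEF: "X \<subseteq> E \<union> F" for X
  proof (rule hausdorff_content_le_suminf)
    show "G X i \<subseteq> S" "ediam d (G X i) \<le> ennreal \<delta>" for i
      using C by (auto simp: G_def delta_covers_def)
    show "X \<subseteq> (\<Union>i. G X i)"
    proof
      fix x assume x: "x \<in> X"
      then have "x \<in> (\<Union>i. C i)" using C XEF unfolding delta_covers_def by blast
      then obtain i where "x \<in> C i" by blast
      then have "x \<in> G X i" using x by (auto simp: G_def)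
      then show "x \<in> (\<Union>i. G X i)" by blast
    qed
  qed
  then have "hausdorff_content d S \<delta> s E + hausdorff_content d S \<delta> s F
      \<le> (\<Sum>i. hausdorff_weight d s (G E i)) + (\<Sum>i. hausdorff_weight d s (G F i))"
    by (intro add_mono) auto
  also have "\<dots> = (\<Sum>i. hausdorff_weight d s (G E i) + hausdorff_weight d s (G F i))"
    by (rule suminf_add) auto
  also have "\<dots> \<le> (\<Sum>i. hausdorff_weight d s (C i))"
  proof (intro suminf_le)
    fix i
    have "C i \<inter> E = {} \<or> C i \<inter> F = {}"
    proof (rule ccontr)
      assume "\<not> ?thesis"
      then obtain x y where xy: "x \<in> C i" "x \<in> E" "y \<in> C i" "y \<in> F" by blast
      have "ediam d (C i) \<le> ennreal \<delta>" using C by (auto simp: delta_covers_def)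
      then have "d x y \<le> \<delta>" using xy assms(2) ediam_le_iff[of \<delta> d "C i"] by auto
      then show False using sep[of x y] xy assms(1) by auto
    qed
    then show "hausdorff_weight d s (G E i) + hausdorff_weight d s (G F i) \<le> hausdorff_weight d s (C i)"
      by (auto simp: G_def)
  qed auto
  finally show "hausdorff_content d S \<delta> s E + hausdorff_content d S \<delta> s F
      \<le> (\<Sum>i. hausdorff_weight d s (C i))" .
qed

lemma hausdorff_outer_separated:
  assumes "0 < \<eta>" and sep: "\<And>x y. x \<in> E \<Longrightarrow> y \<in> F \<Longrightarrow> \<eta> \<le> d x y"
  shows "hausdorff_outer d S s E + hausdorff_outer d S s F \<le> hausdorff_outer d S s (E \<union> F)"
proof -
  have "hausdorff_content d S \<delta> s E + hausdorff_content d S \<delta>' s F \<le> hausdorff_outer d S s (E \<union> F)"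
    if "0 < \<delta>" "0 < \<delta>'" for \<delta> \<delta>'
  proof -
    define \<mu> where "\<mu> = min (min \<delta> \<delta>') (\<eta> / 2)"
    have \<mu>: "0 < \<mu>" "\<mu> \<le> \<delta>" "\<mu> \<le> \<delta>'" "\<mu> < \<eta>" using that assms(1) by (auto simp: \<mu>_def)
    have "hausdorff_content d S \<delta> s E + hausdorff_content d S \<delta>' s F
        \<le> hausdorff_content d S \<mu> s E + hausdorff_content d S \<mu> s F"
      using \<mu> by (intro add_mono hausdorff_content_antimono)
    also have "\<dots> \<le> hausdorff_content d S \<mu> s (E \<union> F)"
      using \<mu> sep by (intro hausdorff_content_separated) auto
    also have "\<dots> \<le> hausdorff_outer d S s (E \<union> F)"
      using \<mu> by (intro hausdorff_content_le_outer)
    finally show ?thesis .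
  qed
  then have 1: "hausdorff_content d S \<delta> s E + hausdorff_outer d S s F \<le> hausdorff_outer d S s (E \<union> F)"
    if "0 < \<delta>" for \<delta>
    unfolding hausdorff_outer_eq_SUP[of d S s F] using that
    by (subst ennreal_SUP_add_right) (auto intro!: SUP_least)
  show ?thesis
    unfolding hausdorff_outer_eq_SUP[of d S s E]
    by (subst ennreal_SUP_add_left[symmetric]) (auto intro!: SUP_least 1)
qed

text \<open>The part of \<open>E\<close> outside \<open>K\<close> is exhausted by the sets
  \<open>X j\<close> of points at distance at least \<open>1 / (j + 1)\<close> from
  \<open>K\<close>. The layers \<open>R j\<close> between these sets are separated as soon as
  another layer lies in between, so the layers of each parity have total measure at most that of
  \<open>E\<close>. As that is finite, the tail of the layers is negligible, and
  \<open>X (Suc N)\<close> has positive distance from \<open>K\<close>.\<close>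

lemma hausdorff_outer_caratheodory_le:
  assumes tri: "\<And>x y z. d x z \<le> d x y + d y z" and E: "E \<subseteq> S" "hausdorff_outer d S s E < \<infinity>"
    and K: "\<And>x. x \<in> S - K \<Longrightarrow> \<exists>\<epsilon>>0. \<forall>u\<in>K. \<epsilon> \<le> d x u" and sym: "\<And>x y. d x y = d y x"
  shows "hausdorff_outer d S s (E \<inter> K) + hausdorff_outer d S s (E - K) \<le> hausdorff_outer d S s E"
proof -
  let ?\<nu> = "hausdorff_outer d S s"
  define X where "X j = {x \<in> E. \<forall>u\<in>K. 1 / real (Suc j) \<le> d x u}" for j
  define R where "R j = X (Suc j) - X j" for j
  have fin: "?\<nu> A < \<infinity>" if "A \<subseteq> E" for A
    using hausdorff_outer_mono[OF that, of d S s] E(2) by (rule le_less_trans)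
  have XE: "X j \<subseteq> E" for j by (auto simp: X_def)
  have Xmono: "X j \<subseteq> X (Suc j)" for j
  proof -
    have "1 / real (Suc (Suc j)) \<le> 1 / real (Suc j)" by (simp add: frac_le)
    then show ?thesis by (auto simp: X_def intro: order_trans)
  qed
  have step: "?\<nu> (X k) + ?\<nu> (R (Suc k)) \<le> ?\<nu> (X (Suc (Suc k)))" for k
  proof -
    have "1 / real (Suc k) - 1 / real (Suc (Suc k)) \<le> d x y" if xy: "x \<in> X k" "y \<in> R (Suc k)" for x y
    proof -
      obtain u where u: "u \<in> K" "d y u < 1 / real (Suc (Suc k))"
        using xy(2) unfolding R_def X_def by (auto simp: not_le)
      have "1 / real (Suc k) \<le> d x u" using xy(1) u(1) by (auto simp: X_def)
      then show ?thesis using tri[of x u y] u(2) by linarith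
    qed
    moreover have "0 < 1 / real (Suc k) - 1 / real (Suc (Suc k))"
      by (simp add: frac_less2)
    ultimately have "?\<nu> (X k) + ?\<nu> (R (Suc k)) \<le> ?\<nu> (X k \<union> R (Suc k))"
      by (rule hausdorff_outer_separated[rotated])
    also have "\<dots> \<le> ?\<nu> (X (Suc (Suc k)))"
      using Xmono by (intro hausdorff_outer_mono) (auto simp: R_def)
    finally show ?thesis .
  qed
  \<comment> \<open>The offset \<open>q\<close> selects the parity of the layers.\<close>
  have sums: "(\<Sum>i<n. ?\<nu> (R (2 * i + 1 + q))) \<le> ?\<nu> (X (2 * n + q))" for n q
  proof (induction n)
    case (Suc n)
    then have "(\<Sum>i<Suc n. ?\<nu> (R (2 * i + 1 + q))) \<le> ?\<nu> (X (2 * n + q)) + ?\<nu> (R (Suc (2 * n + q)))"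
      by (simp add: add_right_mono)
    also have "\<dots> \<le> ?\<nu> (X (2 * Suc n + q))" using step[of "2 * n + q"] by simp
    finally show ?case .
  qed simp
  define r where "r i = enn2real (?\<nu> (R (Suc i)))" for i
  have RE: "R i \<subseteq> E" for i using XE by (auto simp: R_def)
  have r: "?\<nu> (R (Suc i)) = ennreal (r i)" for i
    using fin[OF RE, of "Suc i"] unfolding r_def by simp
  define v where "v = enn2real (?\<nu> E)"
  have v: "?\<nu> E = ennreal v" and v0: "0 \<le> v"
    using E(2) by (simp_all add: v_def)
  have "(\<Sum>i<n. r i) \<le> 2 * v" for n
  proof -
    have "ennreal (\<Sum>i<2 * n. r i) = (\<Sum>i<2 * n. ?\<nu> (R (Suc i)))"
      unfolding r by (rule sum_ennreal[symmetric]) (simp add: r_def)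
    also have "\<dots> = (\<Sum>i<n. ?\<nu> (R (2 * i + 1 + 0))) + (\<Sum>i<n. ?\<nu> (R (2 * i + 1 + 1)))"
      by (induction n) (auto simp: algebra_simps)
    also have "\<dots> \<le> ?\<nu> E + ?\<nu> E"
      by (intro add_mono order_trans[OF sums] hausdorff_outer_mono XE)
    also have "\<dots> = ennreal v + ennreal v" by (simp only: v)
    also have "\<dots> = ennreal (2 * v)"
      using v0 by (simp only: mult_2 ennreal_plus)
    finally have "(\<Sum>i<2 * n. r i) \<le> 2 * v" using v0 by (simp only: ennreal_le_iff mult_nonneg_nonneg zero_le_numeral)
    moreover have "(\<Sum>i<n. r i) \<le> (\<Sum>i<2 * n. r i)"
      by (rule sum_mono2) (simp_all add: r_def)
    ultimately show ?thesis by linarith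
  qed
  then have summ: "summable r"
    by (intro bounded_imp_summable[of r "2 * v"])
      (simp_all add: r_def lessThan_Suc_atMost[symmetric] del: sum.lessThan_Suc)
  show ?thesis
  proof (rule ennreal_le_epsilon)
    fix e :: real assume "0 < e"
    then obtain N where "norm (\<Sum>i. r (i + N)) < e"
      using suminf_exist_split[OF _ summ] by blast
    then have tail: "(\<Sum>i. r (i + N)) \<le> e" by simp
    have "E - K \<subseteq> (\<Union>j. X j)"
    proof
      fix x assume x: "x \<in> E - K"
      then obtain \<epsilon> where \<epsilon>: "0 < \<epsilon>" "\<forall>u\<in>K. \<epsilon> \<le> d x u" using K E(1) by blast
      obtain j where "1 / real (Suc j) < \<epsilon>" using nat_approx_posE[OF \<epsilon>(1)] by blast
      then have "x \<in> X j" using x \<epsilon>(2) by (force simp: X_def)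
      then show "x \<in> (\<Union>j. X j)" by blast
    qed
    moreover have "X j \<subseteq> X (Suc N) \<union> (\<Union>i. R (Suc (i + N)))" for j
    proof (induction j)
      case 0
      have "X 0 \<subseteq> X (Suc N)" using Xmono by (rule lift_Suc_mono_le) simp
      then show ?case by blast
    next
      case (Suc j)
      show ?case
      proof (cases "j \<le> N")
        case True
        have "X (Suc j) \<subseteq> X (Suc N)" using Xmono by (rule lift_Suc_mono_le) (use True in simp)
        then show ?thesis by blast
      next
        case False
        have "X (Suc j) \<subseteq> X j \<union> R j" by (auto simp: R_def)
        moreover have "R j = R (Suc ((j - Suc N) + N))" using False by simp
        then have "R j \<subseteq> (\<Union>i. R (Suc (i + N)))" by blast
        ultimately show ?thesis using Suc by blast
      qed
    qed
    ultimately have "E - K \<subseteq> X (Suc N) \<union> (\<Union>i. R (Suc (i + N)))" by blast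
    then have "?\<nu> (E - K) \<le> ?\<nu> (X (Suc N) \<union> (\<Union>i. R (Suc (i + N))))"
      by (rule hausdorff_outer_mono)
    also have "\<dots> \<le> ?\<nu> (X (Suc N)) + ?\<nu> (\<Union>i. R (Suc (i + N)))"
      using XE RE E(1) by (intro hausdorff_outer_Un_le) (auto simp: subset_iff)
    also have "?\<nu> (\<Union>i. R (Suc (i + N))) \<le> (\<Sum>i. ?\<nu> (R (Suc (i + N))))"
      using RE E(1) by (intro hausdorff_outer_subadditive_suminf) (auto simp: subset_iff)
    also have "\<dots> = ennreal (\<Sum>i. r (i + N))"
      unfolding r by (intro suminf_ennreal2 summable_ignore_initial_segment summ) (simp add: r_def)
    also have "\<dots> \<le> ennreal e" using tail by (rule ennreal_leI)
    finally have 1: "?\<nu> (E - K) \<le> ?\<nu> (X (Suc N)) + ennreal e" by (simp add: add_left_mono)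
    have "?\<nu> (E \<inter> K) + ?\<nu> (X (Suc N)) \<le> ?\<nu> (E \<inter> K \<union> X (Suc N))"
    proof (rule hausdorff_outer_separated[where \<eta> = "1 / real (Suc (Suc N))"])
      fix x y assume "x \<in> E \<inter> K" "y \<in> X (Suc N)"
      then show "1 / real (Suc (Suc N)) \<le> d x y" by (simp add: X_def sym[of x])
    qed simp
    also have "\<dots> \<le> ?\<nu> E" using XE by (intro hausdorff_outer_mono) auto
    finally have 2: "?\<nu> (E \<inter> K) + ?\<nu> (X (Suc N)) \<le> ?\<nu> E" .
    have "?\<nu> (E \<inter> K) + ?\<nu> (E - K) \<le> ?\<nu> (E \<inter> K) + (?\<nu> (X (Suc N)) + ennreal e)"
      using 1 by (rule add_left_mono)
    also have "\<dots> = (?\<nu> (E \<inter> K) + ?\<nu> (X (Suc N))) + ennreal e" by (simp add: add.assoc)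
    also have "\<dots> \<le> ?\<nu> E + ennreal e" using 2 by (rule add_right_mono)
    finally show "?\<nu> (E \<inter> K) + ?\<nu> (E - K) \<le> ?\<nu> E + ennreal e" .
  qed
qed

text \<open>The last hypothesis is closedness of \<open>K\<close> in \<open>S\<close>, put in terms
  of \<open>d\<close> since the space is given only by a carrier and a distance function.\<close>

lemma sets_hausdorff_measureI:
  assumes tri: "\<And>x y z. d x z \<le> d x y + d y z" and sym: "\<And>x y. d x y = d y x" and "K \<subseteq> S"
    and K: "\<And>x. x \<in> S - K \<Longrightarrow> \<exists>\<epsilon>>0. \<forall>u\<in>K. \<epsilon> \<le> d x u"
  shows "K \<in> sets (hausdorff_measure d S s)"
proof -
  let ?\<nu> = "hausdorff_outer d S s"
  have "?\<nu> (K \<inter> E) + ?\<nu> ((S - K) \<inter> E) = ?\<nu> E" if E: "E \<subseteq> S" for E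
  proof (rule antisym)
    have eq: "K \<inter> E = E \<inter> K" "(S - K) \<inter> E = E - K" using E by auto
    show "?\<nu> (K \<inter> E) + ?\<nu> ((S - K) \<inter> E) \<le> ?\<nu> E"
    proof (cases "?\<nu> E < \<infinity>")
      case True
      then show ?thesis unfolding eq
        using hausdorff_outer_caratheodory_le[OF tri E True K sym] by blast
    next
      case False
      then have "?\<nu> E = \<infinity>" by (metis infinity_ennreal_def top.not_eq_extremum)
      then show ?thesis by simp
    qed
    have "?\<nu> E = ?\<nu> (K \<inter> E \<union> (S - K) \<inter> E)" using E by (intro arg_cong[where f = ?\<nu>]) auto
    also have "\<dots> \<le> ?\<nu> (K \<inter> E) + ?\<nu> ((S - K) \<inter> E)"
      using E by (intro hausdorff_outer_Un_le) auto
    finally show "?\<nu> E \<le> ?\<nu> (K \<inter> E) + ?\<nu> ((S - K) \<inter> E)" .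
  qed
  then show ?thesis
    unfolding sets_hausdorff_measure lambda_system_def using assms(3) by auto
qed

lemma tuple_dist_sym: "tuple_dist l x y = tuple_dist l y x"
  by (simp add: tuple_dist_def dist_commute)

lemma tuple_dist_triangle: "tuple_dist l x z \<le> tuple_dist l x y + tuple_dist l y z"
proof -
  have "tuple_dist l x z \<le> L2_set (\<lambda>i. dist (x i) (y i) + dist (y i) (z i)) {..<l}"
    unfolding tuple_dist_def by (intro L2_set_mono dist_triangle) auto
  also have "\<dots> \<le> tuple_dist l x y + tuple_dist l y z"
    unfolding tuple_dist_def by (rule L2_set_triangle_ineq)
  finally show ?thesis .
qed

lemma dist_le_tuple_dist: "i < l \<Longrightarrow> dist (x i) (y i) \<le> tuple_dist l x y"
  unfolding tuple_dist_def by (rule member_le_L2_set) auto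

text \<open>A tuple outside a box of closed sets has an entry off its factor, and that entry alone
  keeps it away from the box.\<close>

lemma emeasure_hausdorff_tuples_box:
  fixes B :: "nat \<Rightarrow> 'a::metric_space set"
  assumes "\<And>i. i < l \<Longrightarrow> closed (B i)"
  shows "PiE {..<l} B \<in> sets (hausdorff_tuples l s)"
    and "emeasure (hausdorff_tuples l s) (PiE {..<l} B)
      = hausdorff_outer (tuple_dist l) ({..<l} \<rightarrow>\<^sub>E UNIV) s (PiE {..<l} B)"
proof -
  show *: "PiE {..<l} B \<in> sets (hausdorff_tuples l s)"
    unfolding hausdorff_tuples_def
  proof (rule sets_hausdorff_measureI[OF tuple_dist_triangle tuple_dist_sym])
    show "PiE {..<l} B \<subseteq> {..<l} \<rightarrow>\<^sub>E UNIV" by (rule PiE_mono) simp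
    fix x assume "x \<in> ({..<l} \<rightarrow>\<^sub>E UNIV) - PiE {..<l} B"
    then obtain i where i: "i < l" "x i \<notin> B i" by (auto simp: PiE_iff)
    then obtain \<epsilon> where \<epsilon>: "\<epsilon> > 0" "ball (x i) \<epsilon> \<subseteq> - B i"
      using assms[OF i(1)] by (metis ComplI open_Compl open_contains_ball)
    have "\<epsilon> \<le> tuple_dist l x u" if "u \<in> PiE {..<l} B" for u
    proof -
      have "u i \<in> B i" using that i(1) by (auto simp: PiE_iff)
      then have "u i \<notin> ball (x i) \<epsilon>" using \<epsilon>(2) by blast
      then show ?thesis using dist_le_tuple_dist[OF i(1), of x u] by (simp add: not_less)
    qed
    then show "\<exists>\<epsilon>>0. \<forall>u\<in>PiE {..<l} B. \<epsilon> \<le> tuple_dist l x u" using \<epsilon>(1) by blast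
  qed
  show "emeasure (hausdorff_tuples l s) (PiE {..<l} B)
      = hausdorff_outer (tuple_dist l) ({..<l} \<rightarrow>\<^sub>E UNIV) s (PiE {..<l} B)"
    using * unfolding hausdorff_tuples_def by (rule emeasure_hausdorff_measure)
qed

section \<open>Simplices\<close>

text \<open>Images of the covering sets are again a covering. The sets are cut down to
  \<open>A\<close> beforehand, as \<open>f\<close> is controlled only there.\<close>

lemma hausdorff_outer_nonexpansive:
  assumes f: "f ` A \<subseteq> S'" and le: "\<And>x y. x \<in> A \<Longrightarrow> y \<in> A \<Longrightarrow> d' (f x) (f y) \<le> d x y"
  shows "hausdorff_outer d' S' s (f ` A) \<le> hausdorff_outer d S s A"
  unfolding hausdorff_outer_eq_SUP
proof (rule SUP_mono)
  fix \<delta> :: real assume \<delta>: "\<delta> \<in> {0<..}"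
  have "hausdorff_content d' S' \<delta> s (f ` A) \<le> hausdorff_content d S \<delta> s A"
    unfolding hausdorff_content_def[of d]
  proof (rule INF_greatest)
    fix C assume C: "C \<in> delta_covers d S \<delta> A"
    have ed: "ediam d' (f ` (C i \<inter> A)) \<le> ediam d (C i)" for i
      unfolding ediam_def image_image
    proof (intro SUP_least)
      fix u v assume uv: "u \<in> C i \<inter> A" "v \<in> C i \<inter> A"
      then have "ennreal (d' (f u) (f v)) \<le> ennreal (d u v)" by (intro ennreal_leI le) auto
      also have "\<dots> \<le> (SUP y\<in>C i. ennreal (d u y))" using uv by (intro SUP_upper) auto
      also have "\<dots> \<le> (SUP x\<in>C i. SUP y\<in>C i. ennreal (d x y))"
        using uv by (intro SUP_upper[where f = "\<lambda>x. SUP y\<in>C i. ennreal (d x y)"]) auto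
      finally show "ennreal (d' (f u) (f v)) \<le> (SUP x\<in>C i. SUP y\<in>C i. ennreal (d x y))" .
    qed
    have "hausdorff_content d' S' \<delta> s (f ` A) \<le> (\<Sum>i. hausdorff_weight d' s (f ` (C i \<inter> A)))"
    proof (rule hausdorff_content_le_suminf)
      show "ediam d' (f ` (C i \<inter> A)) \<le> ennreal \<delta>" for i
        using ed[of i] C by (auto simp: delta_covers_def intro: order_trans)
      have "A \<subseteq> (\<Union>i. C i)" using C by (simp add: delta_covers_def)
      then show "f ` A \<subseteq> (\<Union>i. f ` (C i \<inter> A))" by blast
    qed (use f in auto)
    also have "\<dots> \<le> (\<Sum>i. hausdorff_weight d s (C i))"
    proof (intro suminf_le)
      fix i
      have "(ediam d' (f ` (C i \<inter> A)) / 2) ^ s \<le> (ediam d (C i) / 2) ^ s"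
        using ed[of i] by (intro power_mono divide_right_mono_ennreal) auto
      then show "hausdorff_weight d' s (f ` (C i \<inter> A)) \<le> hausdorff_weight d s (C i)"
        by (auto simp: hausdorff_weight_def intro: mult_left_mono)
    qed auto
    finally show "hausdorff_content d' S' \<delta> s (f ` A) \<le> (\<Sum>i. hausdorff_weight d s (C i))" .
  qed
  then show "\<exists>\<delta>'\<in>{0<..}. hausdorff_content d' S' \<delta> s (f ` A) \<le> hausdorff_content d S \<delta>' s A"
    using \<delta> by blast
qed

text \<open>A set of diameter \<open>d\<close> on the line lies in an interval of length
  \<open>d\<close>, and in dimension 1 the weight is exactly the diameter, the unit ball having
  length 2. The claim is then countable subadditivity of Lebesgue measure.\<close>

lemma hausdorff_interval_ge:
  fixes a b :: real
  assumes "a \<le> b"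
  shows "ennreal (b - a) \<le> hausdorff 1 {a..b}"
proof -
  have "ennreal (b - a) \<le> hausdorff_content dist UNIV 1 1 {a..b}"
    unfolding hausdorff_content_def
  proof (rule INF_greatest)
    fix C assume C: "C \<in> delta_covers dist UNIV 1 {a..b}"
    define d where "d i = enn2real (ediam dist (C i))" for i
    have ed: "ediam dist (C i) = ennreal (d i)" for i
    proof -
      have "ediam dist (C i) \<le> ennreal 1" using C by (auto simp: delta_covers_def)
      then have "ediam dist (C i) < top" by (rule le_less_trans) simp
      then show ?thesis by (simp add: d_def)
    qed
    have d0: "0 \<le> d i" for i by (simp add: d_def)
    have dC: "dist x y \<le> d i" if "x \<in> C i" "y \<in> C i" for x y i
      using ediam_le_iff[OF d0[of i], of dist "C i"] ed[of i] that by auto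
    define J where "J i = (if C i = {} then {} else {Inf (C i)..Inf (C i) + d i})" for i
    have CJ: "C i \<subseteq> J i" for i
    proof
      fix x assume x: "x \<in> C i"
      have "bdd_below (C i)"
      proof (rule bdd_belowI)
        fix y assume "y \<in> C i"
        then show "x - d i \<le> y" using dC[OF x, of y] by (auto simp: dist_real_def)
      qed
      then have "Inf (C i) \<le> x" using x by (rule cInf_lower[rotated])
      moreover have "x - d i \<le> Inf (C i)"
      proof (rule cInf_greatest)
        fix y assume "y \<in> C i"
        then show "x - d i \<le> y" using dC[OF x, of y] by (auto simp: dist_real_def)
      qed (use x in auto)
      ultimately show "x \<in> J i" using x by (auto simp: J_def)
    qed
    have "{a..b} \<subseteq> (\<Union>i. C i)" using C by (auto simp: delta_covers_def)
    then have sub: "{a..b} \<subseteq> (\<Union>i. J i)" using CJ by blast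
    have "ennreal (b - a) = emeasure lborel {a..b}" using assms by simp
    also have "\<dots> \<le> emeasure lborel (\<Union>i. J i)"
      using sub by (intro emeasure_mono) (auto simp: J_def)
    also have "\<dots> \<le> (\<Sum>i. emeasure lborel (J i))"
      by (intro emeasure_subadditive_countably) (auto simp: J_def)
    also have "\<dots> \<le> (\<Sum>i. hausdorff_weight dist 1 (C i))"
    proof (intro suminf_le)
      fix i
      show "emeasure lborel (J i) \<le> hausdorff_weight dist 1 (C i)"
        using d0[of i] hausdorff_weight_eq[OF _ ed d0, of i 1] by (simp add: J_def)
    qed auto
    finally show "ennreal (b - a) \<le> (\<Sum>i. hausdorff_weight dist 1 (C i))" .
  qed
  then show ?thesis
    using hausdorff_content_le_outer[of 1 dist UNIV 1 "{a..b}"] by simp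
qed

text \<open>The simplex is the cone from its last vertex over the preceding face. Cutting the cone
  parameter into \<open>N\<close> intervals multiplies the number of pieces by \<open>N\<close> and
  adds at most \<open>2 * R / N\<close> to their diameter.\<close>

lemma simplex_finite_cover:
  fixes x :: "nat \<Rightarrow> 'a::real_normed_vector"
  assumes "\<And>i. i \<le> k \<Longrightarrow> norm (x i) \<le> R" "0 < N"
  shows "\<exists>\<G>. finite \<G> \<and> card \<G> \<le> N ^ k \<and> convex hull (x ` {..k}) \<subseteq> \<Union>\<G> \<and>
    (\<forall>G\<in>\<G>. \<forall>y\<in>G. \<forall>y'\<in>G. norm y \<le> R \<and> dist y y' \<le> real k * (2 * R) / real N)"
  using assms(1)
proof (induction k)
  case 0
  then show ?case by (intro exI[of _ "{{x 0}}"]) auto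
next
  case (Suc k)
  then obtain \<G> where G: "finite \<G>" "card \<G> \<le> N ^ k" "convex hull (x ` {..k}) \<subseteq> \<Union>\<G>"
    "\<And>G y y'. G \<in> \<G> \<Longrightarrow> y \<in> G \<Longrightarrow> y' \<in> G \<Longrightarrow> norm y \<le> R \<and> dist y y' \<le> real k * (2 * R) / real N"
    by (metis (no_types, lifting) le_SucI)
  let ?a = "x (Suc k)"
  have a: "norm ?a \<le> R" using Suc.prems by simp
  define C where "C = (\<lambda>(j, G). {t *\<^sub>R ?a + (1 - t) *\<^sub>R y |t y. 0 \<le> t \<and> t \<le> 1 \<and> real j / N \<le> t \<and> t \<le> real (Suc j) / N \<and> y \<in> G})"
  let ?H = "C ` ({..<N} \<times> \<G>)"
  have "finite ?H" using G(1) by simp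
  moreover have "card ?H \<le> N ^ Suc k"
  proof -
    have "card ?H \<le> card ({..<N} \<times> \<G>)" using G(1) by (intro card_image_le) auto
    also have "\<dots> \<le> N ^ Suc k" using G(2) by (simp add: card_cartesian_product)
    finally show ?thesis .
  qed
  moreover have "convex hull (x ` {..Suc k}) \<subseteq> \<Union>?H"
  proof
    fix z assume "z \<in> convex hull (x ` {..Suc k})"
    then have "z \<in> convex hull (insert ?a (x ` {..k}))" by (simp add: atMost_Suc)
    then obtain u v y where z: "0 \<le> u" "0 \<le> v" "u + v = 1" "y \<in> convex hull (x ` {..k})" "z = u *\<^sub>R ?a + v *\<^sub>R y"
      by (subst (asm) convex_hull_insert) auto
    obtain g where g: "g \<in> \<G>" "y \<in> g" using z(4) G(3) by blast
    have v: "v = 1 - u" "u \<le> 1" using z by auto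
    \<comment> \<open>The minimum with \<open>N - 1\<close> puts the endpoint \<open>u = 1\<close>
      into the last interval.\<close>
    define j where "j = min (N - 1) (nat \<lfloor>u * N\<rfloor>)"
    have j: "j < N" using assms(2) by (auto simp: j_def)
    have "real j \<le> u * N"
    proof -
      have "real (nat \<lfloor>u * N\<rfloor>) \<le> u * N" using z(1) by (simp add: of_nat_floor)
      then show ?thesis by (auto simp: j_def)
    qed
    moreover have "u * N \<le> real (Suc j)"
    proof (cases "nat \<lfloor>u * N\<rfloor> \<le> N - 1")
      case True
      then have "j = nat \<lfloor>u * N\<rfloor>" by (simp add: j_def)
      then show ?thesis by linarith
    next
      case False
      then have "Suc j = N" using assms(2) by (simp add: j_def)
      then show ?thesis using v(2) by (simp add: mult_left_le_one_le z(1))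
    qed
    ultimately have "real j / N \<le> u" "u \<le> real (Suc j) / N"
      using assms(2) by (simp_all add: field_simps)
    then have "z \<in> C (j, g)" using z v g by (auto simp: C_def)
    then show "z \<in> \<Union>?H" using j g(1) by blast
  qed
  moreover have "norm z \<le> R \<and> dist z z' \<le> real (Suc k) * (2 * R) / real N"
    if H: "H \<in> ?H" "z \<in> H" "z' \<in> H" for H z z'
  proof -
    obtain j g where jg: "g \<in> \<G>" "H = C (j, g)" using H(1) by auto
    obtain t y where z: "z = t *\<^sub>R ?a + (1 - t) *\<^sub>R y" "0 \<le> t" "t \<le> 1" "real j / N \<le> t" "t \<le> real (Suc j) / N" "y \<in> g"
      using H(2) unfolding jg C_def by auto
    obtain t' y' where z': "z' = t' *\<^sub>R ?a + (1 - t') *\<^sub>R y'" "0 \<le> t'" "t' \<le> 1" "real j / N \<le> t'" "t' \<le> real (Suc j) / N" "y' \<in> g"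
      using H(3) unfolding jg C_def by auto
    have y: "norm y \<le> R" "norm y' \<le> R" "dist y y' \<le> real k * (2 * R) / real N"
      using G(4)[OF jg(1)] z z' by blast+
    have "norm z \<le> t * norm ?a + (1 - t) * norm y"
      unfolding z(1) using norm_triangle_ineq[of "t *\<^sub>R ?a" "(1 - t) *\<^sub>R y"] z by simp
    also have "\<dots> \<le> t * R + (1 - t) * R"
      using a y z by (intro add_mono mult_left_mono) auto
    finally have nz: "norm z \<le> R" by (simp add: algebra_simps)
    have tt: "\<bar>t - t'\<bar> \<le> 1 / N"
    proof -
      have "real (Suc j) / N = real j / N + 1 / N" by (simp add: add_divide_distrib)
      then show ?thesis using z z' by linarith
    qed
    have "z - z' = (t - t') *\<^sub>R ?a + (1 - t) *\<^sub>R (y - y') - (t - t') *\<^sub>R y'"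
      unfolding z z' by (simp add: algebra_simps)
    then have "dist z z' \<le> norm ((t - t') *\<^sub>R ?a) + norm ((1 - t) *\<^sub>R (y - y')) + norm ((t - t') *\<^sub>R y')"
      unfolding dist_norm by (metis norm_triangle_ineq4 norm_triangle_ineq add_right_mono order_trans)
    also have "\<dots> \<le> 1 / N * R + 1 * (real k * (2 * R) / real N) + 1 / N * R"
    proof -
      have "\<bar>t - t'\<bar> * norm ?a \<le> 1 / N * R" "\<bar>t - t'\<bar> * norm y' \<le> 1 / N * R"
        using tt a y by (intro mult_mono; simp)+
      moreover have "\<bar>1 - t\<bar> * norm (y - y') \<le> 1 * (real k * (2 * R) / real N)"
        using z y(3) by (intro mult_mono) (auto simp: dist_norm)
      ultimately show ?thesis by simp
    qed
    also have "\<dots> = real (Suc k) * (2 * R) / real N"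
      by (simp add: add_divide_distrib algebra_simps)
    finally show ?thesis using nz by simp
  qed
  ultimately show ?case by (intro exI[of _ ?H]) blast
qed

text \<open>\<open>enn2real\<close> sends infinity to 0, so a lower bound for the curvature
  presupposes that the simplex has finite measure. At most \<open>N ^ k\<close> pieces of diameter
  at most \<open>2 * k * R / N\<close> have a total weight bounded independently of
  \<open>N\<close>.\<close>

lemma hausdorff_simplex_finite:
  fixes x :: "nat \<Rightarrow> 'a::real_normed_vector"
  shows "hausdorff k (convex hull (x ` {..k})) < \<infinity>"
proof -
  define R where "R = (\<Sum>i\<le>k. norm (x i))"
  have R: "norm (x i) \<le> R" if "i \<le> k" for i
    unfolding R_def using that by (intro member_le_sum) auto
  have R0: "0 \<le> R" unfolding R_def by (rule sum_nonneg) simp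
  let ?c = "unit_ball_vol (real k) * (real k * R) ^ k"
  have "hausdorff_content dist UNIV \<delta> k (convex hull (x ` {..k})) \<le> ennreal ?c" if \<delta>: "0 < \<delta>" for \<delta>
  proof -
    obtain N :: nat where "real k * (2 * R) / \<delta> + 1 < real N" using reals_Archimedean2 by blast
    moreover have "0 \<le> real k * (2 * R) / \<delta>" using R0 \<delta> by simp
    ultimately have N: "0 < N" "real k * (2 * R) / \<delta> \<le> real N"
      by (auto intro: Nat.gr0I)
    then have N\<delta>: "real k * (2 * R) / real N \<le> \<delta>"
      using \<delta> by (simp add: field_simps)
    have "\<exists>\<G>. finite \<G> \<and> card \<G> \<le> N ^ k \<and> convex hull (x ` {..k}) \<subseteq> \<Union>\<G> \<and>
        (\<forall>G\<in>\<G>. \<forall>y\<in>G. \<forall>y'\<in>G. norm y \<le> R \<and> dist y y' \<le> real k * (2 * R) / real N)"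
      using R N(1) by (rule simplex_finite_cover)
    then obtain \<G> where G: "finite \<G>" "card \<G> \<le> N ^ k" "convex hull (x ` {..k}) \<subseteq> \<Union>\<G>"
      and G4: "\<forall>G\<in>\<G>. \<forall>y\<in>G. \<forall>y'\<in>G. norm y \<le> R \<and> dist y y' \<le> real k * (2 * R) / real N"
      by (elim exE conjE)
    have nn: "0 \<le> real k * (2 * R) / real N" using R0 by simp
    have ed: "ediam dist G \<le> ennreal (real k * (2 * R) / real N)" if "G \<in> \<G>" for G
      unfolding ediam_le_iff[OF nn] using G4 that by simp
    have "hausdorff_content dist UNIV \<delta> k (convex hull (x ` {..k})) \<le> (\<Sum>G\<in>\<G>. hausdorff_weight dist k G)"
      using G(1,3) order_trans[OF ed ennreal_leI[OF N\<delta>]] by (intro hausdorff_content_le_finite) auto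
    also have "\<dots> \<le> (\<Sum>G\<in>\<G>. ennreal (unit_ball_vol (real k) * (real k * (2 * R) / real N / 2) ^ k))"
      by (intro sum_mono hausdorff_weight_le ed nn)
    also have "\<dots> = ennreal (real (card \<G>) * (unit_ball_vol (real k) * (real k * R / real N) ^ k))"
      using R0 by (simp add: ennreal_mult ennreal_of_nat_eq_real_of_nat)
    also have "\<dots> \<le> ennreal ?c"
    proof (rule ennreal_leI)
      have "real (card \<G>) * (unit_ball_vol (real k) * (real k * R / real N) ^ k)
          \<le> real (N ^ k) * (unit_ball_vol (real k) * (real k * R / real N) ^ k)"
        using G(2) R0 by (intro mult_right_mono) (auto simp only: of_nat_le_iff, simp)
      also have "\<dots> = ?c" using N(1) by (simp add: power_divide)
      finally show "real (card \<G>) * (unit_ball_vol (real k) * (real k * R / real N) ^ k) \<le> ?c" .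
    qed
    finally show ?thesis .
  qed
  then have "hausdorff k (convex hull (x ` {..k})) \<le> ennreal ?c"
    unfolding hausdorff_outer_eq_SUP by (intro SUP_least) auto
  also have "\<dots> < \<infinity>" by simp
  finally show ?thesis .
qed

section \<open>Orthonormal frames and perturbations of nondegenerate simplices\<close>

definition orthonormal_upto :: "nat \<Rightarrow> (nat \<Rightarrow> 'a::real_inner) \<Rightarrow> bool" where
  "orthonormal_upto k e \<longleftrightarrow> (\<forall>i<k. \<forall>j<k. e i \<bullet> e j = (if i = j then 1 else 0))"

lemma inner_orthonormal_sum:
  assumes "orthonormal_upto k e" "j < k"
  shows "(\<Sum>i<k. c i *\<^sub>R e i) \<bullet> e j = c j"
proof -
  have "(\<Sum>i<k. c i *\<^sub>R e i) \<bullet> e j = (\<Sum>i<k. if i = j then c i else 0)"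
    using assms by (simp add: inner_sum_left orthonormal_upto_def) (simp add: if_distrib cong: if_cong)
  then show ?thesis using assms(2) by simp
qed

lemma inner_orthonormal_residual:
  assumes "orthonormal_upto k e" "j < k"
  shows "(w - (\<Sum>i<k. (w \<bullet> e i) *\<^sub>R e i)) \<bullet> e j = 0"
  using inner_orthonormal_sum[OF assms] by (simp add: inner_diff_left)

lemma bessel:
  assumes "orthonormal_upto k e"
  shows "(\<Sum>i<k. (w \<bullet> e i)\<^sup>2) \<le> (norm w)\<^sup>2"
proof -
  let ?p = "\<Sum>i<k. (w \<bullet> e i) *\<^sub>R e i"
  have pw: "w \<bullet> ?p = (\<Sum>i<k. (w \<bullet> e i)\<^sup>2)"
    by (simp add: inner_sum_right power2_eq_square)
  have "?p \<bullet> ?p = (\<Sum>i<k. (w \<bullet> e i) * (?p \<bullet> e i))"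
    by (simp only: inner_sum_right inner_scaleR_right)
  also have "\<dots> = (\<Sum>i<k. (w \<bullet> e i)\<^sup>2)"
    using inner_orthonormal_sum[OF assms] by (intro sum.cong) (auto simp: power2_eq_square)
  finally have pp: "?p \<bullet> ?p = (\<Sum>i<k. (w \<bullet> e i)\<^sup>2)" .
  have "0 \<le> (w - ?p) \<bullet> (w - ?p)" by simp
  also have "\<dots> = w \<bullet> w - 2 * (w \<bullet> ?p) + ?p \<bullet> ?p"
    by (simp add: inner_diff_left inner_diff_right inner_commute)
  finally show ?thesis using pw pp by (simp add: power2_norm_eq_inner)
qed

text \<open>
  Greedy choice of a frame: \<open>p j\<close> maximises over \<open>F\<close> the distance to the affine hull of \<open>x, p 0, \<dots>, p (j - 1)\<close>.
\<close>

lemma greedy_frame: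
  fixes F :: "'a::euclidean_space set"
  assumes F: "compact F" "F \<noteq> {}" and \<eta>: "0 < \<eta>"
    and far: "\<And>j e. j < k \<Longrightarrow> orthonormal_upto j e \<Longrightarrow>
      \<exists>z\<in>F. \<eta> \<le> norm (z - x - (\<Sum>i<j. ((z - x) \<bullet> e i) *\<^sub>R e i))"
  shows "\<exists>e h p. orthonormal_upto k e \<and>
    (\<forall>j<k. p j \<in> F \<and> \<eta> \<le> h j \<and> (p j - x) \<bullet> e j = h j \<and>
       p j - x = (\<Sum>i<Suc j. ((p j - x) \<bullet> e i) *\<^sub>R e i) \<and> (\<forall>z\<in>F. \<bar>(z - x) \<bullet> e j\<bar> \<le> h j))"
  using far
proof (induction k)
  case 0
  then show ?case by (simp add: orthonormal_upto_def)
next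
  case (Suc k)
  have "\<exists>e h p. orthonormal_upto k e \<and>
    (\<forall>j<k. p j \<in> F \<and> \<eta> \<le> h j \<and> (p j - x) \<bullet> e j = h j \<and>
       p j - x = (\<Sum>i<Suc j. ((p j - x) \<bullet> e i) *\<^sub>R e i) \<and> (\<forall>z\<in>F. \<bar>(z - x) \<bullet> e j\<bar> \<le> h j))"
    by (rule Suc.IH) (rule Suc.prems, simp_all)
  then obtain e h p where e: "orthonormal_upto k e" and
    p: "\<forall>j<k. p j \<in> F \<and> \<eta> \<le> h j \<and> (p j - x) \<bullet> e j = h j \<and>
       p j - x = (\<Sum>i<Suc j. ((p j - x) \<bullet> e i) *\<^sub>R e i) \<and> (\<forall>z\<in>F. \<bar>(z - x) \<bullet> e j\<bar> \<le> h j)"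
    by (elim exE conjE)
  define R where "R z = z - x - (\<Sum>i<k. ((z - x) \<bullet> e i) *\<^sub>R e i)" for z
  have Re: "R z \<bullet> e j = 0" if "j < k" for z j
    unfolding R_def by (rule inner_orthonormal_residual[OF e that])
  have "continuous_on F (\<lambda>z. norm (R z))" unfolding R_def by (intro continuous_intros)
  then obtain q where q: "q \<in> F" "\<And>z. z \<in> F \<Longrightarrow> norm (R z) \<le> norm (R q)"
    using continuous_attains_sup[OF F] by blast
  define H where "H = norm (R q)"
  have H: "\<eta> \<le> H" using Suc.prems[of k e] e q(2) unfolding H_def R_def by (force intro: order_trans)
  then have H0: "0 < H" using \<eta> by simp
  \<comment> \<open>The new axis is the direction of the largest residual. Along it a point of
    \<open>F\<close> has the same component as its own residual, hence at most \<open>H\<close> in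
    absolute value.\<close>
  define e' where "e' = e(k := R q /\<^sub>R H)"
  have e'k: "e' k = R q /\<^sub>R H" and e'j: "\<And>j. j < k \<Longrightarrow> e' j = e j" by (simp_all add: e'_def)
  have e'R: "w \<bullet> e' k = (w \<bullet> R q) / H" for w by (simp add: e'k divide_inverse mult.commute)
  have kk: "e' k \<bullet> e' k = 1"
    using H0 by (simp add: e'k H_def power2_norm_eq_inner[symmetric] power2_eq_square)
  have ek: "e j \<bullet> e' k = 0" if "j < k" for j
    using Re[OF that, of q] unfolding e'R by (simp add: inner_commute)
  have on: "orthonormal_upto (Suc k) e'"
    using e kk ek unfolding orthonormal_upto_def
    by (auto simp: less_Suc_eq e'j inner_commute)
  have inner_k: "(z - x) \<bullet> e' k = R z \<bullet> e' k" for z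
    using ek by (simp add: R_def inner_diff_left inner_sum_left)
  have sums: "(\<Sum>i<Suc j. (w \<bullet> e' i) *\<^sub>R e' i) = (\<Sum>i<Suc j. (w \<bullet> e i) *\<^sub>R e i)" if "j < k" for j w
    using that by (intro sum.cong) (auto simp: e'j)
  define p' where "p' = p(k := q)"
  define h' where "h' = h(k := H)"
  have "p' j \<in> F \<and> \<eta> \<le> h' j \<and> (p' j - x) \<bullet> e' j = h' j \<and>
       p' j - x = (\<Sum>i<Suc j. ((p' j - x) \<bullet> e' i) *\<^sub>R e' i) \<and> (\<forall>z\<in>F. \<bar>(z - x) \<bullet> e' j\<bar> \<le> h' j)"
    if "j < Suc k" for j
  proof (cases "j < k")
    case True
    then have ph: "p' j = p j" "h' j = h j" by (auto simp: p'_def h'_def)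
    show ?thesis
      unfolding ph sums[OF True] e'j[OF True] by (rule p[rule_format, OF True])
  next
    case False
    then have jk: "j = k" using that by simp
    have qk: "(q - x) \<bullet> e' k = H"
      using H0 by (subst inner_k) (simp add: e'R H_def power2_norm_eq_inner[symmetric] power2_eq_square)
    have "(\<Sum>i<k. ((q - x) \<bullet> e' i) *\<^sub>R e' i) = (\<Sum>i<k. ((q - x) \<bullet> e i) *\<^sub>R e i)"
      by (intro sum.cong) (auto simp: e'j)
    moreover have "H *\<^sub>R e' k = R q" using H0 by (simp add: e'k)
    ultimately have qs: "q - x = (\<Sum>i<Suc k. ((q - x) \<bullet> e' i) *\<^sub>R e' i)"
      by (simp add: qk R_def)
    have "\<bar>(z - x) \<bullet> e' k\<bar> \<le> H" if "z \<in> F" for z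
    proof -
      have "\<bar>(z - x) \<bullet> e' k\<bar> \<le> norm (R z) * norm (e' k)"
        unfolding inner_k by (rule Cauchy_Schwarz_ineq2)
      also have "norm (e' k) = 1" using kk by (simp add: norm_eq_sqrt_inner)
      also have "norm (R z) * 1 \<le> H" using q(2)[OF that] by (simp add: H_def)
      finally show ?thesis .
    qed
    then show ?thesis using q(1) H qk qs by (simp add: jk p'_def h'_def del: sum.lessThan_Suc)
  qed
  then show ?case using on by blast
qed

text \<open>Back substitution: each step at most doubles the sum obtained so far and adds
  \<tau>.\<close>

lemma sum_power2_bound:
  fixes s u :: "nat \<Rightarrow> real"
  assumes "\<And>j. j < k \<Longrightarrow> \<bar>u j\<bar> \<le> \<tau> + (\<Sum>i<j. \<bar>u i\<bar>)" "0 \<le> \<tau>"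
  shows "(\<Sum>i<k. \<bar>u i\<bar>) \<le> (2 ^ k - 1) * \<tau>"
  using assms(1)
proof (induction k)
  case (Suc k)
  have "(\<Sum>i<k. \<bar>u i\<bar>) \<le> (2 ^ k - 1) * \<tau>" using Suc by simp
  moreover have "\<bar>u k\<bar> \<le> \<tau> + (\<Sum>i<k. \<bar>u i\<bar>)" using Suc.prems by simp
  ultimately show ?case by (simp add: algebra_simps)
qed simp

text \<open>
  In the coordinates \<open>(y - x) \<bullet> e i / h i\<close> the simplex is a perturbation of one whose edge vectors
  form a unit triangular matrix with entries bounded by \<open>1\<close>. A point near its barycentre that is missed
  by the perturbed simplex would be separated by a functional which back substitution shows to be zero.
\<close>

lemma perturbed_simplex_contains_box:
  fixes x :: "'a::euclidean_space" and z :: "nat \<Rightarrow> 'a"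
  assumes e: "orthonormal_upto k e" and h: "\<And>i. i < k \<Longrightarrow> 0 < h i"
    and v: "\<And>j. j < k \<Longrightarrow> v j \<bullet> e j = h j" "\<And>i j. j < i \<Longrightarrow> i < k \<Longrightarrow> v j \<bullet> e i = 0"
      "\<And>i j. i < k \<Longrightarrow> j < k \<Longrightarrow> \<bar>v j \<bullet> e i\<bar> \<le> h i"
    and \<rho>: "\<rho> = 1 / (2 ^ (k + 2) * (real k + 1))"
    and z0: "\<And>i. i < k \<Longrightarrow> \<bar>(z 0 - x) \<bullet> e i\<bar> \<le> \<rho> * h i"
    and z: "\<And>i j. i < k \<Longrightarrow> j < k \<Longrightarrow> \<bar>(z (Suc j) - x - v j) \<bullet> e i\<bar> \<le> \<rho> * h i"
    and q: "\<And>i. i < k \<Longrightarrow> \<bar>q i - (\<Sum>j<k. v j \<bullet> e i) / (real k + 1)\<bar> \<le> \<rho> * h i"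
  shows "\<exists>y\<in>convex hull (z ` {..k}). \<forall>i<k. (y - x) \<bullet> e i = q i"
proof -
  define P where "P y = (\<Sum>i<k. ((y - x) \<bullet> e i / h i) *\<^sub>R e i)" for y
  define Q where "Q = (\<Sum>i<k. (q i / h i) *\<^sub>R e i)"
  have Pe: "P y \<bullet> e i = (y - x) \<bullet> e i / h i" if "i < k" for y i
    unfolding P_def using inner_orthonormal_sum[OF e that] by simp
  have Qe: "Q \<bullet> e i = q i / h i" if "i < k" for i
    unfolding Q_def using inner_orthonormal_sum[OF e that] by simp
  have "Q \<in> P ` (convex hull (z ` {..k}))"
  proof (rule ccontr)
    assume nQ: "Q \<notin> P ` (convex hull (z ` {..k}))"
    have "compact (convex hull (z ` {..k}))"
      by (intro finite_imp_compact_convex_hull) simp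
    moreover have "continuous_on (convex hull (z ` {..k})) P"
      unfolding P_def using h by (intro continuous_intros) (auto simp: less_imp_neq[symmetric])
    ultimately have "compact (P ` (convex hull (z ` {..k})))"
      by (rule compact_continuous_image[rotated])
    moreover have "convex (P ` (convex hull (z ` {..k})))"
    proof -
      define L where "L y = (\<Sum>i<k. (y \<bullet> e i / h i) *\<^sub>R e i)" for y
      have "linear L"
        unfolding L_def
        by (intro linearI) (simp_all add: inner_add_left add_divide_distrib scaleR_add_left sum.distrib scaleR_sum_right)
      then have "convex (L ` ((\<lambda>y. - x + y) ` (convex hull (z ` {..k}))))"
        by (intro convex_linear_image convex_translation convex_convex_hull)
      moreover have "L ` ((\<lambda>y. - x + y) ` (convex hull (z ` {..k}))) = P ` (convex hull (z ` {..k}))"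
        by (simp add: image_image P_def L_def)
      ultimately show ?thesis by simp
    qed
    ultimately obtain a b where ab: "a \<bullet> Q < b" "\<forall>y\<in>P ` (convex hull (z ` {..k})). b < a \<bullet> y"
      using nQ separating_hyperplane_closed_point[of "P ` (convex hull (z ` {..k}))" Q] compact_imp_closed by blast
    define u where "u i = a \<bullet> e i" for i
    define U where "U = (\<Sum>i<k. \<bar>u i\<bar>)"
    have U0: "0 \<le> U" unfolding U_def by (rule sum_nonneg) simp
    have less: "a \<bullet> Q < a \<bullet> P (z j)" if "j \<le> k" for j
    proof -
      have "z j \<in> convex hull (z ` {..k})" using that by (intro hull_inc) auto
      then show ?thesis using ab by force
    qed
    have aP: "a \<bullet> P y = (\<Sum>i<k. u i * ((y - x) \<bullet> e i / h i))" for y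
      unfolding P_def u_def by (simp add: inner_sum_right mult.commute)
    have aQ: "a \<bullet> Q = (\<Sum>i<k. u i * (q i / h i))"
      unfolding Q_def u_def by (simp add: inner_sum_right mult.commute)
    define T where "T j i = (v j \<bullet> e i) / h i" for j i
    define s where "s j = (\<Sum>i<k. u i * T j i)" for j
    have pert: "\<bar>(\<Sum>i<k. u i * (c i / h i)) - (\<Sum>i<k. u i * (c' i / h i))\<bar> \<le> \<rho> * U"
      if "\<And>i. i < k \<Longrightarrow> \<bar>c i - c' i\<bar> \<le> \<rho> * h i" for c c'
    proof -
      have "\<bar>(\<Sum>i<k. u i * (c i / h i)) - (\<Sum>i<k. u i * (c' i / h i))\<bar> = \<bar>\<Sum>i<k. u i * ((c i - c' i) / h i)\<bar>"
        by (simp add: sum_subtractf[symmetric] diff_divide_distrib right_diff_distrib)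
      also have "\<dots> \<le> (\<Sum>i<k. \<bar>u i * ((c i - c' i) / h i)\<bar>)" by (rule sum_abs)
      also have "\<dots> \<le> (\<Sum>i<k. \<bar>u i\<bar> * \<rho>)"
      proof (rule sum_mono)
        fix i assume "i \<in> {..<k}"
        then have "\<bar>(c i - c' i) / h i\<bar> \<le> \<rho>"
          using that[of i] h[of i] by (simp add: abs_divide pos_divide_le_eq)
        then show "\<bar>u i * ((c i - c' i) / h i)\<bar> \<le> \<bar>u i\<bar> * \<rho>"
          unfolding abs_mult by (rule mult_left_mono) simp
      qed
      also have "\<dots> = \<rho> * U" by (simp add: U_def sum_distrib_left mult.commute)
      finally show ?thesis .
    qed
    \<comment> \<open>The value of \<open>a\<close> at the barycentre of the unperturbed simplex,
      relative to \<open>x\<close>: of its \<open>k + 1\<close> vertices the one at \<open>x\<close>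
      contributes 0 and the others \<open>s j\<close>.\<close>
    define S where "S = (\<Sum>j<k. s j) / (real k + 1)"
    have "(\<Sum>i<k. u i * (((\<Sum>j<k. v j \<bullet> e i) / (real k + 1)) / h i)) = S"
    proof -
      have "S = (\<Sum>i<k. \<Sum>j<k. u i * T j i) / (real k + 1)"
        unfolding S_def s_def by (subst sum.swap) simp
      also have "\<dots> = (\<Sum>i<k. (\<Sum>j<k. u i * T j i) / (real k + 1))"
        by (rule sum_divide_distrib)
      also have "\<dots> = (\<Sum>i<k. u i * (((\<Sum>j<k. v j \<bullet> e i) / (real k + 1)) / h i))"
        by (intro sum.cong)
          (simp_all add: T_def sum_distrib_left[symmetric] sum_divide_distrib[symmetric] mult.commute)
      finally show ?thesis by simp
    qed
    with pert[OF q] have Q1: "\<bar>a \<bullet> Q - S\<bar> \<le> \<rho> * U" by (simp add: aQ)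
    have P0: "\<bar>a \<bullet> P (z 0)\<bar> \<le> \<rho> * U"
      using pert[of "\<lambda>i. (z 0 - x) \<bullet> e i" "\<lambda>i. 0"] z0 by (simp add: aP)
    have Pj: "\<bar>a \<bullet> P (z (Suc j)) - s j\<bar> \<le> \<rho> * U" if "j < k" for j
      using pert[of "\<lambda>i. (z (Suc j) - x) \<bullet> e i" "\<lambda>i. v j \<bullet> e i"] z[OF _ that]
      by (simp add: aP s_def T_def inner_diff_left)
    \<comment> \<open>An error \<open>\<rho> * U\<close> arises once for \<open>Q\<close> and once
      for a vertex. Back substitution will give
      \<open>U \<le> 2 ^ k * ((real k + 1) * \<tau>)\<close>, and \<rho> is chosen such that the
      right-hand side equals \<open>U / 2\<close>.\<close>
    define \<tau> where "\<tau> = 2 * \<rho> * U"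
    have \<rho>0: "0 < \<rho>" unfolding \<rho> by simp
    have \<tau>0: "0 \<le> \<tau>" using U0 \<rho>0 by (simp add: \<tau>_def)
    have S\<tau>: "S < \<tau>" using less[of 0] Q1 P0 by (simp add: \<tau>_def)
    have s\<tau>: "S - \<tau> < s j" if "j < k" for j
      using less[of "Suc j"] Q1 Pj[OF that] that by (simp add: \<tau>_def)
    have Ssum: "(real k + 1) * S = (\<Sum>j<k. s j)" by (simp add: S_def)
    have "real k * (S - \<tau>) \<le> (\<Sum>j<k. s j)"
      using sum_bounded_below[of "{..<k}" "S - \<tau>" s] s\<tau> by (simp add: less_imp_le)
    then have Slow: "- (real k * \<tau>) \<le> S" using Ssum by (simp add: algebra_simps)
    \<comment> \<open>All values exceed \<open>S - \<tau>\<close> and their sum is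
      \<open>(k + 1) * S\<close>; so each single value is bounded above as well as below.\<close>
    have sabs: "\<bar>s j\<bar> \<le> (real k + 1) * \<tau>" if j: "j < k" for j
    proof -
      have "(\<Sum>i<k. s i) = s j + (\<Sum>i\<in>{..<k} - {j}. s i)" using j by (intro sum.remove) auto
      moreover have "real (card ({..<k} - {j})) * (S - \<tau>) \<le> (\<Sum>i\<in>{..<k} - {j}. s i)"
        using sum_bounded_below[of "{..<k} - {j}" "S - \<tau>" s] s\<tau> by (simp add: less_imp_le)
      moreover have "real (card ({..<k} - {j})) = real k - 1" using j by (simp add: of_nat_diff)
      ultimately have "s j \<le> (real k + 1) * S - (real k - 1) * (S - \<tau>)" using Ssum by simp
      also have "\<dots> = 2 * S + (real k - 1) * \<tau>" by (simp add: algebra_simps)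
      also have "\<dots> \<le> (real k + 1) * \<tau>" using S\<tau> by (simp add: algebra_simps)
      finally show ?thesis using s\<tau>[OF j] Slow by (simp add: algebra_simps abs_le_iff)
    qed
    have "\<bar>u j\<bar> \<le> (real k + 1) * \<tau> + (\<Sum>i<j. \<bar>u i\<bar>)" if j: "j < k" for j
    proof -
      \<comment> \<open>Triangularity: \<open>v j\<close> has no component along the axes after
        \<open>j\<close>, and the diagonal entry is 1.\<close>
      have "s j = (\<Sum>i\<in>{..<Suc j}. u i * T j i)"
        unfolding s_def using j v(2) by (intro sum.mono_neutral_right) (auto simp: T_def not_less_eq)
      also have "\<dots> = u j + (\<Sum>i<j. u i * T j i)" using v(1)[OF j] h[OF j] by (simp add: T_def)
      finally have "\<bar>u j\<bar> \<le> \<bar>s j\<bar> + \<bar>\<Sum>i<j. u i * T j i\<bar>" by linarith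
      also have "\<bar>\<Sum>i<j. u i * T j i\<bar> \<le> (\<Sum>i<j. \<bar>u i * T j i\<bar>)" by (rule sum_abs)
      also have "\<dots> \<le> (\<Sum>i<j. \<bar>u i\<bar>)"
      proof (rule sum_mono)
        fix i assume "i \<in> {..<j}"
        then have "\<bar>T j i\<bar> \<le> 1" using v(3)[of i j] h[of i] j by (simp add: T_def)
        then show "\<bar>u i * T j i\<bar> \<le> \<bar>u i\<bar>" by (simp add: abs_mult mult_left_le)
      qed
      finally show ?thesis using sabs[OF j] by simp
    qed
    then have "U \<le> (2 ^ k - 1) * ((real k + 1) * \<tau>)"
      unfolding U_def using \<tau>0 by (intro sum_power2_bound) auto
    also have "\<dots> \<le> 2 ^ k * ((real k + 1) * \<tau>)"
      using \<tau>0 by (intro mult_right_mono) auto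
    also have "\<dots> = (\<rho> * (2 ^ (k + 2) * (real k + 1))) * U / 2"
      unfolding \<tau>_def by (simp add: algebra_simps)
    also have "\<rho> * (2 ^ (k + 2) * (real k + 1)) = 1" unfolding \<rho> by simp
    finally have "U = 0" using U0 by simp
    then have "\<tau> = 0" by (simp add: \<tau>_def)
    then show False using S\<tau> Slow by simp
  qed
  then obtain y where y: "y \<in> convex hull (z ` {..k})" "Q = P y" by blast
  have "(y - x) \<bullet> e i = q i" if "i < k" for i
    using Pe[OF that, of y] Qe[OF that] h[OF that] y(2) by simp
  then show ?thesis using y(1) by blast
qed

text \<open>The size of perturbation, relative to the heights, that back substitution in
  \<open>perturbed_simplex_contains_box\<close> tolerates.\<close>

definition frame_tolerance :: "nat \<Rightarrow> real" where
  "frame_tolerance k = 1 / (2 ^ (k + 2) * (real k + 1))"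

text \<open>The unperturbed simplex has the vertices \<open>x\<close> and \<open>x + v j\<close>.
  Mind the shift: \<open>z 0\<close> is near \<open>x\<close> and \<open>z (Suc j)\<close> is near
  \<open>x + v j\<close>, both only as seen along the axes.\<close>

definition perturbed_frame ::
    "nat \<Rightarrow> 'a::real_inner \<Rightarrow> (nat \<Rightarrow> 'a) \<Rightarrow> (nat \<Rightarrow> 'a) \<Rightarrow> (nat \<Rightarrow> real) \<Rightarrow> (nat \<Rightarrow> 'a) \<Rightarrow> bool" where
  "perturbed_frame k x v e h z \<longleftrightarrow>
     orthonormal_upto k e \<and> (\<forall>i<k. 0 < h i) \<and> (\<forall>j<k. v j \<bullet> e j = h j) \<and>
     (\<forall>i<k. \<forall>j<i. v j \<bullet> e i = 0) \<and> (\<forall>i<k. \<forall>j<k. \<bar>v j \<bullet> e i\<bar> \<le> h i) \<and>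
     (\<forall>i<k. \<bar>(z 0 - x) \<bullet> e i\<bar> \<le> frame_tolerance k * h i) \<and>
     (\<forall>i<k. \<forall>j<k. \<bar>(z (Suc j) - x - v j) \<bullet> e i\<bar> \<le> frame_tolerance k * h i)"

text \<open>Taking coordinates along the frame is nonexpansive by Bessel's inequality, and the image
  of the simplex contains a box with sides \<open>2 * \<rho> * h i\<close>. So the box, a product of
  intervals, bounds the measure of the simplex from below.\<close>

lemma perturbed_simplex_hausdorff_ge:
  "\<exists>c>0. \<forall>(x :: 'a::euclidean_space) v e h z. perturbed_frame k x v e h z \<longrightarrow>
     ennreal (c * (\<Prod>i<k. h i)) \<le> hausdorff k (convex hull (z ` {..k}))"
proof -
  obtain c where c: "0 < c" "\<And>(B :: nat \<Rightarrow> real set) b.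
     (\<forall>i<k. compact (B i) \<and> 0 < b i \<and> ennreal (b i) < hausdorff 1 (B i)) \<Longrightarrow>
     ennreal (c * (\<Prod>i<k. b i)) \<le> hausdorff_outer (tuple_dist k) ({..<k} \<rightarrow>\<^sub>E UNIV) (1 * k) (PiE {..<k} B)"
    using hausdorff_outer_tuples_box[of k 1, where 'a=real] by blast
  define \<rho> where "\<rho> = frame_tolerance k"
  have \<rho>_eq: "\<rho> = 1 / (2 ^ (k + 2) * (real k + 1))" unfolding \<rho>_def frame_tolerance_def ..
  then have \<rho>0: "0 < \<rho>" by simp
  have "ennreal (c * \<rho> ^ k * (\<Prod>i<k. h i)) \<le> hausdorff k (convex hull (z ` {..k}))"
    if pf: "perturbed_frame k x v e h z" for x :: 'a and z e h v
  proof -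
    have e: "orthonormal_upto k e" and h: "\<And>i. i < k \<Longrightarrow> 0 < h i"
      and v: "\<And>j. j < k \<Longrightarrow> v j \<bullet> e j = h j" "\<And>i j. j < i \<Longrightarrow> i < k \<Longrightarrow> v j \<bullet> e i = 0"
        "\<And>i j. i < k \<Longrightarrow> j < k \<Longrightarrow> \<bar>v j \<bullet> e i\<bar> \<le> h i"
      and z: "\<And>i. i < k \<Longrightarrow> \<bar>(z 0 - x) \<bullet> e i\<bar> \<le> \<rho> * h i"
        "\<And>i j. i < k \<Longrightarrow> j < k \<Longrightarrow> \<bar>(z (Suc j) - x - v j) \<bullet> e i\<bar> \<le> \<rho> * h i"
      using pf unfolding perturbed_frame_def \<rho>_def by blast+
    define A where "A i = (\<Sum>j<k. v j \<bullet> e i) / (real k + 1) + x \<bullet> e i" for i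
    define B where "B i = {A i - \<rho> * h i .. A i + \<rho> * h i}" for i
    define f where "f y = (\<lambda>i\<in>{..<k}. y \<bullet> e i)" for y :: 'a
    \<comment> \<open>The interval has twice this length; the estimate for boxes wants strict
      bounds.\<close>
    have "ennreal (\<rho> * h i) < hausdorff 1 (B i)" if "i < k" for i
    proof -
      have p: "0 < \<rho> * h i" using h[OF that] \<rho>0 by simp
      then have "ennreal (\<rho> * h i) < ennreal (A i + \<rho> * h i - (A i - \<rho> * h i))"
        by (intro ennreal_lessI) auto
      also have "\<dots> \<le> hausdorff 1 (B i)"
        unfolding B_def using p by (intro hausdorff_interval_ge) auto
      finally show ?thesis .
    qed
    then have "ennreal (c * (\<Prod>i<k. \<rho> * h i)) \<le>
        hausdorff_outer (tuple_dist k) ({..<k} \<rightarrow>\<^sub>E UNIV) (1 * k) (PiE {..<k} B)"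
      using h \<rho>0 by (intro c(2)) (auto simp: B_def)
    also have "\<dots> \<le> hausdorff_outer (tuple_dist k) ({..<k} \<rightarrow>\<^sub>E UNIV) (1 * k) (f ` (convex hull (z ` {..k})))"
    proof (rule hausdorff_outer_mono, rule subsetI)
      fix w assume w: "w \<in> PiE {..<k} B"
      have "\<exists>y\<in>convex hull (z ` {..k}). \<forall>i<k. (y - x) \<bullet> e i = w i - x \<bullet> e i"
      proof (rule perturbed_simplex_contains_box[OF e h v \<rho>_eq z])
        fix i assume "i < k"
        then have "w i \<in> B i" using w by (auto simp: PiE_iff)
        then show "\<bar>w i - x \<bullet> e i - (\<Sum>j<k. v j \<bullet> e i) / (real k + 1)\<bar> \<le> \<rho> * h i"
          by (auto simp: B_def A_def abs_le_iff)
      qed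
      then obtain y where y: "y \<in> convex hull (z ` {..k})" "\<And>i. i < k \<Longrightarrow> (y - x) \<bullet> e i = w i - x \<bullet> e i"
        by blast
      have "w i = f y i" for i
      proof (cases "i < k")
        case True
        then show ?thesis using y(2)[OF True] by (simp add: f_def inner_diff_left)
      next
        case False
        then show ?thesis using w by (auto simp: f_def PiE_iff extensional_def)
      qed
      then have "w = f y" by (rule ext)
      then show "w \<in> f ` (convex hull (z ` {..k}))" using y(1) by blast
    qed
    also have "\<dots> \<le> hausdorff (1 * k) (convex hull (z ` {..k}))"
    proof (rule hausdorff_outer_nonexpansive)
      show "f ` (convex hull (z ` {..k})) \<subseteq> {..<k} \<rightarrow>\<^sub>E UNIV" by (auto simp: f_def PiE_def)
      fix y y'
      have "(tuple_dist k (f y) (f y'))\<^sup>2 = (\<Sum>i<k. ((y - y') \<bullet> e i)\<^sup>2)"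
        by (auto simp: tuple_dist_def L2_set_def f_def dist_real_def inner_diff_left sum_nonneg intro!: sum.cong)
      also have "\<dots> \<le> (dist y y')\<^sup>2" unfolding dist_norm by (rule bessel[OF e])
      finally show "tuple_dist k (f y) (f y') \<le> dist y y'" by (rule power2_le_imp_le) simp
    qed
    finally show ?thesis by (simp add: prod.distrib mult.assoc)
  qed
  moreover have "0 < c * \<rho> ^ k" using c(1) \<rho>0 by simp
  ultimately show ?thesis by blast
qed

section \<open>Decay of the beta numbers\<close>

text \<open>The infimum in \<beta> runs over planes of dimension exactly \<open>m\<close>, while the
  greedy axes span a space of dimension at most \<open>m\<close>, which has to be enlarged for the
  comparison.\<close>

lemma subspace_extend_dim:
  fixes S :: "'a::euclidean_space set"
  assumes "subspace S" "dim S \<le> m" "m \<le> DIM('a)"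
  obtains H where "H \<in> grassmannian m" "S \<subseteq> H"
proof -
  obtain B where B: "B \<subseteq> S" "independent B" "S \<subseteq> span B" "card B = dim S"
    using basis_exists by blast
  obtain C where C: "B \<subseteq> C" "independent C" "UNIV \<subseteq> span C"
    by (rule maximal_independent_subset_extend[OF subset_UNIV B(2)])
  have fin: "finite C" "finite B"
    using independent_imp_finite[OF C(2)] independent_imp_finite[OF B(2)] by simp_all
  have "card C = DIM('a)"
    using dim_eq_card[OF _ C(2), of UNIV] C(3) by (simp add: top.extremum_unique)
  then have "m - card B \<le> card (C - B)"
    using fin C(1) assms(3) by (simp add: card_Diff_subset)
  then obtain D where D: "D \<subseteq> C - B" "card D = m - card B"
    by (rule obtain_subset_with_card_n)
  have D': "finite D" "D \<inter> B = {}"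
    using finite_subset[OF D(1)] D(1) fin(1) by blast+
  have "B \<union> D \<subseteq> C" using D(1) C(1) by blast
  then have "independent (B \<union> D)" by (rule independent_mono[OF C(2)])
  then have "dim (span (B \<union> D)) = m"
    using D(2) D' fin(2) B(4) assms(2)
    by (simp add: dim_eq_card_independent card_Un_disjoint Int_commute)
  then have "span (B \<union> D) \<in> grassmannian m" by (simp add: grassmannian_def)
  moreover have "S \<subseteq> span (B \<union> D)" using B(3) span_mono[of B "B \<union> D"] by blast
  ultimately show ?thesis by (rule that)
qed

lemma grassmannian_nonempty: "m \<le> DIM('a) \<Longrightarrow> grassmannian m \<noteq> ({} :: 'a::euclidean_space set set)"
proof -
  assume m: "m \<le> DIM('a)"
  have "dim {0::'a} \<le> m" by (simp add: dim_eq_0)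
  then obtain H :: "'a set" where "H \<in> grassmannian m"
    using subspace_extend_dim[OF subspace_single_0 _ m] by blast
  then show ?thesis by blast
qed

lemma infdist_plane_le:
  assumes "H \<in> grassmannian m" "z \<in> cball x r"
  shows "infdist z ((+) x ` H) \<le> r"
proof -
  have "0 \<in> H" using assms(1) by (simp add: grassmannian_def subspace_0)
  then have "x \<in> (+) x ` H" by (rule image_eqI[rotated]) simp
  then have "infdist z ((+) x ` H) \<le> dist z x" by (rule infdist_le)
  then show ?thesis using assms(2) by (simp add: dist_commute)
qed

lemma bdd_above_infdist_plane:
  assumes "H \<in> grassmannian m"
  shows "bdd_above ((\<lambda>z. infdist z ((+) x ` H)) ` (\<Sigma> \<inter> cball x r))"
  using infdist_plane_le[OF assms] by (intro bdd_aboveI[of _ r]) auto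

lemma SUP_infdist_nonneg:
  assumes "H \<in> grassmannian m" "x \<in> \<Sigma>" "0 < r"
  shows "0 \<le> (SUP z\<in>\<Sigma> \<inter> cball x r. infdist z ((+) x ` H))"
proof (rule order_trans[OF infdist_nonneg])
  show "infdist x ((+) x ` H) \<le> (SUP z\<in>\<Sigma> \<inter> cball x r. infdist z ((+) x ` H))"
    using assms by (intro cSUP_upper bdd_above_infdist_plane) auto
qed

lemma beta_number_le_SUP:
  assumes "H \<in> grassmannian m" "x \<in> \<Sigma>" "0 < r"
  shows "beta_number m \<Sigma> x r * r \<le> (SUP z\<in>\<Sigma> \<inter> cball x r. infdist z ((+) x ` H))"
proof -
  have "(INF H\<in>grassmannian m. SUP z\<in>\<Sigma> \<inter> cball x r. infdist z ((+) x ` H))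
      \<le> (SUP z\<in>\<Sigma> \<inter> cball x r. infdist z ((+) x ` H))"
    using assms(1) by (intro cINF_lower bdd_belowI[of _ 0]) (auto intro: SUP_infdist_nonneg assms)
  then show ?thesis using assms(3) by (simp add: beta_number_def)
qed

text \<open>Fewer than \<open>m + 1\<close> axes span a subspace of some \<open>m\<close>-plane. As
  \<beta> exceeds \<open>\<eta> / r\<close>, this plane misses some point of \<Sigma> in the ball by
  more than \<eta>, so the greedy choice can go on until it has \<open>m + 1\<close> edge
  vectors.\<close>

lemma beta_number_frame:
  fixes \<Sigma> :: "'a::euclidean_space set"
  assumes m: "m \<le> DIM('a)" and \<Sigma>: "compact \<Sigma>" "x \<in> \<Sigma>" and r: "0 < r"
    and \<beta>: "0 < \<eta>" "\<eta> < beta_number m \<Sigma> x r * r"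
  shows "\<exists>e h p. orthonormal_upto (m + 1) e \<and>
    (\<forall>j<m + 1. p j \<in> \<Sigma> \<inter> cball x r \<and> \<eta> \<le> h j \<and> (p j - x) \<bullet> e j = h j) \<and>
    (\<forall>i<m + 1. \<forall>j<i. (p j - x) \<bullet> e i = 0) \<and>
    (\<forall>i<m + 1. \<forall>j<m + 1. \<bar>(p j - x) \<bullet> e i\<bar> \<le> h i)"
proof -
  let ?F = "\<Sigma> \<inter> cball x r"
  have "\<exists>e h p. orthonormal_upto (m + 1) e \<and>
    (\<forall>j<m + 1. p j \<in> ?F \<and> \<eta> \<le> h j \<and> (p j - x) \<bullet> e j = h j \<and>
       p j - x = (\<Sum>i<Suc j. ((p j - x) \<bullet> e i) *\<^sub>R e i) \<and> (\<forall>z\<in>?F. \<bar>(z - x) \<bullet> e j\<bar> \<le> h j))"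
  proof (rule greedy_frame)
    show "compact ?F" using \<Sigma>(1) by (intro compact_Int_closed) auto
    show "?F \<noteq> {}" using \<Sigma>(2) r by auto
    fix j and e :: "nat \<Rightarrow> 'a" assume j: "j < m + 1" and e: "orthonormal_upto j e"
    have "dim (span (e ` {..<j})) \<le> m"
    proof -
      have "dim (e ` {..<j}) \<le> card (e ` {..<j})" by (rule dim_le_card') simp
      also have "\<dots> \<le> j" using card_image_le[of "{..<j}" e] by simp
      finally show ?thesis using j by simp
    qed
    then obtain H where H: "H \<in> grassmannian m" "span (e ` {..<j}) \<subseteq> H"
      using subspace_extend_dim[OF subspace_span _ m] by blast
    have "\<eta> < (SUP z\<in>?F. infdist z ((+) x ` H))"
      using \<beta>(2) beta_number_le_SUP[OF H(1) \<Sigma>(2) r] by linarith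
    then obtain z where z: "z \<in> ?F" "\<eta> < infdist z ((+) x ` H)"
      using less_cSUP_iff[OF \<open>?F \<noteq> {}\<close> bdd_above_infdist_plane[OF H(1)]] by blast
    let ?w = "\<Sum>i<j. ((z - x) \<bullet> e i) *\<^sub>R e i"
    have "?w \<in> span (e ` {..<j})" by (intro span_sum span_mul span_base) auto
    then have "infdist z ((+) x ` H) \<le> dist z (x + ?w)" using H(2) by (intro infdist_le) auto
    then have "\<eta> \<le> norm (z - x - ?w)" using z(2) by (simp add: dist_norm diff_diff_eq)
    then show "\<exists>z\<in>?F. \<eta> \<le> norm (z - x - (\<Sum>i<j. ((z - x) \<bullet> e i) *\<^sub>R e i))" using z(1) by blast
  qed (use \<beta> in auto)
  then obtain e h p where e: "orthonormal_upto (m + 1) e" and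
    p: "\<forall>j<m + 1. p j \<in> ?F \<and> \<eta> \<le> h j \<and> (p j - x) \<bullet> e j = h j \<and>
       p j - x = (\<Sum>i<Suc j. ((p j - x) \<bullet> e i) *\<^sub>R e i) \<and> (\<forall>z\<in>?F. \<bar>(z - x) \<bullet> e j\<bar> \<le> h j)"
    by (elim exE conjE)
  have "(p j - x) \<bullet> e i = 0" if "j < i" "i < m + 1" for i j
  proof -
    have "j < m + 1" using that by simp
    then have eq: "p j - x = (\<Sum>a<Suc j. ((p j - x) \<bullet> e a) *\<^sub>R e a)" using p by blast
    have "(p j - x) \<bullet> e i = (\<Sum>a<Suc j. ((p j - x) \<bullet> e a) * (e a \<bullet> e i))"
      by (subst eq) (simp only: inner_sum_left inner_scaleR_left)
    also have "\<dots> = 0" using e that by (intro sum.neutral) (auto simp: orthonormal_upto_def)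
    finally show ?thesis .
  qed
  then have o: "\<forall>i<m + 1. \<forall>j<i. (p j - x) \<bullet> e i = 0"
    by (intro allI impI)
  have a: "\<forall>j<m + 1. p j \<in> ?F \<and> \<eta> \<le> h j \<and> (p j - x) \<bullet> e j = h j"
    using p by blast
  have b: "\<forall>i<m + 1. \<forall>j<m + 1. \<bar>(p j - x) \<bullet> e i\<bar> \<le> h i"
    using p by blast
  show ?thesis
    by (intro exI[of _ e] exI[of _ h] exI[of _ p] conjI e a o b)
qed

section \<open>Lower bounds for curvature and energy\<close>

lemma menger_curv_frame_ge:
  fixes x :: "'a::euclidean_space"
  assumes c: "\<And>(x :: 'a::euclidean_space) v e h z. perturbed_frame (m + 1) x v e h z \<Longrightarrow>
       ennreal (c * (\<Prod>i<m + 1. h i)) \<le> hausdorff (m + 1) (convex hull (z ` {..m + 1}))"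
    and "0 < c" and pf: "perturbed_frame (m + 1) x v e h z"
    and h: "\<And>i. i < m + 1 \<Longrightarrow> \<eta> \<le> h i" "0 < \<eta>"
    and r: "0 < r" "\<And>i. i \<le> m + 1 \<Longrightarrow> dist x (z i) \<le> 2 * r"
  shows "c * \<eta> ^ (m + 1) / (4 * r) ^ (m + 2) \<le> menger_curv m z"
proof -
  have "\<eta> ^ (m + 1) = (\<Prod>i<m + 1. \<eta>)" by simp
  also have "\<dots> \<le> (\<Prod>i<m + 1. h i)" using h by (intro prod_mono) (simp add: less_imp_le)
  finally have "c * \<eta> ^ (m + 1) \<le> c * (\<Prod>i<m + 1. h i)" using assms(2) by simp
  then have "ennreal (c * \<eta> ^ (m + 1)) \<le> ennreal (c * (\<Prod>i<m + 1. h i))" by (rule ennreal_leI)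
  also have "\<dots> \<le> hausdorff (m + 1) (convex hull (z ` {..m + 1}))" by (rule c[OF pf])
  finally have "enn2real (ennreal (c * \<eta> ^ (m + 1))) \<le> enn2real (hausdorff (m + 1) (convex hull (z ` {..m + 1})))"
    using hausdorff_simplex_finite[of "m + 1" z] by (intro enn2real_mono) auto
  then have num: "c * \<eta> ^ (m + 1) \<le> enn2real (hausdorff (m + 1) (convex hull (z ` {..m + 1})))"
    using assms(2) h(2) by simp
  have dle: "diameter (z ` {..m + 1}) \<le> 4 * r"
  proof (rule diameter_le)
    fix a b assume "a \<in> z ` {..m + 1}" "b \<in> z ` {..m + 1}"
    then have "dist x a \<le> 2 * r" "dist x b \<le> 2 * r" using r(2) by auto
    then show "norm (a - b) \<le> 4 * r" using dist_triangle3[of a b x] by (simp add: dist_norm)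
  qed auto
  \<comment> \<open>A zero diameter would make the curvature 0 by division by zero. The first two
    vertices are apart along the axis \<open>e 0\<close>, since the tolerance is at most
    \<open>1 / 4\<close>.\<close>
  have dpos: "0 < diameter (z ` {..m + 1})"
  proof -
    let ?t = "frame_tolerance (m + 1)"
    have "1 \<le> (2::real) ^ (m + 1)" by (rule one_le_power) simp
    then have "(1::real) * 4 \<le> 2 ^ (m + 1) * 4" by (intro mult_right_mono) auto
    then have "4 * 1 \<le> (2::real) ^ (m + 1 + 2) * (real (m + 1) + 1)"
      by (intro mult_mono) (auto simp: power_add)
    then have t: "?t \<le> 1 / 4" unfolding frame_tolerance_def by (intro divide_left_mono) auto
    have h0: "0 < h 0" using h(1)[of 0] h(2) by simp
    have "\<bar>(z 0 - x) \<bullet> e 0\<bar> \<le> ?t * h 0" "\<bar>(z (Suc 0) - x - v 0) \<bullet> e 0\<bar> \<le> ?t * h 0" "v 0 \<bullet> e 0 = h 0"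
      using pf unfolding perturbed_frame_def by auto
    moreover have "?t * h 0 \<le> 1 / 4 * h 0" using t h0 by (intro mult_right_mono) auto
    ultimately have "(z (Suc 0) - z 0) \<bullet> e 0 > 0"
      using h0 unfolding inner_diff_left by linarith
    then have "z (Suc 0) \<noteq> z 0" by auto
    then have "0 < dist (z (Suc 0)) (z 0)" by simp
    also have "\<dots> \<le> diameter (z ` {..m + 1})"
      by (intro diameter_bounded_bound finite_imp_bounded) auto
    finally show ?thesis .
  qed
  have "c * \<eta> ^ (m + 1) / (4 * r) ^ (m + 2)
      \<le> enn2real (hausdorff (m + 1) (convex hull (z ` {..m + 1}))) / diameter (z ` {..m + 1}) ^ (m + 2)"
    using num dle dpos assms(2) h(2) by (intro frac_le power_mono zero_less_power) auto
  then show ?thesis by (simp add: menger_curv_def)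
qed

text \<open>The integral is monotone without measurability of the larger function, so a measurable
  box on which the supremum is at least \<open>K powr p\<close> suffices.\<close>

lemma menger_energy_ge:
  fixes \<Sigma> :: "'a::euclidean_space set"
  assumes "\<And>i. i < l \<Longrightarrow> closed (B i)" "\<And>i. i < l \<Longrightarrow> B i \<subseteq> \<Sigma>" "0 \<le> K" "0 \<le> p"
    and "\<And>w. w \<in> PiE {..<l} B \<Longrightarrow>
      \<exists>y\<in>{..m + 1} \<rightarrow>\<^sub>E \<Sigma>. (\<forall>i<l. y i = w i) \<and> K \<le> menger_curv m y"
  shows "ennreal (K powr p) * hausdorff_outer (tuple_dist l) ({..<l} \<rightarrow>\<^sub>E UNIV) (m * l) (PiE {..<l} B)
    \<le> menger_energy m l p \<Sigma>"
proof -
  let ?M = "hausdorff_tuples l (m * l) :: (nat \<Rightarrow> 'a) measure"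
  have box: "PiE {..<l} B \<in> sets ?M"
    "emeasure ?M (PiE {..<l} B) = hausdorff_outer (tuple_dist l) ({..<l} \<rightarrow>\<^sub>E UNIV) (m * l) (PiE {..<l} B)"
    using emeasure_hausdorff_tuples_box[of l B, OF assms(1)] by auto
  have "ennreal (K powr p) * emeasure ?M (PiE {..<l} B)
      = (\<integral>\<^sup>+ x. ennreal (K powr p) * indicator (PiE {..<l} B) x \<partial>?M)"
    using box(1) by (simp add: nn_integral_cmult_indicator)
  also have "\<dots> \<le> menger_energy m l p \<Sigma>"
    unfolding menger_energy_def
  proof (rule nn_integral_mono)
    fix w
    show "ennreal (K powr p) * indicator (PiE {..<l} B) w
      \<le> (SUP y\<in>{y \<in> {..m + 1} \<rightarrow>\<^sub>E \<Sigma>. \<forall>i<l. y i = w i}. ennreal (menger_curv m y powr p)) * indicator ({..<l} \<rightarrow>\<^sub>E \<Sigma>) w"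
    proof (cases "w \<in> PiE {..<l} B")
      case True
      then obtain y where y: "y \<in> {..m + 1} \<rightarrow>\<^sub>E \<Sigma>" "\<forall>i<l. y i = w i" "K \<le> menger_curv m y"
        using assms(5) by blast
      have "PiE {..<l} B \<subseteq> {..<l} \<rightarrow>\<^sub>E \<Sigma>" using assms(2) by (intro PiE_mono) auto
      then have w: "w \<in> {..<l} \<rightarrow>\<^sub>E \<Sigma>" using True by blast
      have "ennreal (K powr p) \<le> ennreal (menger_curv m y powr p)"
        using y(3) assms(3,4) by (intro ennreal_leI powr_mono2) auto
      also have "\<dots> \<le> (SUP y\<in>{y \<in> {..m + 1} \<rightarrow>\<^sub>E \<Sigma>. \<forall>i<l. y i = w i}. ennreal (menger_curv m y powr p))"
        using y(1,2) by (intro SUP_upper) auto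
      finally show ?thesis using True w by simp
    qed simp
  qed
  finally show ?thesis using box(2) by simp
qed

text \<open>A simplex with heights about \<open>\<beta> * r\<close> in a ball of radius
  \<open>r\<close> has curvature at least of order
  \<open>(\<beta> * r) ^ (m + 1) / r ^ (m + 2)\<close>, and this persists when the first
  \<open>l\<close> vertices range over pieces of \<Sigma> of radius proportional to
  \<open>\<beta> * r\<close>.\<close>

lemma beta_number_energy_le:
  fixes \<Sigma> :: "'a::euclidean_space set"
  assumes m: "m \<le> DIM('a)" and l: "l \<le> m + 2" and \<Sigma>: "compact \<Sigma>" and A: "0 < A" and p: "0 \<le> p"
    and Ahl: "\<And>x r. x \<in> \<Sigma> \<Longrightarrow> 0 < r \<Longrightarrow> r \<le> R \<Longrightarrow> ennreal (A * r ^ m) \<le> hausdorff m (\<Sigma> \<inter> ball x r)"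
  shows "\<exists>c>0. \<forall>x\<in>\<Sigma>. \<forall>r. 0 < r \<longrightarrow> r \<le> R \<longrightarrow> 0 < beta_number m \<Sigma> x r \<longrightarrow>
    ennreal (c * (beta_number m \<Sigma> x r * r) ^ (m * l) * (beta_number m \<Sigma> x r ^ (m + 1) / r) powr p)
      \<le> menger_energy m l p \<Sigma>"
proof -
  obtain c1 where c1: "0 < c1" "\<And>(x :: 'a) v e h z. perturbed_frame (m + 1) x v e h z \<Longrightarrow>
       ennreal (c1 * (\<Prod>i<m + 1. h i)) \<le> hausdorff (m + 1) (convex hull (z ` {..m + 1}))"
    using perturbed_simplex_hausdorff_ge by metis
  obtain c2 where c2: "0 < c2" "\<And>(B :: nat \<Rightarrow> 'a set) b.
     (\<forall>i<l. compact (B i) \<and> 0 < b i \<and> ennreal (b i) < hausdorff m (B i)) \<Longrightarrow>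
     ennreal (c2 * (\<Prod>i<l. b i)) \<le> hausdorff_outer (tuple_dist l) ({..<l} \<rightarrow>\<^sub>E UNIV) (m * l) (PiE {..<l} B)"
    using hausdorff_outer_tuples_box[of l m, where 'a='a] by blast
  define t where "t = frame_tolerance (m + 1)"
  have t: "0 < t" "t \<le> 1"
  proof -
    have "1 * 1 \<le> (2::real) ^ (m + 1 + 2) * (real (m + 1) + 1)"
      by (intro mult_mono one_le_power) auto
    then show "0 < t" "t \<le> 1" by (auto simp: t_def frame_tolerance_def)
  qed
  \<comment> \<open>The powers of 2 and 4 come from the height bound \<open>\<beta> * r / 2\<close>
    and the diameter bound \<open>4 * r\<close>.\<close>
  define K where "K = c1 / (2 ^ (m + 1) * 4 ^ (m + 2))"
  have K: "0 < K" using c1 by (simp add: K_def)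
  define c where "c = c2 * (A / 2) ^ l * (t / 2) ^ (m * l) * K powr p"
  have c0: "0 < c" using c2 A t K by (simp add: c_def)
  have main: "ennreal (c * (beta_number m \<Sigma> x r * r) ^ (m * l) * (beta_number m \<Sigma> x r ^ (m + 1) / r) powr p)
      \<le> menger_energy m l p \<Sigma>"
    if x: "x \<in> \<Sigma>" and r: "0 < r" "r \<le> R" and \<beta>0: "0 < beta_number m \<Sigma> x r" for x r
  proof -
    define \<beta> where "\<beta> = beta_number m \<Sigma> x r"
    define \<eta> where "\<eta> = \<beta> * r / 2"
    have \<eta>: "0 < \<eta>" "\<eta> < beta_number m \<Sigma> x r * r" using \<beta>0 r by (auto simp: \<eta>_def \<beta>_def)
    obtain e h q where e: "orthonormal_upto (m + 1) e"
      and qh: "\<forall>j<m + 1. q j \<in> \<Sigma> \<inter> cball x r \<and> \<eta> \<le> h j \<and> (q j - x) \<bullet> e j = h j"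
      and v: "\<forall>i<m + 1. \<forall>j<i. (q j - x) \<bullet> e i = 0"
        "\<forall>i<m + 1. \<forall>j<m + 1. \<bar>(q j - x) \<bullet> e i\<bar> \<le> h i"
      using beta_number_frame[OF m \<Sigma> x r(1) \<eta>] by (elim exE conjE)
    have q: "\<And>j. j < m + 1 \<Longrightarrow> q j \<in> \<Sigma> \<inter> cball x r" and h: "\<And>j. j < m + 1 \<Longrightarrow> \<eta> \<le> h j"
      and qe: "\<And>j. j < m + 1 \<Longrightarrow> (q j - x) \<bullet> e j = h j"
      using qh by blast+
    have ne: "norm (e i) = 1" if "i < m + 1" for i
      using e that by (simp add: orthonormal_upto_def norm_eq_sqrt_inner)
    have inner_le: "\<bar>a \<bullet> e i\<bar> \<le> norm a" if "i < m + 1" for a i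
      using Cauchy_Schwarz_ineq2[of a "e i"] ne[OF that] by simp
    \<comment> \<open>Leads to \<open>\<eta> \<le> r\<close>: the small radii then stay below
      \<open>R\<close>, where Ahlfors regularity holds, and moved vertices stay within
      \<open>2 * r\<close> of \<open>x\<close>.\<close>
    have "\<eta> \<le> norm (q 0 - x)" using h[of 0] qe[of 0] inner_le[of 0 "q 0 - x"] by simp
    also have "\<dots> \<le> r" using q[of 0] by (simp add: dist_norm norm_minus_commute)
    finally have \<eta>r: "\<eta> \<le> r" .
    define \<epsilon> where "\<epsilon> = t * \<eta>"
    have \<epsilon>: "0 < \<epsilon>" "\<epsilon> \<le> \<eta>" using t \<eta> by (auto simp: \<epsilon>_def mult_left_le_one_le)
    define X where "X i = (case i of 0 \<Rightarrow> x | Suc j \<Rightarrow> q j)" for i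
    have X: "X i \<in> \<Sigma>" "dist x (X i) \<le> r" if "i \<le> m + 1" for i
      using that x q r by (auto simp: X_def split: nat.splits)
    \<comment> \<open>Closed balls make the factors compact; they contain the open balls for which
      the lower bound is assumed.\<close>
    define B where "B i = \<Sigma> \<inter> cball (X i) \<epsilon>" for i
    have cB: "compact (B i)" for i unfolding B_def using \<Sigma> by (intro compact_Int_closed) auto
    have "ennreal (A / 2 * \<epsilon> ^ m) < hausdorff m (B i)" if "i < l" for i
    proof -
      have "ennreal (A / 2 * \<epsilon> ^ m) < ennreal (A * \<epsilon> ^ m)" using A \<epsilon> by (intro ennreal_lessI) auto
      also have "\<dots> \<le> hausdorff m (\<Sigma> \<inter> ball (X i) \<epsilon>)"
        using X(1)[of i] that l \<epsilon> \<eta>r r by (intro Ahl) auto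
      also have "\<dots> \<le> hausdorff m (B i)"
        unfolding B_def by (intro hausdorff_outer_mono) auto
      finally show ?thesis .
    qed
    then have "ennreal (c2 * (\<Prod>i<l. A / 2 * \<epsilon> ^ m))
        \<le> hausdorff_outer (tuple_dist l) ({..<l} \<rightarrow>\<^sub>E UNIV) (m * l) (PiE {..<l} B)"
      using cB A \<epsilon> by (intro c2(2)) auto
    moreover have "(\<Prod>i<l. A / 2 * \<epsilon> ^ m) = (A / 2) ^ l * (t / 2) ^ (m * l) * (\<beta> * r) ^ (m * l)"
      by (simp add: \<epsilon>_def \<eta>_def power_mult power_mult_distrib power_divide)
    ultimately have box: "ennreal (c2 * ((A / 2) ^ l * (t / 2) ^ (m * l) * (\<beta> * r) ^ (m * l)))
        \<le> hausdorff_outer (tuple_dist l) ({..<l} \<rightarrow>\<^sub>E UNIV) (m * l) (PiE {..<l} B)"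
      by simp
    define \<kappa> where "\<kappa> = K * (\<beta> ^ (m + 1) / r)"
    have \<kappa>0: "0 \<le> \<kappa>" using K \<beta>0 r by (simp add: \<kappa>_def \<beta>_def)
    have "ennreal (\<kappa> powr p) * hausdorff_outer (tuple_dist l) ({..<l} \<rightarrow>\<^sub>E UNIV) (m * l) (PiE {..<l} B)
      \<le> menger_energy m l p \<Sigma>"
    proof (rule menger_energy_ge)
      show "closed (B i)" for i using cB by (rule compact_imp_closed)
      show "B i \<subseteq> \<Sigma>" for i by (auto simp: B_def)
      fix w assume w: "w \<in> PiE {..<l} B"
      \<comment> \<open>The variables of the supremum are filled with the unmoved vertices, the
        integration variables with the moved ones.\<close>
      define y where "y i = (if i < l then w i else if i \<le> m + 1 then X i else undefined)" for i
      have y: "y i \<in> \<Sigma>" "dist (X i) (y i) \<le> \<epsilon>" if "i \<le> m + 1" for i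
        using w X(1)[OF that] \<epsilon>(1) that by (auto simp: y_def PiE_iff B_def)
      have "y \<in> {..m + 1} \<rightarrow>\<^sub>E \<Sigma>"
        using y(1) l by (auto simp: PiE_iff extensional_def y_def)
      moreover have "\<kappa> \<le> menger_curv m y"
      proof -
        have \<epsilon>h: "\<epsilon> \<le> t * h i" if "i < m + 1" for i
          using h[OF that] t by (simp add: \<epsilon>_def)
        have pf: "perturbed_frame (m + 1) x (\<lambda>j. q j - x) e h y"
          unfolding perturbed_frame_def t_def[symmetric]
        proof (intro conjI allI impI)
          fix i assume i: "i < m + 1"
          show "0 < h i" using h[OF i] \<eta> by simp
          show "\<bar>(y 0 - x) \<bullet> e i\<bar> \<le> t * h i"
            using inner_le[OF i, of "y 0 - x"] y(2)[of 0] \<epsilon>h[OF i]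
            by (simp add: X_def dist_norm norm_minus_commute)
          fix j assume j: "j < m + 1"
          show "\<bar>(y (Suc j) - x - (q j - x)) \<bullet> e i\<bar> \<le> t * h i"
            using inner_le[OF i, of "y (Suc j) - q j"] y(2)[of "Suc j"] \<epsilon>h[OF i] j
            by (simp add: X_def dist_norm norm_minus_commute)
        qed (use e v qe in blast)+
        have "c1 * \<eta> ^ (m + 1) / (4 * r) ^ (m + 2) \<le> menger_curv m y"
        proof (rule menger_curv_frame_ge[OF _ c1(1) pf])
          show "ennreal (c1 * (\<Prod>i<m + 1. h' i)) \<le> hausdorff (m + 1) (convex hull (z' ` {..m + 1}))"
            if "perturbed_frame (m + 1) x' v' e' h' z'" for x' :: 'a and v' e' h' z'
            by (rule c1(2)[OF that])
          fix i assume i: "i \<le> m + 1"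
          have "dist x (y i) \<le> dist x (X i) + dist (X i) (y i)" by (rule dist_triangle)
          then show "dist x (y i) \<le> 2 * r" using X(2)[OF i] y(2)[OF i] \<epsilon>(2) \<eta>r by linarith
        qed (use h \<eta> r in auto)
        also have "c1 * \<eta> ^ (m + 1) / (4 * r) ^ (m + 2) = \<kappa>"
          using r by (simp add: \<kappa>_def K_def \<eta>_def power_mult_distrib power_divide)
        finally show ?thesis .
      qed
      ultimately show "\<exists>y\<in>{..m + 1} \<rightarrow>\<^sub>E \<Sigma>. (\<forall>i<l. y i = w i) \<and> \<kappa> \<le> menger_curv m y"
        by (intro bexI[of _ y]) (auto simp: y_def)
    qed (use \<kappa>0 p in auto)
    then have "ennreal (\<kappa> powr p) * ennreal (c2 * ((A / 2) ^ l * (t / 2) ^ (m * l) * (\<beta> * r) ^ (m * l)))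
        \<le> menger_energy m l p \<Sigma>"
      using mult_left_mono[OF box, of "ennreal (\<kappa> powr p)"] by (meson order_trans zero_le)
    moreover have "ennreal (\<kappa> powr p) * ennreal (c2 * ((A / 2) ^ l * (t / 2) ^ (m * l) * (\<beta> * r) ^ (m * l)))
      = ennreal (c * (\<beta> * r) ^ (m * l) * (\<beta> ^ (m + 1) / r) powr p)"
    proof -
      have "\<kappa> powr p = K powr p * (\<beta> ^ (m + 1) / r) powr p"
        unfolding \<kappa>_def by (rule powr_mult)
      then show ?thesis
        by (simp add: c_def ennreal_mult'[symmetric] mult_ac)
    qed
    ultimately show ?thesis by (simp add: \<beta>_def)
  qed
  show ?thesis
  proof (intro exI[of _ c] conjI ballI allI impI c0)
    fix x r assume "x \<in> \<Sigma>" "0 < r" "r \<le> R" "0 < beta_number m \<Sigma> x r"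
    then show "ennreal (c * (beta_number m \<Sigma> x r * r) ^ (m * l) * (beta_number m \<Sigma> x r ^ (m + 1) / r) powr p)
      \<le> menger_energy m l p \<Sigma>" by (rule main)
  qed
qed

text \<open>The energy bound has the form
  \<open>\<beta> powr s * r powr (- lam) \<le> E0 / c\<close>, with \<open>lam = p - m * l\<close>
  and \<open>s = m * l + (m + 1) * p\<close>. Since \<open>s\<close> is at most
  \<open>(p + m * l) * (m + 1)\<close> and \<open>r \<le> 1\<close>, the exponent
  \<open>lam / s\<close> may be lowered to the claimed one.\<close>

lemma beta_number_decay:
  fixes \<Sigma> :: "'a::euclidean_space set"
  assumes m: "m \<le> DIM('a)" and l: "l \<le> m + 2" and \<Sigma>: "compact \<Sigma>" and A: "0 < A" and R: "0 < R"
    and Ahl: "\<And>x r. x \<in> \<Sigma> \<Longrightarrow> 0 < r \<Longrightarrow> r \<le> R \<Longrightarrow> ennreal (A * r ^ m) \<le> hausdorff m (\<Sigma> \<inter> ball x r)"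
    and p: "real (m * l) < p" and E: "menger_energy m l p \<Sigma> < \<infinity>"
  shows "\<exists>C>0. \<forall>x\<in>\<Sigma>. \<forall>r. 0 < r \<longrightarrow> r \<le> min R 1 \<longrightarrow>
    beta_number m \<Sigma> x r \<le> C * r powr ((p - real (m * l)) / ((p + real (m * l)) * real (m + 1)))"
proof -
  have p0: "0 < p" using p by (rule le_less_trans[rotated]) simp
  have "\<exists>c>0. \<forall>x\<in>\<Sigma>. \<forall>r. 0 < r \<longrightarrow> r \<le> R \<longrightarrow> 0 < beta_number m \<Sigma> x r \<longrightarrow>
    ennreal (c * (beta_number m \<Sigma> x r * r) ^ (m * l) * (beta_number m \<Sigma> x r ^ (m + 1) / r) powr p)
      \<le> menger_energy m l p \<Sigma>"
    by (rule beta_number_energy_le[OF m l \<Sigma> A less_imp_le[OF p0]]) (rule Ahl)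
  then obtain c where c: "0 < c" "\<forall>x\<in>\<Sigma>. \<forall>r. 0 < r \<longrightarrow> r \<le> R \<longrightarrow> 0 < beta_number m \<Sigma> x r \<longrightarrow>
    ennreal (c * (beta_number m \<Sigma> x r * r) ^ (m * l) * (beta_number m \<Sigma> x r ^ (m + 1) / r) powr p)
      \<le> menger_energy m l p \<Sigma>"
    by (elim exE conjE)
  define E0 where "E0 = enn2real (menger_energy m l p \<Sigma>)"
  have E0: "menger_energy m l p \<Sigma> = ennreal E0" "0 \<le> E0" using E by (auto simp: E0_def)
  let ?lam = "p - real (m * l)" and ?\<kappa> = "(p + real (m * l)) * real (m + 1)"
  define s where "s = real (m * l) + real (m + 1) * p"
  have s: "0 < s" unfolding s_def using p0 by (intro add_nonneg_pos) auto
  have s\<kappa>: "s \<le> ?\<kappa>"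
  proof -
    have "real (m * l) * 1 \<le> real (m * l) * real (m + 1)" by (intro mult_left_mono) auto
    then show ?thesis by (simp add: s_def algebra_simps)
  qed
  \<comment> \<open>Adding 1 keeps \<open>C\<close> positive even if the energy vanishes.\<close>
  define C where "C = ((E0 + 1) / c) powr (1 / s)"
  have C: "0 < C" using c E0(2) by (simp add: C_def)
  have "beta_number m \<Sigma> x r \<le> C * r powr (?lam / ?\<kappa>)" if x: "x \<in> \<Sigma>" and r: "0 < r" "r \<le> min R 1" for x r
  proof (cases "0 < beta_number m \<Sigma> x r")
    case False
    moreover have "0 \<le> C * r powr (?lam / ?\<kappa>)" using C by simp
    ultimately show ?thesis by linarith
  next
    case True
    define \<beta> where "\<beta> = beta_number m \<Sigma> x r"
    have \<beta>: "0 < \<beta>" using True by (simp add: \<beta>_def)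
    have "ennreal (c * (\<beta> * r) ^ (m * l) * (\<beta> ^ (m + 1) / r) powr p) \<le> ennreal E0"
      using c(2)[rule_format, OF x r(1) _ True] r(2) by (simp add: \<beta>_def E0(1))
    then have 0: "c * ((\<beta> * r) ^ (m * l) * (\<beta> ^ (m + 1) / r) powr p) \<le> E0"
      using E0(2) by (simp add: ennreal_le_iff mult.assoc)
    have "(\<beta> * r) ^ (m * l) * (\<beta> ^ (m + 1) / r) powr p = \<beta> powr s * r powr (- ?lam)"
    proof -
      have "(\<beta> * r) ^ (m * l) = \<beta> powr real (m * l) * r powr real (m * l)"
        using \<beta> r by (simp only: powr_realpow power_mult_distrib)
      moreover have "(\<beta> ^ (m + 1) / r) powr p = \<beta> powr (real (m + 1) * p) * r powr (- p)"
      proof -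
        have "(\<beta> ^ (m + 1) / r) powr p = (\<beta> powr real (m + 1)) powr p / r powr p"
          using \<beta> r by (simp only: powr_realpow powr_divide zero_le_power less_imp_le)
        then show ?thesis by (simp add: powr_powr powr_minus_divide)
      qed
      moreover have "\<beta> powr s = \<beta> powr real (m * l) * \<beta> powr (real (m + 1) * p)"
        unfolding s_def by (rule powr_add)
      moreover have "r powr (- ?lam) = r powr real (m * l) * r powr (- p)"
        by (simp only: powr_add[symmetric]) simp
      ultimately show ?thesis by (simp only: mult_ac)
    qed
    with 0 have 1: "c * (\<beta> powr s * r powr (- ?lam)) \<le> E0" by (simp only:)
    have "\<beta> powr s \<le> (E0 + 1) / c * r powr ?lam"
    proof -
      have "c * \<beta> powr s = c * (\<beta> powr s * r powr (- ?lam)) * r powr ?lam"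
        using powr_add[of r "- ?lam" ?lam] r by (simp del: minus_diff_eq)
      also have "\<dots> \<le> (E0 + 1) * r powr ?lam" using 1 by (intro mult_right_mono) auto
      finally show ?thesis using c(1) by (simp add: field_simps)
    qed
    then have "(\<beta> powr s) powr (1 / s) \<le> ((E0 + 1) / c * r powr ?lam) powr (1 / s)"
      using s by (intro powr_mono2) auto
    then have "\<beta> \<le> C * (r powr ?lam) powr (1 / s)"
      using \<beta> s unfolding powr_mult[of "(E0 + 1) / c" "r powr ?lam"] C_def by (simp add: powr_powr)
    also have "(r powr ?lam) powr (1 / s) = r powr (?lam / s)" by (simp add: powr_powr)
    also have "r powr (?lam / s) \<le> r powr (?lam / ?\<kappa>)"
      using r p p0 s s\<kappa> by (intro powr_mono' divide_left_mono mult_pos_pos add_pos_nonneg) auto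
    finally show ?thesis using C by (simp add: \<beta>_def)
  qed
  then show ?thesis using C by blast
qed

section \<open>A Taylor criterion for Hoelder classes\<close>

text \<open>For \<open>t\<close> with \<open>t - z\<close> of length \<open>s = dist y z\<close> in
  any direction, \<open>(L y - L z) (t - z)\<close> is a combination of the three Taylor remainders
  for the pairs among \<open>y\<close>, \<open>z\<close>, \<open>t\<close>. The ball of radius
  \<open>3 * r\<close> leaves room for \<open>t\<close>, and \<open>4 * r\<close> bounds
  \<open>norm (t - y)\<close>.\<close>

lemma holder_of_taylor:
  fixes F :: "'a::euclidean_space \<Rightarrow> 'b::euclidean_space" and L :: "'a \<Rightarrow> 'a \<Rightarrow>\<^sub>L 'b"
  assumes U: "ball u (3 * r) \<subseteq> U" and r: "0 < r" and C: "0 \<le> C" and \<alpha>: "0 \<le> \<alpha>"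
    and T: "\<And>y z. y \<in> U \<Longrightarrow> z \<in> U \<Longrightarrow> norm (z - y) \<le> \<rho> \<Longrightarrow>
      norm (F z - F y - L y (z - y)) \<le> C * norm (z - y) powr (1 + \<alpha>)" and \<rho>: "4 * r \<le> \<rho>"
    and y: "y \<in> ball u r" and z: "z \<in> ball u r"
  shows "norm (L y - L z) \<le> 3 * C * 2 powr (1 + \<alpha>) * dist y z powr \<alpha>"
proof (cases "y = z")
  case True
  then show ?thesis using C by simp
next
  case False
  define s where "s = dist y z"
  have s: "0 < s" "s < 2 * r"
    using False dist_triangle3[of y z u] y z by (auto simp: s_def)
  have yzU: "y \<in> U" "z \<in> U" using y z r U by auto
  show ?thesis
  proof (rule norm_blinfun_bound)
    show "0 \<le> 3 * C * 2 powr (1 + \<alpha>) * dist y z powr \<alpha>" using C by simp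
    fix w
    show "norm (blinfun_apply (L y - L z) w) \<le> 3 * C * 2 powr (1 + \<alpha>) * dist y z powr \<alpha> * norm w"
    proof (cases "w = 0")
      case False
      define t where "t = z + (s / norm w) *\<^sub>R w"
      have tz: "norm (t - z) = s" using False s by (simp add: t_def)
      have "dist u t \<le> dist u z + norm (t - z)"
        using dist_triangle[of u t z] by (simp add: dist_norm norm_minus_commute)
      then have tU: "t \<in> U" using z s tz U by auto
      have ty: "norm (t - y) \<le> 2 * s"
        using norm_triangle_ineq[of "t - z" "z - y"] tz by (simp add: s_def dist_norm norm_minus_commute)
      have zy: "norm (z - y) = s" by (simp add: s_def dist_norm norm_minus_commute)
      have b: "norm a powr (1 + \<alpha>) \<le> (2 * s) powr (1 + \<alpha>)" if "norm a \<le> 2 * s" for a :: 'a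
        using that \<alpha> by (intro powr_mono2) auto
      have tri3: "norm (a - b + c) \<le> norm a + norm b + norm c" for a b c :: 'b
        using norm_triangle_ineq[of "a - b" c] norm_triangle_ineq4[of a b] by linarith
      have eq: "(L y - L z) (t - z) = (F t - F z - L z (t - z)) - (F t - F y - L y (t - y)) + (F z - F y - L y (z - y))"
        by (simp add: blinfun.diff_left blinfun.diff_right)
      have "norm ((L y - L z) (t - z)) \<le> norm (F t - F z - L z (t - z)) + norm (F t - F y - L y (t - y))
          + norm (F z - F y - L y (z - y))"
        unfolding eq by (rule tri3)
      also have "\<dots> \<le> C * (2 * s) powr (1 + \<alpha>) + C * (2 * s) powr (1 + \<alpha>) + C * (2 * s) powr (1 + \<alpha>)"
      proof (intro add_mono)
        show "norm (F t - F z - L z (t - z)) \<le> C * (2 * s) powr (1 + \<alpha>)"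
          using order_trans[OF T[OF yzU(2) tU] mult_left_mono[OF b C]] tz s \<rho> by simp
        show "norm (F t - F y - L y (t - y)) \<le> C * (2 * s) powr (1 + \<alpha>)"
          using order_trans[OF T[OF yzU(1) tU] mult_left_mono[OF b C]] ty s \<rho> by simp
        show "norm (F z - F y - L y (z - y)) \<le> C * (2 * s) powr (1 + \<alpha>)"
          using order_trans[OF T[OF yzU] mult_left_mono[OF b C]] zy s \<rho> by simp
      qed
      also have "\<dots> = 3 * C * 2 powr (1 + \<alpha>) * s powr \<alpha> * s"
        using s by (simp add: powr_mult powr_add)
      finally have 1: "norm ((L y - L z) (t - z)) \<le> 3 * C * 2 powr (1 + \<alpha>) * s powr \<alpha> * s" .
      have "(L y - L z) (t - z) = (s / norm w) *\<^sub>R (L y - L z) w"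
        by (simp add: t_def blinfun.scaleR_right)
      then have "s * (norm ((L y - L z) w) / norm w) \<le> s * (3 * C * 2 powr (1 + \<alpha>) * s powr \<alpha>)"
        using 1 s by (simp add: mult.commute)
      then have "norm ((L y - L z) w) / norm w \<le> 3 * C * 2 powr (1 + \<alpha>) * s powr \<alpha>"
        using s(1) by (simp only: mult_le_cancel_left_pos)
      then show ?thesis using False by (simp add: s_def pos_divide_le_eq)
    qed simp
  qed
qed

text \<open>A uniform remainder of order \<open>1 + \<alpha>\<close> forces \<open>L\<close> to be
  the derivative and to be locally \<alpha>-Hoelder, so \<open>L\<close> may be chosen pointwise,
  with no care for its dependence on the base point.\<close>

lemma C1_holder_on_taylor:
  fixes F :: "'a::euclidean_space \<Rightarrow> 'b::euclidean_space" and L :: "'a \<Rightarrow> 'a \<Rightarrow>\<^sub>L 'b"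
  assumes U: "open U" and C: "0 \<le> C" and \<alpha>: "0 < \<alpha>" and \<rho>: "0 < \<rho>"
    and T: "\<And>y z. y \<in> U \<Longrightarrow> z \<in> U \<Longrightarrow> norm (z - y) \<le> \<rho> \<Longrightarrow>
      norm (F z - F y - L y (z - y)) \<le> C * norm (z - y) powr (1 + \<alpha>)"
  shows "C1_holder_on \<alpha> U F"
proof -
  have hol: "\<exists>r>0. \<exists>C'. \<forall>y\<in>U \<inter> ball x r. \<forall>z\<in>U \<inter> ball x r. norm (L y - L z) \<le> C' * dist y z powr \<alpha>"
    if x: "x \<in> U" for x
  proof -
    obtain e where e: "0 < e" "ball x e \<subseteq> U" using U x open_contains_ball by blast
    define r where "r = min (e / 3) (\<rho> / 4)"
    have r: "0 < r" "3 * r \<le> e" "4 * r \<le> \<rho>" using e \<rho> by (auto simp: r_def)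
    have "ball x (3 * r) \<subseteq> U" using r(2) e(2) by (auto simp: subset_iff)
    then have "norm (L y - L z) \<le> 3 * C * 2 powr (1 + \<alpha>) * dist y z powr \<alpha>"
      if "y \<in> ball x r" "z \<in> ball x r" for y z
      using holder_of_taylor[OF _ r(1) C less_imp_le[OF \<alpha>] T r(3) that] by blast
    then show ?thesis using r(1) by blast
  qed
  have "continuous_on U L"
    unfolding continuous_on_eq_continuous_at[OF U]
  proof
    fix x assume x: "x \<in> U"
    obtain r C' where r: "r > 0" and C': "\<forall>y\<in>U \<inter> ball x r. \<forall>z\<in>U \<inter> ball x r. norm (L y - L z) \<le> C' * dist y z powr \<alpha>"
      using hol[OF x] by blast
    have "((\<lambda>y. C' * dist y x powr \<alpha>) \<longlongrightarrow> C' * dist x x powr \<alpha>) (at x)"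
      using \<alpha> by (intro tendsto_intros tendsto_powr') (auto simp: eventually_at_filter)
    then have lim: "((\<lambda>y. C' * dist y x powr \<alpha>) \<longlongrightarrow> 0) (at x)" using \<alpha> by simp
    have "eventually (\<lambda>y. y \<in> U \<inter> ball x r) (at x)"
      using U x r by (intro eventually_at_in_open') (auto simp: open_Int)
    then have "eventually (\<lambda>y. norm (L y - L x) \<le> C' * dist y x powr \<alpha>) (at x)"
      using C' x r by (auto elim!: eventually_mono)
    then have "((\<lambda>y. L y - L x) \<longlongrightarrow> 0) (at x)"
      by (rule Lim_null_comparison[OF _ lim])
    then show "isCont L x" by (simp add: isCont_def LIM_zero_iff)
  qed
  moreover have "(F has_derivative blinfun_apply (L x)) (at x)" if x: "x \<in> U" for x
  proof -
    obtain e where e: "0 < e" "ball x e \<subseteq> U" using U x open_contains_ball by blast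
    show ?thesis
    proof (rule has_derivativeI_sandwich)
      show "0 < min e \<rho>" using e \<rho> by simp
      show "bounded_linear (blinfun_apply (L x))" by (rule blinfun.bounded_linear_right)
      have "((\<lambda>y. C * norm (y - x) powr \<alpha>) \<longlongrightarrow> C * norm (x - x) powr \<alpha>) (at x)"
        using \<alpha> by (intro tendsto_intros tendsto_powr') (auto simp: eventually_at_filter)
      then show "((\<lambda>y. C * norm (y - x) powr \<alpha>) \<longlongrightarrow> 0) (at x)" using \<alpha> by simp
      fix y assume y: "y \<noteq> x" "dist y x < min e \<rho>"
      then have "y \<in> U" using e by (auto simp: dist_commute)
      then have "norm (F y - F x - L x (y - x)) \<le> C * norm (y - x) powr (1 + \<alpha>)"
        using T[OF x] y by (auto simp: dist_norm)
      also have "norm (y - x) powr (1 + \<alpha>) = norm (y - x) powr \<alpha> * norm (y - x)"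
        using y by (simp add: powr_add)
      finally show "norm (F y - F x - L x (y - x)) / norm (y - x) \<le> C * norm (y - x) powr \<alpha>"
        using y by (simp add: pos_divide_le_eq mult.assoc)
    qed
  qed
  ultimately show ?thesis
    unfolding C1_holder_on_def using hol by blast
qed

lemma geometric_limit:
  fixes X :: "nat \<Rightarrow> 'a::banach"
  assumes "\<And>j. norm (X (Suc j) - X j) \<le> c * q ^ j" "0 \<le> q" "q < 1"
  obtains L where "\<And>j. norm (L - X j) \<le> c * q ^ j / (1 - q)"
proof -
  have c: "0 \<le> c" using order_trans[OF norm_ge_zero assms(1)[of 0]] by simp
  have step: "norm (X (j + k) - X j) \<le> c * q ^ j * (\<Sum>i<k. q ^ i)" for j k
  proof (induction k)
    case (Suc k)
    have "norm (X (j + Suc k) - X j) \<le> norm (X (Suc (j + k)) - X (j + k)) + norm (X (j + k) - X j)"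
      using norm_triangle_ineq[of "X (Suc (j + k)) - X (j + k)" "X (j + k) - X j"] by simp
    also have "\<dots> \<le> c * q ^ (j + k) + c * q ^ j * (\<Sum>i<k. q ^ i)"
      by (intro add_mono assms(1) Suc)
    finally show ?case by (simp add: power_add distrib_left)
  qed simp
  have geo: "(\<Sum>i<k. q ^ i) \<le> 1 / (1 - q)" for k
    using assms(2,3) sum_le_suminf[OF summable_geometric, of q "{..<k}"] suminf_geometric[of q] by simp
  have bound: "norm (X (j + k) - X j) \<le> c * q ^ j / (1 - q)" for j k
    using order_trans[OF step[of j k] mult_left_mono[OF geo[of k]]] c assms(2) by simp
  have "Cauchy X"
  proof (rule CauchyI)
    fix e :: real assume "0 < e"
    have "(\<lambda>j. c * q ^ j / (1 - q)) \<longlonglongrightarrow> c * 0 / (1 - q)"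
      using assms by (intro tendsto_intros LIMSEQ_power_zero) auto
    then have "eventually (\<lambda>j. c * q ^ j / (1 - q) < e / 2) sequentially"
      using \<open>0 < e\<close> by (intro order_tendstoD(2)[where y = "c * 0 / (1 - q)"]) auto
    then obtain M where M: "c * q ^ M / (1 - q) < e / 2" by (auto simp: eventually_sequentially)
    have "norm (X k - X l) < e" if "M \<le> k" "M \<le> l" for k l
    proof -
      have "norm (X k - X M) < e / 2" "norm (X l - X M) < e / 2"
        using le_less_trans[OF bound[of M "k - M"] M] le_less_trans[OF bound[of M "l - M"] M] that by simp_all
      then show ?thesis using norm_triangle_ineq4[of "X k - X M" "X l - X M"] by simp
    qed
    then show "\<exists>M. \<forall>m\<ge>M. \<forall>n\<ge>M. norm (X m - X n) < e" by blast
  qed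
  then obtain L where L: "X \<longlonglongrightarrow> L" using Cauchy_convergent_iff convergent_def by blast
  have "norm (L - X j) \<le> c * q ^ j / (1 - q)" for j
  proof (rule tendsto_upperbound)
    show "(\<lambda>k. norm (X (j + k) - X j)) \<longlonglongrightarrow> norm (L - X j)"
      using LIMSEQ_ignore_initial_segment[OF L, of j] by (intro tendsto_intros) (simp add: add.commute)
  qed (use bound in auto)
  then show ?thesis by (rule that)
qed

section \<open>Nearby subspaces\<close>

lemma orthogonal_projection_exists:
  fixes H :: "'a::euclidean_space set"
  assumes "subspace H"
  obtains P where "linear P" "\<And>v. P v \<in> H" "\<And>v. v \<in> H \<Longrightarrow> P v = v"
    "\<And>v. norm (P v) \<le> norm v" "\<And>v. norm (v - P v) \<le> norm v"
    "\<And>v w. w \<in> H \<Longrightarrow> norm (v - P v) \<le> norm (v - w)"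
proof -
  obtain B where B: "B \<subseteq> H" "pairwise orthogonal B" "\<And>x. x \<in> B \<Longrightarrow> norm x = 1"
     "independent B" "span B = H"
    using orthonormal_basis_subspace[OF assms] by metis
  have fin: "finite B" using B(4) by (rule independent_imp_finite)
  define P where "P v = (\<Sum>b\<in>B. (v \<bullet> b) *\<^sub>R b)" for v
  have lin: "linear P"
    unfolding P_def by (intro linearI) (simp_all add: inner_add_left scaleR_add_left sum.distrib scaleR_sum_right)
  have PH: "P v \<in> H" for v
    unfolding P_def B(5)[symmetric] by (intro span_sum span_mul span_base)
  have res: "(v - P v) \<bullet> b = 0" if b: "b \<in> B" for v b
  proof -
    have "P v \<bullet> b = (\<Sum>a\<in>B. (v \<bullet> a) * (a \<bullet> b))" by (simp add: P_def inner_sum_left)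
    also have "\<dots> = (\<Sum>a\<in>B. if a = b then v \<bullet> b else 0)"
    proof (intro sum.cong refl)
      fix a assume "a \<in> B"
      then show "(v \<bullet> a) * (a \<bullet> b) = (if a = b then v \<bullet> b else 0)"
        using B(2,3) b by (auto simp: pairwise_def orthogonal_def norm_eq_1)
    qed
    also have "\<dots> = v \<bullet> b" using fin b by simp
    finally show ?thesis by (simp add: inner_diff_left)
  qed
  have orth: "orthogonal (v - P v) w" if "w \<in> H" for v w
    using that unfolding B(5)[symmetric]
    by (rule orthogonal_to_span) (simp add: res orthogonal_def)
  \<comment> \<open>The case \<open>w = 0\<close> gives both norm bounds, \<open>w = v\<close> gives
    the fixed points, and a general \<open>w\<close> gives minimality.\<close>
  have pyth: "(norm (v - w))\<^sup>2 = (norm (v - P v))\<^sup>2 + (norm (P v - w))\<^sup>2" if "w \<in> H" for v w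
  proof -
    have "orthogonal (v - P v) (P v - w)" using assms PH that by (intro orth subspace_diff)
    then show ?thesis using norm_add_Pythagorean[of "v - P v" "P v - w"] by simp
  qed
  have zero: "0 \<in> H" using assms by (rule subspace_0)
  show ?thesis
  proof (rule that[OF lin PH])
    fix v
    have "(norm (P v))\<^sup>2 \<le> (norm v)\<^sup>2" "(norm (v - P v))\<^sup>2 \<le> (norm v)\<^sup>2"
      using pyth[OF zero, of v] by simp_all
    then show "norm (P v) \<le> norm v" "norm (v - P v) \<le> norm v"
      by (simp_all only: power2_le_iff_abs_le abs_norm_cancel norm_ge_zero)
    show "P v = v" if "v \<in> H" using pyth[OF that, of v] by simp
    show "norm (v - P v) \<le> norm (v - w)" if "w \<in> H" for w
    proof (rule power2_le_imp_le)
      show "(norm (v - P v))\<^sup>2 \<le> (norm (v - w))\<^sup>2" using pyth[OF that, of v] by simp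
    qed simp
  qed
qed

text \<open>A one-sided gap between subspaces, in relative terms. Demanding
  \<open>norm w \<le> norm v\<close> as well makes the gaps simply add up under composition;
  projecting to \<open>H'\<close> provides it for free.\<close>

definition near_subspace :: "real \<Rightarrow> 'a::euclidean_space set \<Rightarrow> 'a set \<Rightarrow> bool" where
  "near_subspace \<epsilon> H H' \<longleftrightarrow> (\<forall>v\<in>H. \<exists>w\<in>H'. norm w \<le> norm v \<and> norm (v - w) \<le> \<epsilon> * norm v)"

lemma near_subspaceI:
  assumes "subspace H'" "\<And>v. v \<in> H \<Longrightarrow> \<exists>w\<in>H'. norm (v - w) \<le> \<epsilon> * norm v"
  shows "near_subspace \<epsilon> H H'"
  unfolding near_subspace_def
proof
  fix v assume "v \<in> H"
  then obtain w where w: "w \<in> H'" "norm (v - w) \<le> \<epsilon> * norm v" using assms(2) by blast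
  obtain P where P: "P v \<in> H'" "norm (P v) \<le> norm v" "norm (v - P v) \<le> norm (v - w)"
    using orthogonal_projection_exists[OF assms(1)] w(1) by metis
  then show "\<exists>w\<in>H'. norm w \<le> norm v \<and> norm (v - w) \<le> \<epsilon> * norm v"
    using w(2) by (intro bexI[of _ "P v"]) auto
qed

lemma near_subspace_mono: "near_subspace \<epsilon> H H' \<Longrightarrow> \<epsilon> \<le> \<delta> \<Longrightarrow> near_subspace \<delta> H H'"
  unfolding near_subspace_def by (meson mult_right_mono norm_ge_zero order_trans)

lemma near_subspace_trans:
  assumes "near_subspace \<epsilon> H H'" "near_subspace \<delta> H' H''" "0 \<le> \<delta>"
  shows "near_subspace (\<epsilon> + \<delta>) H H''"
  unfolding near_subspace_def
proof
  fix v assume "v \<in> H"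
  then obtain w where w: "w \<in> H'" "norm w \<le> norm v" "norm (v - w) \<le> \<epsilon> * norm v"
    using assms(1) by (auto simp: near_subspace_def)
  then obtain u where u: "u \<in> H''" "norm u \<le> norm w" "norm (w - u) \<le> \<delta> * norm w"
    using assms(2) by (auto simp: near_subspace_def)
  have "norm (v - u) \<le> norm (v - w) + norm (w - u)"
    using norm_triangle_ineq[of "v - w" "w - u"] by simp
  also have "\<dots> \<le> \<epsilon> * norm v + \<delta> * norm v"
    using w u mult_left_mono[OF w(2) assms(3)] by linarith
  finally show "\<exists>w\<in>H''. norm w \<le> norm v \<and> norm (v - w) \<le> (\<epsilon> + \<delta>) * norm v"
    using u w by (intro bexI[of _ u]) (auto simp: algebra_simps)
qed

lemma near_subspace_projection:
  assumes "near_subspace \<epsilon> H H'" "v \<in> H" "\<And>v w. w \<in> H' \<Longrightarrow> norm (v - P v) \<le> norm (v - w)"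
  shows "norm (v - P v) \<le> \<epsilon> * norm v"
  using assms unfolding near_subspace_def by (meson order_trans)

text \<open>
  By equality of dimensions the projection of \<open>H\<close> to \<open>H'\<close>, being injective, is onto.
\<close>

lemma near_subspace_projection_onto:
  assumes "near_subspace \<epsilon> H H'" "\<epsilon> < 1" "H \<in> grassmannian m" "H' \<in> grassmannian m"
    and P: "linear P" "\<And>v. P v \<in> H'" "\<And>v w. w \<in> H' \<Longrightarrow> norm (v - P v) \<le> norm (v - w)"
  shows "inj_on P H" "P ` H = H'"
proof -
  have sub: "subspace H" "subspace H'" "dim H = m" "dim H' = m"
    using assms(3,4) by (auto simp: grassmannian_def)
  show inj: "inj_on P H"
  proof (rule inj_onI)
    fix v w assume vw: "v \<in> H" "w \<in> H" "P v = P w"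
    then have "v - w \<in> H" using sub by (simp add: subspace_diff)
    from near_subspace_projection[OF assms(1) this P(3)]
    have "norm (v - w) \<le> \<epsilon> * norm (v - w)" using vw(3) linear_diff[OF P(1)] by simp
    then have "(1 - \<epsilon>) * norm (v - w) \<le> 0" by (simp add: algebra_simps)
    then show "v = w" using assms(2) by (simp add: mult_le_0_iff)
  qed
  have "dim (P ` H) = m"
    using dim_image_eq[OF P(1), of H] inj sub by (simp add: span_eq_iff[THEN iffD2])
  moreover have "subspace (P ` H)" using P(1) sub(1) by (rule linear_subspace_image)
  moreover have "P ` H \<subseteq> H'" using P(2) by auto
  ultimately show "P ` H = H'" using sub by (intro subspace_dim_equal) auto
qed

text \<open>Each \<open>u\<close> in \<open>H'\<close> is the projection of some \<open>v\<close> in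
  \<open>H\<close>, and \<open>\<epsilon> \<le> 1 / 2\<close> gives
  \<open>norm v \<le> 2 * norm u\<close>; that is the factor 2.\<close>

lemma near_subspace_sym:
  assumes near: "near_subspace \<epsilon> H H'" and \<epsilon>: "0 \<le> \<epsilon>" "\<epsilon> \<le> 1 / 2"
    and G: "H \<in> grassmannian m" "H' \<in> grassmannian m"
  shows "near_subspace (2 * \<epsilon>) H' H"
proof (rule near_subspaceI)
  have sub: "subspace H" "subspace H'" using G by (auto simp: grassmannian_def)
  show "subspace H" by (rule sub)
  obtain P where P: "linear P" "\<And>v. P v \<in> H'" "\<And>v w. w \<in> H' \<Longrightarrow> norm (v - P v) \<le> norm (v - w)"
    using orthogonal_projection_exists[OF sub(2)] by metis
  fix u assume "u \<in> H'"
  then obtain v where v: "v \<in> H" "u = P v"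
    using near_subspace_projection_onto(2)[OF near _ G P] \<epsilon> by auto
  have 1: "norm (v - u) \<le> \<epsilon> * norm v"
    using near_subspace_projection[OF near v(1) P(3)] v(2) by simp
  also have "\<dots> \<le> 1 / 2 * norm v" using \<epsilon> by (intro mult_right_mono) auto
  finally have "norm v \<le> 2 * norm u" using norm_triangle_ineq2[of v u] by simp
  then have "\<epsilon> * norm v \<le> \<epsilon> * (2 * norm u)" using \<epsilon> by (intro mult_left_mono)
  then show "\<exists>w\<in>H. norm (u - w) \<le> 2 * \<epsilon> * norm u"
    using 1 v(1) by (intro bexI[of _ v]) (auto simp: norm_minus_commute)
qed

section \<open>Bilaterally flat sets\<close>

text \<open>The two halves correspond to the two terms of \<theta> at scale \<open>r\<close>, with
  nearby points in place of distances to sets. The constant \<epsilon> is relative to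
  \<open>r\<close>, and \<open>H\<close> is the direction of the plane through
  \<open>x\<close>.\<close>

definition flat_at :: "'a::euclidean_space set \<Rightarrow> 'a \<Rightarrow> real \<Rightarrow> real \<Rightarrow> 'a set \<Rightarrow> bool" where
  "flat_at \<Sigma> x r \<epsilon> H \<longleftrightarrow>
     (\<forall>z\<in>\<Sigma> \<inter> cball x r. \<exists>w\<in>H. norm (z - x - w) \<le> \<epsilon> * r) \<and>
     (\<forall>w\<in>H. norm w \<le> r \<longrightarrow> (\<exists>z\<in>\<Sigma> \<inter> cball x r. norm (x + w - z) \<le> \<epsilon> * r))"

text \<open>A real supremum says something only about bounded sets: both sets lie in one ball and
  contain its centre, which bounds the distances by \<open>r\<close> and makes each of the two terms
  nonnegative.\<close>

lemma infdist_le_hausdorff_distance: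
  assumes "E \<subseteq> cball x r" "F \<subseteq> cball x r" "x \<in> E" "x \<in> F"
  shows "y \<in> E \<Longrightarrow> infdist y F \<le> hausdorff_distance E F"
    and "y \<in> F \<Longrightarrow> infdist y E \<le> hausdorff_distance E F"
proof -
  have bdd: "bdd_above ((\<lambda>y. infdist y B) ` A)" if "A \<subseteq> cball x r" "x \<in> B" for A B
  proof (rule bdd_aboveI)
    fix t assume "t \<in> (\<lambda>y. infdist y B) ` A"
    then obtain y where y: "y \<in> A" "t = infdist y B" by blast
    have "infdist y B \<le> dist y x" by (rule infdist_le[OF that(2)])
    also have "dist y x \<le> r" using that(1) y(1) by (auto simp: dist_commute)
    finally show "t \<le> r" using y(2) by simp
  qed
  have up: "infdist y B \<le> (SUP y\<in>A. infdist y B)" if "A \<subseteq> cball x r" "x \<in> B" "y \<in> A" for A B y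
    using that(3) bdd[OF that(1,2)] by (rule cSUP_upper)
  have pos: "0 \<le> (SUP y\<in>A. infdist y B)" if "A \<subseteq> cball x r" "x \<in> B" "x \<in> A" for A B
    using up[OF that] infdist_nonneg[of x B] by linarith
  have posE: "0 \<le> (SUP y\<in>E. infdist y F)" by (rule pos[OF assms(1,4,3)])
  have posF: "0 \<le> (SUP y\<in>F. infdist y E)" by (rule pos[OF assms(2,3,4)])
  show "infdist y F \<le> hausdorff_distance E F" if "y \<in> E"
    using up[OF assms(1,4) that] posF by (simp add: hausdorff_distance_def)
  show "infdist y E \<le> hausdorff_distance E F" if "y \<in> F"
    using up[OF assms(2,3) that] posE by (simp add: hausdorff_distance_def)
qed

text \<open>No plane is claimed to attain the infimum, hence the strict hypothesis. Closedness of
  both sets turns distances into nearest points.\<close>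

lemma theta_number_flat:
  fixes \<Sigma> :: "'a::euclidean_space set"
  assumes m: "m \<le> DIM('a)" and \<Sigma>: "compact \<Sigma>" "x \<in> \<Sigma>" and r: "0 < r" and \<theta>: "theta_number m \<Sigma> x r < \<epsilon>"
  obtains H where "H \<in> grassmannian m" "flat_at \<Sigma> x r \<epsilon> H"
proof -
  let ?E = "\<Sigma> \<inter> cball x r" and ?F = "\<lambda>H. (+) x ` H \<inter> cball x r"
  have "(INF H\<in>grassmannian m. hausdorff_distance ?E (?F H)) < \<epsilon> * r"
    using \<theta> r by (simp add: theta_number_def pos_divide_less_eq)
  then obtain H where H: "H \<in> grassmannian m" "hausdorff_distance ?E (?F H) < \<epsilon> * r"
    using cInf_lessD[of "(\<lambda>H. hausdorff_distance ?E (?F H)) ` grassmannian m"] grassmannian_nonempty[OF m]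
    by blast
  have sub: "subspace H" using H(1) by (simp add: grassmannian_def)
  have x: "x \<in> ?E" "x \<in> ?F H"
    using \<Sigma>(2) r subspace_0[OF sub] by (auto intro: image_eqI[where x = 0])
  have sE: "?E \<subseteq> cball x r" and sF: "?F H \<subseteq> cball x r" by blast+
  have cl: "closed ?E" "closed (?F H)"
    using compact_imp_closed[OF \<Sigma>(1)] closed_subspace[OF sub] by (auto intro: closed_Int closed_translation)
  have "\<exists>w\<in>H. norm (z - x - w) \<le> \<epsilon> * r" if z: "z \<in> ?E" for z
  proof -
    have "?F H \<noteq> {}" using x(2) by blast
    then obtain w where w: "w \<in> ?F H" "infdist z (?F H) = dist z w"
      using infdist_attains_inf[OF cl(2)] by blast
    then obtain h where h: "h \<in> H" "w = x + h" by blast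
    have "dist z w \<le> \<epsilon> * r"
      using infdist_le_hausdorff_distance(1)[OF sE sF x z] H(2) w(2) by simp
    then show ?thesis using h by (intro bexI[of _ h]) (auto simp: dist_norm diff_diff_eq)
  qed
  moreover have "\<exists>z\<in>?E. norm (x + w - z) \<le> \<epsilon> * r" if w: "w \<in> H" "norm w \<le> r" for w
  proof -
    have "?E \<noteq> {}" using x(1) by blast
    then obtain z where z: "z \<in> ?E" "infdist (x + w) ?E = dist (x + w) z"
      using infdist_attains_inf[OF cl(1)] by blast
    have "x + w \<in> ?F H" using w by (auto simp: dist_norm)
    then have "dist (x + w) z \<le> \<epsilon> * r"
      using infdist_le_hausdorff_distance(2)[OF sE sF x, of "x + w"] H(2) z(2) by simp
    then show ?thesis using z(1) by (intro bexI[of _ z]) (auto simp: dist_norm)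
  qed
  ultimately show ?thesis using H(1) by (intro that[of H]) (auto simp: flat_at_def)
qed

text \<open>For \<open>v'\<close> in \<open>H'\<close> of length \<open>s\<close> there is a point
  \<open>z\<close> of \<Sigma> near \<open>y + v'\<close>, and both \<open>y\<close> and
  \<open>z\<close> are within \<open>\<epsilon> * r\<close> of \<open>x + H\<close>. The difference
  of their approximations in \<open>H\<close> approximates \<open>v'\<close> up to
  \<open>\<delta> * s + 2 * \<epsilon> * r\<close>.\<close>

lemma flat_at_near_subspace:
  assumes F: "flat_at \<Sigma> x r \<epsilon> H" and F': "flat_at \<Sigma> y s \<delta> H'"
    and H: "subspace H" "subspace H'" and y: "y \<in> \<Sigma>" "dist x y + s \<le> r" and s: "0 < s"
  shows "near_subspace (\<delta> + 2 * \<epsilon> * r / s) H' H"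
proof (rule near_subspaceI[OF H(1)])
  fix v assume v: "v \<in> H'"
  show "\<exists>w\<in>H. norm (v - w) \<le> (\<delta> + 2 * \<epsilon> * r / s) * norm v"
  proof (cases "v = 0")
    case True
    then show ?thesis using subspace_0[OF H(1)] by (intro bexI[of _ 0]) auto
  next
    case False
    define v' where "v' = (s / norm v) *\<^sub>R v"
    have v': "v' \<in> H'" "norm v' = s" using v H(2) False s by (auto simp: v'_def subspace_scale)
    obtain z where z: "z \<in> \<Sigma>" "dist y z \<le> s" "norm (y + v' - z) \<le> \<delta> * s"
      using F' v' unfolding flat_at_def by force
    have "z \<in> \<Sigma> \<inter> cball x r" "y \<in> \<Sigma> \<inter> cball x r"
      using z y s dist_triangle[of x z y] by auto
    then obtain w1 w2 where w: "w1 \<in> H" "norm (z - x - w1) \<le> \<epsilon> * r" "w2 \<in> H" "norm (y - x - w2) \<le> \<epsilon> * r"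
      using F unfolding flat_at_def by blast
    have tri: "norm (a + b - c) \<le> norm a + norm b + norm c" for a b c :: 'a
      using norm_triangle_ineq4[of "a + b" c] norm_triangle_ineq[of a b] by linarith
    have "v' - (w1 - w2) = (y + v' - z) + (z - x - w1) - (y - x - w2)" by simp
    then have "norm (v' - (w1 - w2)) \<le> norm (y + v' - z) + norm (z - x - w1) + norm (y - x - w2)"
      by (simp only: tri)
    also have "\<dots> \<le> \<delta> * s + 2 * \<epsilon> * r" using z(3) w(2,4) by linarith
    finally have 1: "norm (v' - (w1 - w2)) \<le> \<delta> * s + 2 * \<epsilon> * r" .
    define w where "w = (norm v / s) *\<^sub>R (w1 - w2)"
    have "v - w = (norm v / s) *\<^sub>R (v' - (w1 - w2))"
      using False s by (simp add: w_def v'_def scaleR_diff_right)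
    then have "norm (v - w) = norm v / s * norm (v' - (w1 - w2))" using s by simp
    also have "\<dots> \<le> norm v / s * (\<delta> * s + 2 * \<epsilon> * r)" using 1 s by (intro mult_left_mono) auto
    also have "\<dots> = (\<delta> + 2 * \<epsilon> * r / s) * norm v" using s by (simp add: field_simps)
    finally show ?thesis
      using H(1) w(1,3) by (intro bexI[of _ w]) (auto simp: w_def subspace_scale subspace_diff)
  qed
qed

lemma dyadic_scale:
  fixes t R :: real
  assumes "0 < t" "t \<le> R"
  obtains j where "R / 2 ^ Suc j < t" "t \<le> R / 2 ^ j"
proof -
  have R: "0 < R" using assms by simp
  obtain n where "(1 / 2) ^ n < t / R" using real_arch_pow_inv[of "t / R" "1 / 2"] assms R by auto
  then have n: "R / 2 ^ n < t" using R by (simp add: field_simps power_divide)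
  define k where "k = (LEAST n. R / 2 ^ n < t)"
  have k: "R / 2 ^ k < t" unfolding k_def using n by (rule LeastI)
  have "k \<noteq> 0" using k assms(2) by (intro notI) simp
  then obtain j where j: "k = Suc j" by (cases k) auto
  have "\<not> R / 2 ^ j < t" using j unfolding k_def by (intro not_less_Least) simp
  then show ?thesis using k j by (intro that[of j]) auto
qed

text \<open>\<open>c * q ^ j\<close> stands for \<open>C * r powr \<alpha>\<close> at the dyadic
  radius \<open>r = R / 2 ^ j\<close>. The bound \<open>1 / 20\<close> on all tilts against the
  single plane \<open>H0\<close>, uniform in the point and the scale, is what yields cones with a
  fixed axis. \<open>P\<close> is the orthogonal projection to \<open>H0\<close>, described by the
  properties in use.\<close>

locale flat_graph =
  fixes \<Sigma> :: "'a::euclidean_space set" and m :: nat and x0 :: 'a and R c q :: real and H0 and P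
  assumes \<Sigma>: "compact \<Sigma>" "x0 \<in> \<Sigma>" and R: "0 < R" and c: "0 \<le> c" "c \<le> 1 / 20" and q: "0 < q" "q < 1"
    and H0: "H0 \<in> grassmannian m"
    and P: "linear P" "\<And>v. P v \<in> H0" "\<And>v. v \<in> H0 \<Longrightarrow> P v = v" "\<And>v. norm (P v) \<le> norm v"
      "\<And>v. norm (v - P v) \<le> norm v" "\<And>v w. w \<in> H0 \<Longrightarrow> norm (v - P v) \<le> norm (v - w)"
    and flat: "\<And>y j. y \<in> \<Sigma> \<Longrightarrow> dist x0 y \<le> R \<Longrightarrow>
      \<exists>H\<in>grassmannian m. flat_at \<Sigma> y (R / 2 ^ j) (c * q ^ j) H \<and> near_subspace (1 / 20) H H0"
begin

lemma subH0: "subspace H0" using H0 by (simp add: grassmannian_def)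

lemmas P_add = linear_add[OF P(1)] and P_diff = linear_diff[OF P(1)]
  and P_scale = linear_scale[OF P(1)] and P_0 = linear_0[OF P(1)]

lemma P_P [simp]: "P (P v) = P v" using P(2,3) by blast

lemma cq_le: "c * q ^ j \<le> 1 / 20" "0 \<le> c * q ^ j"
proof -
  have "c * q ^ j \<le> c * 1" using c q by (intro mult_left_mono power_le_one) auto
  then show "c * q ^ j \<le> 1 / 20" using c by simp
qed (use c q in simp)

text \<open>At the dyadic scale next above \<open>t = norm (z - y)\<close> flatness places
  \<open>z - y\<close> within \<open>1 / 20 * (2 * t) = t / 10\<close> of a plane, and the tilt of
  that plane against \<open>H0\<close> adds at most \<open>1 / 20 * (11 / 10 * t)\<close>; together
  this is less than \<open>t / 5\<close>.\<close>

lemma cone: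
  assumes "y \<in> \<Sigma>" "z \<in> \<Sigma>" "dist x0 y \<le> R" "dist y z \<le> R"
  shows "norm (z - y - P (z - y)) \<le> 1 / 5 * norm (z - y)"
proof (cases "y = z")
  case True
  then show ?thesis by (simp add: P_0)
next
  case False
  then have t: "0 < dist y z" by simp
  obtain j where j: "R / 2 ^ Suc j < dist y z" "dist y z \<le> R / 2 ^ j"
    by (rule dyadic_scale[OF t assms(4)])
  obtain H where H: "H \<in> grassmannian m" "flat_at \<Sigma> y (R / 2 ^ j) (c * q ^ j) H" "near_subspace (1 / 20) H H0"
    using flat[OF assms(1,3)] by blast
  define t where "t = norm (z - y)"
  have td: "dist y z = t" by (simp add: t_def dist_norm norm_minus_commute)
  have zy: "z \<in> \<Sigma> \<inter> cball y (R / 2 ^ j)" using assms(2) j(2) by simp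
  obtain w where w: "w \<in> H" "norm (z - y - w) \<le> c * q ^ j * (R / 2 ^ j)"
    using H(2) zy unfolding flat_at_def by blast
  have "c * q ^ j * (R / 2 ^ j) \<le> 1 / 20 * (2 * t)"
    using cq_le j(1) R unfolding td by (intro mult_mono) auto
  then have 1: "norm (z - y - w) \<le> t / 10" using w(2) by linarith
  then have "norm w \<le> 11 / 10 * t"
    using norm_triangle_ineq4[of "z - y" "z - y - w"] by (simp add: t_def)
  moreover obtain u where u: "u \<in> H0" "norm (w - u) \<le> 1 / 20 * norm w"
    using H(3) w(1) unfolding near_subspace_def by blast
  ultimately have "norm (z - y - u) \<le> t / 5"
    using 1 norm_triangle_ineq[of "z - y - w" "w - u"] norm_ge_zero[of "z - y"]
    unfolding t_def by (simp del: norm_ge_zero)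
  then show ?thesis using P(6)[OF u(1), of "z - y"] by (simp add: t_def)
qed

text \<open>Makes the projection injective on \<Sigma> near \<open>x0\<close>, where \<Sigma> is
  thus part of a graph with Lipschitz constant \<open>1 / 4\<close>.\<close>

lemma cone_projection:
  assumes "y \<in> \<Sigma>" "z \<in> \<Sigma>" "dist x0 y \<le> R" "dist y z \<le> R"
  shows "norm (z - y) \<le> 5 / 4 * norm (P (z - y))" "norm (z - y - P (z - y)) \<le> 1 / 4 * norm (P (z - y))"
proof -
  have "norm (z - y) \<le> norm (P (z - y)) + norm (z - y - P (z - y))"
    using norm_triangle_ineq[of "P (z - y)" "z - y - P (z - y)"] by simp
  then show "norm (z - y) \<le> 5 / 4 * norm (P (z - y))" "norm (z - y - P (z - y)) \<le> 1 / 4 * norm (P (z - y))"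
    using cone[OF assms] by linarith+
qed

text \<open>
  Were \<open>v\<close> not in the projection, a small scale of flatness at the point of \<open>\<Sigma>\<close> with projection nearest to
  \<open>v\<close> would yield a point with nearer projection.
\<close>

lemma projection_onto:
  assumes v: "v \<in> H0" "norm v < R / 8"
  shows "\<exists>y\<in>\<Sigma> \<inter> cball x0 (R / 2). P (y - x0) = v"
proof -
  let ?F = "\<Sigma> \<inter> cball x0 (R / 2)"
  have "compact ?F" using \<Sigma>(1) by (intro compact_Int_closed) auto
  moreover have x0F: "x0 \<in> ?F" using \<Sigma>(2) R by simp
  moreover have "continuous_on ?F (\<lambda>y. norm (v - P (y - x0)))"
    by (intro continuous_intros linear_continuous_on_compose[OF _ P(1)])
  ultimately obtain y where y: "y \<in> ?F" "\<And>z. z \<in> ?F \<Longrightarrow> norm (v - P (y - x0)) \<le> norm (v - P (z - x0))"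
    using continuous_attains_inf[of ?F "\<lambda>y. norm (v - P (y - x0))"] by blast
  define d where "d = norm (v - P (y - x0))"
  have "d = 0"
  proof (rule ccontr)
    assume "d \<noteq> 0"
    then have d: "0 < d" by (simp add: d_def)
    have "d \<le> norm v" using y(2)[OF x0F] by (simp add: d_def P_0)
    then have "norm (P (y - x0)) \<le> R / 4"
      using norm_triangle_ineq4[of v "v - P (y - x0)"] v(2) by (simp add: d_def)
    \<comment> \<open>The nearest point lies well inside the half ball: \<open>5 / 16 * R\<close>
      plus a step of \<open>R / 8\<close> stays below \<open>R / 2\<close>, so the better point
      found below is an admissible competitor.\<close>
    then have yx: "norm (y - x0) \<le> 5 / 16 * R"
      using cone_projection(1)[of x0 y] \<Sigma>(2) y(1) R by (auto simp: dist_norm norm_minus_commute)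
    define e where "e = (1 / d) *\<^sub>R (v - P (y - x0))"
    have e: "e \<in> H0" "norm e = 1"
      using subH0 v(1) P(2) d by (auto simp: e_def d_def intro!: subspace_scale subspace_diff)
    \<comment> \<open>The step must neither overshoot the gap \<open>d\<close> nor leave the half
      ball.\<close>
    define t where "t = min d (R / 8)"
    have t: "0 < t" "t \<le> d" "t \<le> R / 8" "t \<le> R" using d R by (auto simp: t_def)
    obtain j where j: "R / 2 ^ Suc j < t" by (rule dyadic_scale[OF t(1,4)])
    define r where "r = R / 2 ^ Suc j"
    have r: "0 < r" "r \<le> d" "r \<le> R / 8" using j t R by (auto simp: r_def)
    have yR: "y \<in> \<Sigma>" "dist x0 y \<le> R" using y(1) R by auto
    obtain H where H: "H \<in> grassmannian m" "flat_at \<Sigma> y r (c * q ^ Suc j) H" "near_subspace (1 / 20) H H0"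
      using flat[OF yR, of "Suc j"] unfolding r_def by blast
    have "near_subspace (2 * (1 / 20)) H0 H" using H(1,3) H0 by (intro near_subspace_sym) auto
    moreover have "r *\<^sub>R e \<in> H0" using e(1) subH0 by (simp add: subspace_scale)
    ultimately obtain w where w: "w \<in> H" "norm w \<le> norm (r *\<^sub>R e)" "norm (r *\<^sub>R e - w) \<le> 2 * (1 / 20) * norm (r *\<^sub>R e)"
      unfolding near_subspace_def by blast
    have nr: "norm (r *\<^sub>R e) = r" using e(2) r(1) by simp
    obtain z where z: "z \<in> \<Sigma>" "dist y z \<le> r" "norm (y + w - z) \<le> c * q ^ Suc j * r"
      using H(2) w(1,2) unfolding flat_at_def nr by force
    have "c * q ^ Suc j * r \<le> 1 / 20 * r" using cq_le(1)[of "Suc j"] r(1) by (intro mult_right_mono) auto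
    \<comment> \<open>The tilt costs \<open>2 / 20\<close> and flatness \<open>1 / 20\<close> of
      \<open>r\<close>; the projection thus advances towards \<open>v\<close> by at least
      \<open>17 / 20 * r\<close>.\<close>
    then have 1: "norm (r *\<^sub>R e - (z - y)) \<le> 3 / 20 * r"
      using norm_triangle_ineq[of "r *\<^sub>R e - w" "y + w - z"] z(3) w(3) unfolding nr by (simp add: algebra_simps)
    have "z \<in> ?F"
      using z yx r(3) R dist_triangle[of x0 z y] by (auto simp: dist_norm norm_minus_commute)
    then have "d \<le> norm (v - P (z - x0))" using y(2) by (simp add: d_def)
    also have "v - P (z - x0) = (d - r) *\<^sub>R e + P (r *\<^sub>R e - (z - y))"
    proof -
      have "d *\<^sub>R e = v - P (y - x0)" using d by (simp add: e_def)
      moreover have "P (r *\<^sub>R e - (z - y)) = r *\<^sub>R e - P (z - y)" using e(1) by (simp add: P_diff P_scale P(3))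
      moreover have "P (z - x0) = P (y - x0) + P (z - y)" by (simp add: P_add[symmetric])
      ultimately show ?thesis by (simp add: scaleR_diff_left)
    qed
    also have "norm \<dots> \<le> (d - r) + 3 / 20 * r"
      using norm_triangle_ineq[of "(d - r) *\<^sub>R e" "P (r *\<^sub>R e - (z - y))"] P(4)[of "r *\<^sub>R e - (z - y)"] 1 e(2) r(2)
      by simp
    finally show False using r(1) by simp
  qed
  then show ?thesis using y(1) by (intro bexI[of _ y]) (auto simp: d_def)
qed

section \<open>The graph function and its Taylor expansion\<close>

definition lift :: "'a \<Rightarrow> 'a" where
  "lift v = (SOME y. y \<in> \<Sigma> \<inter> cball x0 (R / 2) \<and> P (y - x0) = P v)"

text \<open>By definition \<open>lift v = x0 + P v + height v\<close>. Both functions live on the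
  ambient space but depend on \<open>P v\<close> only; constancy along the fibres of
  \<open>P\<close> allows charts on open subsets of the ambient space.\<close>

definition height :: "'a \<Rightarrow> 'a" where
  "height v = lift v - x0 - P v"

lemma lift:
  assumes "norm (P v) < R / 8"
  shows "lift v \<in> \<Sigma> \<inter> cball x0 (R / 2)" "P (lift v - x0) = P v"
proof -
  have "\<exists>y. y \<in> \<Sigma> \<inter> cball x0 (R / 2) \<and> P (y - x0) = P v" using projection_onto[OF P(2) assms] by blast
  then have "lift v \<in> \<Sigma> \<inter> cball x0 (R / 2) \<and> P (lift v - x0) = P v" unfolding lift_def by (rule someI_ex)
  then show "lift v \<in> \<Sigma> \<inter> cball x0 (R / 2)" "P (lift v - x0) = P v" by auto
qed

lemma half_ball:
  assumes "y \<in> \<Sigma> \<inter> cball x0 (R / 2)" "z \<in> \<Sigma> \<inter> cball x0 (R / 2)"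
  shows "y \<in> \<Sigma>" "z \<in> \<Sigma>" "dist x0 y \<le> R" "dist y z \<le> R"
  using assms R dist_triangle3[of y z x0] by auto

lemma lift_unique:
  assumes y: "y \<in> \<Sigma> \<inter> cball x0 (R / 2)" and n: "norm (P (y - x0)) < R / 8"
  shows "lift (y - x0) = y"
proof -
  have "P (lift (y - x0) - y) = P (lift (y - x0) - x0) - P (y - x0)" by (simp add: P_diff[symmetric])
  then have "P (lift (y - x0) - y) = 0" using lift(2)[OF n] by simp
  then show ?thesis using cone_projection(1)[OF half_ball[OF y lift(1)[OF n]]] by simp
qed

lemma height_cong: "P u = P v \<Longrightarrow> height u = height v" by (simp add: height_def lift_def)

lemma P_height: "norm (P v) < R / 8 \<Longrightarrow> P (height v) = 0"
  using lift(2)[of v] by (simp add: height_def P_diff)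

lemma lift_diff:
  "lift v - lift u = P (v - u) + (height v - height u)"
  by (simp add: height_def P_diff)

lemma height_lipschitz:
  assumes "norm (P u) < R / 8" "norm (P v) < R / 8"
  shows "norm (height v - height u) \<le> 1 / 4 * norm (P (v - u))"
    and "norm (lift v - lift u) \<le> 5 / 4 * norm (P (v - u))"
proof -
  have "P (lift v - lift u) = P (v - u)"
    unfolding lift_diff using assms by (simp add: P_add P_diff P_height)
  then show "norm (height v - height u) \<le> 1 / 4 * norm (P (v - u))"
    "norm (lift v - lift u) \<le> 5 / 4 * norm (P (v - u))"
    using cone_projection[OF half_ball[OF lift(1)[OF assms(1)] lift(1)[OF assms(2)]]]
    by (simp_all add: lift_diff)
qed

text \<open>The plane \<open>H\<close> belonging to \<open>lift u\<close> and the scale is itself a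
  graph over \<open>H0\<close>, namely of \<open>A = (id - P) S P\<close> with \<open>S\<close>
  inverse to \<open>P\<close> on \<open>H\<close>. The deviation of \<Sigma> from \<open>H\<close>
  enters once directly and, through the bound 2 for \<open>S\<close>, twice more, whence the factor
  3.\<close>

lemma height_approx:
  assumes u: "norm (P u) < R / 8"
  shows "\<exists>A :: 'a \<Rightarrow>\<^sub>L 'a. \<forall>v. norm (P v) < R / 8 \<longrightarrow> norm (v - u) \<le> R / 2 ^ Suc j \<longrightarrow>
    norm (height v - height u - A (v - u)) \<le> 3 * (c * q ^ j) * (R / 2 ^ j)"
proof -
  have y: "lift u \<in> \<Sigma>" "dist x0 (lift u) \<le> R" using lift(1)[OF u] R by auto
  obtain H where H: "H \<in> grassmannian m" "flat_at \<Sigma> (lift u) (R / 2 ^ j) (c * q ^ j) H" "near_subspace (1 / 20) H H0"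
    using flat[OF y] by blast
  have subH: "subspace H" using H(1) by (simp add: grassmannian_def)
  have PH: "inj_on P H" "P ` H = H0"
    using near_subspace_projection_onto[OF H(3) _ H(1) H0 P(1,2,6)] by auto
  obtain S where S: "range S \<subseteq> H" "linear S" "\<And>w. w \<in> H \<Longrightarrow> S (P w) = w"
    using linear_exists_left_inverse_on[OF P(1) subH PH(1)] by auto
  have S2: "norm (S h) \<le> 2 * norm h" if h: "h \<in> H0" for h
  proof -
    obtain w where w: "w \<in> H" "h = P w" using h PH(2) by blast
    have "norm (w - P w) \<le> 1 / 20 * norm w" by (rule near_subspace_projection[OF H(3) w(1) P(6)])
    then have "norm w \<le> 2 * norm (P w)"
      using norm_triangle_ineq2[of w "P w"] norm_ge_zero[of w] by linarith
    then show ?thesis using w S(3) by simp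
  qed
  define A where "A v = S (P v) - P (S (P v))" for v
  have linA: "bounded_linear A"
    unfolding linear_conv_bounded_linear[symmetric]
    by (intro linearI)
      (simp_all add: A_def P_add P_scale linear_add[OF S(2)] linear_scale[OF S(2)] scaleR_diff_right)
  have "norm (height v - height u - A (v - u)) \<le> 3 * (c * q ^ j) * (R / 2 ^ j)"
    if v: "norm (P v) < R / 8" "norm (v - u) \<le> R / 2 ^ Suc j" for v
  proof -
    let ?a = "lift v - lift u"
    \<comment> \<open>The lift stretches distances by up to \<open>5 / 4\<close>; allowing only half
      of the scale for \<open>v - u\<close> makes up for it.\<close>
    have "norm ?a \<le> 5 / 4 * norm (v - u)" using height_lipschitz(2)[OF u v(1)] P(4)[of "v - u"] by linarith
    also have "\<dots> \<le> R / 2 ^ j" using v(2) R by (simp add: field_simps)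
    finally have "lift v \<in> \<Sigma> \<inter> cball (lift u) (R / 2 ^ j)"
      using lift(1)[OF v(1)] by (auto simp: dist_norm norm_minus_commute)
    then obtain w where w: "w \<in> H" "norm (?a - w) \<le> c * q ^ j * (R / 2 ^ j)"
      using H(2) unfolding flat_at_def by blast
    have Pa: "P ?a = P (v - u)"
      unfolding lift_diff using u v by (simp add: P_add P_diff P_height)
    have "A (v - u) = (w - P w) + (S (P (?a - w)) - P (S (P (?a - w))))"
    proof -
      have "S (P (v - u)) = w + S (P (?a - w))"
      proof -
        have "P (v - u) = P (w + (?a - w))" unfolding Pa[symmetric] by simp
        also have "\<dots> = P w + P (?a - w)" by (rule P_add)
        finally show ?thesis using S(3)[OF w(1)] by (simp only: linear_add[OF S(2)])
      qed
      then show ?thesis by (simp add: A_def P_add)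
    qed
    moreover have "height v - height u = ?a - P ?a" unfolding Pa by (simp add: lift_diff)
    ultimately have "height v - height u - A (v - u)
        = ((?a - w) - P (?a - w)) - (S (P (?a - w)) - P (S (P (?a - w))))"
      by (simp add: P_diff)
    also have "norm \<dots> \<le> norm (?a - w) + norm (S (P (?a - w)))"
      by (rule order_trans[OF norm_triangle_ineq4 add_mono[OF P(5) P(5)]])
    also have "norm (S (P (?a - w))) \<le> 2 * norm (?a - w)"
      using S2[OF P(2), of "?a - w"] P(4)[of "?a - w"] by linarith
    finally show ?thesis using w(2) by simp
  qed
  then show ?thesis using linA by (intro exI[of _ "Blinfun A"]) (simp add: bounded_linear_Blinfun_apply)
qed

text \<open>Consecutive linear maps \<open>A i\<close>, compared on vectors of length
  \<open>R / 2 ^ (i + 2)\<close>, differ by at most \<open>24 * (c * q ^ i)\<close>, so they have a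
  limit \<open>L\<close>. For a given \<open>v\<close> the index \<open>i\<close> is taken at a
  scale near \<open>norm (v - u)\<close>, where \<open>q ^ i\<close> is at most a constant times
  \<open>norm (v - u) powr \<alpha>\<close>.\<close>

lemma height_taylor_at:
  assumes \<alpha>: "0 < \<alpha>" "q = 2 powr (- \<alpha>)" and u: "norm (P u) < R / 16"
  shows "\<exists>L :: 'a \<Rightarrow>\<^sub>L 'a. \<forall>v. norm (P v) < R / 16 \<longrightarrow> norm (v - u) \<le> R / 16 \<longrightarrow>
    norm (height v - height u - L (v - u))
      \<le> (12 + 24 / (1 - q)) * c * (4 / R) powr \<alpha> * norm (v - u) powr (1 + \<alpha>)"
proof -
  have u8: "norm (P u) < R / 8" using u R by simp
  have "\<forall>i. \<exists>A :: 'a \<Rightarrow>\<^sub>L 'a. \<forall>v. norm (P v) < R / 8 \<longrightarrow> norm (v - u) \<le> R / 2 ^ Suc i \<longrightarrow>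
    norm (height v - height u - A (v - u)) \<le> 3 * (c * q ^ i) * (R / 2 ^ i)"
    using height_approx[OF u8] by blast
  then obtain A :: "nat \<Rightarrow> 'a \<Rightarrow>\<^sub>L 'a" where
    A: "\<forall>i v. norm (P v) < R / 8 \<longrightarrow> norm (v - u) \<le> R / 2 ^ Suc i \<longrightarrow>
      norm (height v - height u - A i (v - u)) \<le> 3 * (c * q ^ i) * (R / 2 ^ i)"
    by (rule choice[THEN exE])
  \<comment> \<open>The restriction \<open>3 \<le> i\<close> keeps the test vectors shorter than
    \<open>R / 16\<close>, so that they do not leave the cylinder of radius
    \<open>R / 8\<close>.\<close>
  have step: "norm (A (Suc i) - A i) \<le> 24 * (c * q ^ i)" if i: "3 \<le> i" for i
  proof (rule norm_blinfun_bound)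
    show "0 \<le> 24 * (c * q ^ i)" using cq_le(2) by simp
    fix w
    show "norm ((A (Suc i) - A i) w) \<le> 24 * (c * q ^ i) * norm w"
    proof (cases "w = 0")
      case False
      define s where "s = R / 2 ^ (i + 2)"
      have s0: "0 < s" using R by (simp add: s_def)
      have "(2::real) ^ 5 \<le> 2 ^ (i + 2)" using i by (intro power_increasing) auto
      then have "s \<le> R / 2 ^ 5" unfolding s_def using R by (intro divide_left_mono) auto
      then have s32: "s \<le> R / 32" by simp
      define v where "v = u + (s / norm w) *\<^sub>R w"
      have vu: "norm (v - u) = s" using False s0 by (simp add: v_def)
      have "norm (P v) \<le> norm (P u) + norm (P (v - u))"
        using norm_triangle_ineq[of "P u" "P (v - u)"] by (simp add: P_diff)
      then have v: "norm (P v) < R / 8" using u s32 R P(4)[of "v - u"] vu by simp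
      have si: "s \<le> R / 2 ^ Suc i" "s \<le> R / 2 ^ Suc (Suc i)" using R by (simp_all add: s_def field_simps)
      have 1: "norm (height v - height u - A i (v - u)) \<le> 3 * (c * q ^ i) * (R / 2 ^ i)"
        using A[rule_format, OF v] si vu by simp
      have "norm (height v - height u - A (Suc i) (v - u)) \<le> 3 * (c * q ^ Suc i) * (R / 2 ^ Suc i)"
        using A[rule_format, OF v, of "Suc i"] si vu by simp
      also have "\<dots> \<le> 3 * (c * q ^ i) * (R / 2 ^ i)"
      proof (rule mult_mono)
        have "c * q ^ Suc i \<le> c * q ^ i" using c q by (intro mult_left_mono power_decreasing) auto
        then show "3 * (c * q ^ Suc i) \<le> 3 * (c * q ^ i)" by simp
        show "R / 2 ^ Suc i \<le> R / 2 ^ i" using R by (simp add: field_simps)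
        show "0 \<le> 3 * (c * q ^ i)" using cq_le(2) by simp
        show "0 \<le> R / 2 ^ Suc i" using R by simp
      qed
      finally have 2: "norm (height v - height u - A (Suc i) (v - u)) \<le> 3 * (c * q ^ i) * (R / 2 ^ i)" .
      have eq: "(A (Suc i) - A i) (v - u)
          = (height v - height u - A i (v - u)) - (height v - height u - A (Suc i) (v - u))"
        by (simp add: blinfun.diff_left)
      have "norm ((A (Suc i) - A i) (v - u)) \<le> 6 * (c * q ^ i) * (R / 2 ^ i)"
        unfolding eq using order_trans[OF norm_triangle_ineq4 add_mono[OF 1 2]] by (simp add: mult_ac)
      \<comment> \<open>Two remainders of \<open>3 * (c * q ^ i) * (R / 2 ^ i)\<close> and this
        ratio make up the 24.\<close>
      also have "R / 2 ^ i = 4 * s" by (simp add: s_def power_add)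
      finally have "norm ((A (Suc i) - A i) (v - u)) \<le> s * (24 * (c * q ^ i))"
        by (simp add: mult_ac)
      moreover have "(A (Suc i) - A i) (v - u) = (s / norm w) *\<^sub>R (A (Suc i) - A i) w"
        by (simp add: v_def blinfun.scaleR_right)
      ultimately have "s * (norm ((A (Suc i) - A i) w) / norm w) \<le> s * (24 * (c * q ^ i))"
        using s0 by simp
      then have "norm ((A (Suc i) - A i) w) / norm w \<le> 24 * (c * q ^ i)"
        using s0 by (simp only: mult_le_cancel_left_pos)
      then show ?thesis using False by (simp add: pos_divide_le_eq)
    qed simp
  qed
  have "norm (A (Suc j + 3) - A (j + 3)) \<le> (24 * c * q ^ 3) * q ^ j" for j
    using step[of "j + 3"] by (simp add: power_add mult_ac)
  then obtain L where L: "\<And>j. norm (L - A (j + 3)) \<le> (24 * c * q ^ 3) * q ^ j / (1 - q)"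
    using geometric_limit[of "\<lambda>j. A (j + 3)" "24 * c * q ^ 3" q] q by auto
  have "norm (height v - height u - L (v - u))
      \<le> (12 + 24 / (1 - q)) * c * (4 / R) powr \<alpha> * norm (v - u) powr (1 + \<alpha>)"
    if v: "norm (P v) < R / 16" "norm (v - u) \<le> R / 16" for v
  proof (cases "v = u")
    case True
    then show ?thesis by simp
  next
    case False
    define t where "t = norm (v - u)"
    have t: "0 < t" "t \<le> R / 16" using False v by (auto simp: t_def)
    obtain j where j: "R / 16 / 2 ^ Suc j < t" "t \<le> R / 16 / 2 ^ j" by (rule dyadic_scale[OF t])
    \<comment> \<open>The scale is counted from \<open>R / 16\<close>, four halvings of
      \<open>R\<close>; \<open>i\<close> is only \<open>j + 3\<close> because \<open>A i\<close> is
      valid up to \<open>R / 2 ^ Suc i\<close>.\<close>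
    define i where "i = j + 3"
    have i: "R / 2 ^ i \<le> 4 * t" "t \<le> R / 2 ^ Suc i"
      using j by (simp_all add: i_def power_add)
    have v8: "norm (P v) < R / 8" using v R by simp
    have 1: "norm (height v - height u - A i (v - u)) \<le> 3 * (c * q ^ i) * (R / 2 ^ i)"
      using A[rule_format, OF v8] i(2) by (simp add: t_def)
    have "norm (L - A i) \<le> 24 * (c * q ^ i) / (1 - q)"
      using L[of j] by (simp add: i_def power_add mult_ac)
    then have 2: "norm ((L - A i) (v - u)) \<le> 24 * (c * q ^ i) / (1 - q) * t"
      using norm_blinfun[of "L - A i" "v - u"] unfolding t_def
      by (meson mult_right_mono norm_ge_zero order_trans)
    have eq: "height v - height u - L (v - u) = (height v - height u - A i (v - u)) - (L - A i) (v - u)"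
      by (simp add: blinfun.diff_left)
    have "norm (height v - height u - L (v - u)) \<le> 3 * (c * q ^ i) * (R / 2 ^ i) + 24 * (c * q ^ i) / (1 - q) * t"
      unfolding eq by (rule order_trans[OF norm_triangle_ineq4 add_mono[OF 1 2]])
    also have "\<dots> \<le> 3 * (c * q ^ i) * (4 * t) + 24 * (c * q ^ i) / (1 - q) * t"
      using i(1) cq_le(2)[of i] by (intro add_right_mono mult_left_mono) auto
    also have "\<dots> = (12 + 24 / (1 - q)) * c * t * q ^ i"
      by (simp add: algebra_simps)
    also have "\<dots> \<le> (12 + 24 / (1 - q)) * c * t * (4 / R * t) powr \<alpha>"
    proof (intro mult_left_mono)
      have "q ^ i = (1 / 2 ^ i) powr \<alpha>"
      proof -
        have "q ^ i = (2 powr (- \<alpha>)) powr real i" by (simp add: \<alpha>(2) powr_realpow)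
        also have "\<dots> = (2 powr (- real i)) powr \<alpha>" by (simp add: powr_powr mult.commute)
        also have "2 powr (- real i) = 1 / (2::real) ^ i" by (simp add: powr_minus_divide powr_realpow)
        finally show ?thesis .
      qed
      also have "\<dots> \<le> (4 / R * t) powr \<alpha>"
        using i(1) R \<alpha>(1) by (intro powr_mono2) (auto simp: field_simps)
      finally show "q ^ i \<le> (4 / R * t) powr \<alpha>" .
    qed (use c q t in auto)
    also have "\<dots> = (12 + 24 / (1 - q)) * c * (4 / R) powr \<alpha> * t powr (1 + \<alpha>)"
      using t(1) by (simp only: powr_mult powr_add powr_one mult_ac)
    finally show ?thesis by (simp add: t_def)
  qed
  then show ?thesis by blast
qed

end

section \<open>Slice charts by shearing along the fibres of the projection\<close>

context flat_graph
begin

lemma height_taylor: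
  assumes \<alpha>: "0 < \<alpha>" "q = 2 powr (- \<alpha>)"
  obtains L :: "'a \<Rightarrow> 'a \<Rightarrow>\<^sub>L 'a" and K where "0 \<le> K"
    "\<And>u v. norm (P u) < R / 16 \<Longrightarrow> norm (P v) < R / 16 \<Longrightarrow> norm (v - u) \<le> R / 16 \<Longrightarrow>
      norm (height v - height u - L u (v - u)) \<le> K * norm (v - u) powr (1 + \<alpha>)"
proof -
  define K where "K = (12 + 24 / (1 - q)) * c * (4 / R) powr \<alpha>"
  have K0: "0 \<le> K" using c q by (simp add: K_def)
  have "\<forall>u. \<exists>L :: 'a \<Rightarrow>\<^sub>L 'a. norm (P u) < R / 16 \<longrightarrow> (\<forall>v. norm (P v) < R / 16 \<longrightarrow> norm (v - u) \<le> R / 16 \<longrightarrow>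
    norm (height v - height u - L (v - u)) \<le> K * norm (v - u) powr (1 + \<alpha>))"
    using height_taylor_at[OF \<alpha>] unfolding K_def by blast
  then obtain L :: "'a \<Rightarrow> 'a \<Rightarrow>\<^sub>L 'a" where L: "\<forall>u. norm (P u) < R / 16 \<longrightarrow> (\<forall>v. norm (P v) < R / 16 \<longrightarrow> norm (v - u) \<le> R / 16 \<longrightarrow>
    norm (height v - height u - L u (v - u)) \<le> K * norm (v - u) powr (1 + \<alpha>))"
    by (rule choice[THEN exE])
  show ?thesis
  proof (rule that[OF K0])
    fix u v assume "norm (P u) < R / 16" "norm (P v) < R / 16" "norm (v - u) \<le> R / 16"
    then show "norm (height v - height u - L u (v - u)) \<le> K * norm (v - u) powr (1 + \<alpha>)"
      using L by blast
  qed
qed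

text \<open>The shear that flattens the graph into \<open>H0\<close>. On the cylinder it preserves
  the projection of \<open>w - x0\<close>, and \<open>height\<close> depends on that only, so the
  inverse is the shear with the opposite sign.\<close>

definition chart :: "'a \<Rightarrow> 'a" where "chart w = w - x0 - height (w - x0)"

definition chart_inv :: "'a \<Rightarrow> 'a" where "chart_inv v = x0 + v + height v"

text \<open>The second condition excludes other parts of \<Sigma> over the same disc: the domain
  lies in the ball of radius \<open>R / 2\<close> about \<open>x0\<close>, where \<Sigma> is a
  graph. \<open>chart_ran\<close> is the same set after the shear.\<close>

definition chart_dom :: "'a set" where
  "chart_dom = {w. norm (P (w - x0)) < R / 16 \<and> norm (w - x0 - P (w - x0)) < R / 16}"

definition chart_ran :: "'a set" where
  "chart_ran = {v. norm (P v) < R / 16 \<and> norm (v - P v + height v) < R / 16}"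

lemma R16: "norm (P v) < R / 16 \<Longrightarrow> norm (P v) < R / 8" using R by simp

lemma continuous_on_P [continuous_intros]:
  fixes f :: "'a \<Rightarrow> 'a"
  shows "continuous_on A f \<Longrightarrow> continuous_on A (\<lambda>v. P (f v))"
  by (rule linear_continuous_on_compose[OF _ P(1)])

lemma open_cylinder: "open {v. norm (P v) < R / 16}"
  by (intro open_Collect_less continuous_intros)

lemma open_chart_dom: "open chart_dom"
  unfolding chart_dom_def by (intro open_Collect_conj open_Collect_less continuous_intros)

lemma continuous_on_height: "continuous_on {v. norm (P v) < R / 16} height"
proof (rule continuous_onI)
  fix u e assume u: "u \<in> {v. norm (P v) < R / 16}" and e: "0 < (e::real)"
  show "\<exists>d>0. \<forall>v\<in>{v. norm (P v) < R / 16}. dist v u < d \<longrightarrow> dist (height v) (height u) \<le> e"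
  proof (intro exI[of _ e] conjI ballI impI e)
    fix v assume v: "v \<in> {v. norm (P v) < R / 16}" "dist v u < e"
    have "norm (height v - height u) \<le> 1 / 4 * norm (P (v - u))"
      using u v(1) by (intro height_lipschitz(1) R16) auto
    also have "\<dots> \<le> norm (v - u)" using P(4)[of "v - u"] norm_ge_zero[of "P (v - u)"] by linarith
    finally show "dist (height v) (height u) \<le> e" using v(2) by (simp add: dist_norm)
  qed
qed

lemma open_chart_ran: "open chart_ran"
proof -
  have "continuous_on {v. norm (P v) < R / 16} (\<lambda>v. norm (v - P v + height v))"
    by (intro continuous_intros continuous_on_height)
  then have "open ({v. norm (P v) < R / 16} \<inter> (\<lambda>v. norm (v - P v + height v)) -` {..<R / 16})"
    by (rule continuous_open_preimage[OF _ open_cylinder open_lessThan])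
  also have "{v. norm (P v) < R / 16} \<inter> (\<lambda>v. norm (v - P v + height v)) -` {..<R / 16} = chart_ran"
    by (auto simp: chart_ran_def)
  finally show ?thesis .
qed

lemma P_chart: "norm (P (w - x0)) < R / 16 \<Longrightarrow> P (chart w) = P (w - x0)"
  using P_height[OF R16, of "w - x0"] by (simp add: chart_def P_diff)

lemma P_chart_inv: "norm (P v) < R / 16 \<Longrightarrow> P (chart_inv v - x0) = P v"
  using P_height[OF R16, of v] by (simp add: chart_inv_def P_add)

lemma chart_inv_chart: "norm (P (w - x0)) < R / 16 \<Longrightarrow> chart_inv (chart w) = w"
  using height_cong[OF P_chart, of w] by (simp add: chart_inv_def) (simp add: chart_def)

lemma chart_chart_inv: "norm (P v) < R / 16 \<Longrightarrow> chart (chart_inv v) = v"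
  using height_cong[OF P_chart_inv, of v] by (simp add: chart_def) (simp add: chart_inv_def)

lemma chart_mem: "w \<in> chart_dom \<Longrightarrow> chart w \<in> chart_ran"
  using P_chart[of w] height_cong[OF P_chart, of w]
  by (simp add: chart_dom_def chart_ran_def) (simp add: chart_def)

lemma chart_inv_mem: "v \<in> chart_ran \<Longrightarrow> chart_inv v \<in> chart_dom"
  using P_chart_inv[of v] by (simp add: chart_dom_def chart_ran_def) (simp add: chart_inv_def algebra_simps)

text \<open>Up to translation both maps are the identity minus or plus \<open>height\<close>, so the
  Taylor estimate of \<open>height\<close> carries over with the same constant.\<close>

lemma chart_C1_holder:
  assumes \<alpha>: "0 < \<alpha>" "q = 2 powr (- \<alpha>)"
  shows "C1_holder_on \<alpha> chart_dom chart" "C1_holder_on \<alpha> chart_ran chart_inv"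
proof -
  obtain L :: "'a \<Rightarrow> 'a \<Rightarrow>\<^sub>L 'a" and K where K: "0 \<le> K" and
    L: "\<And>u v. norm (P u) < R / 16 \<Longrightarrow> norm (P v) < R / 16 \<Longrightarrow> norm (v - u) \<le> R / 16 \<Longrightarrow>
      norm (height v - height u - L u (v - u)) \<le> K * norm (v - u) powr (1 + \<alpha>)"
    using height_taylor[OF \<alpha>] by metis
  have R0: "0 < R / 16" using R by simp
  show "C1_holder_on \<alpha> chart_dom chart"
  proof (rule C1_holder_on_taylor[OF open_chart_dom K \<alpha>(1) R0])
    fix y z assume yz: "y \<in> chart_dom" "z \<in> chart_dom" "norm (z - y) \<le> R / 16"
    have "chart z - chart y - (id_blinfun - L (y - x0)) (z - y)
        = - (height (z - x0) - height (y - x0) - L (y - x0) ((z - x0) - (y - x0)))"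
      by (simp add: chart_def blinfun.diff_left)
    then have "norm (chart z - chart y - (id_blinfun - L (y - x0)) (z - y))
        = norm (height (z - x0) - height (y - x0) - L (y - x0) ((z - x0) - (y - x0)))"
      by (simp only: norm_minus_cancel)
    also have "\<dots> \<le> K * norm ((z - x0) - (y - x0)) powr (1 + \<alpha>)"
      using yz by (intro L) (auto simp: chart_dom_def)
    finally show "norm (chart z - chart y - (id_blinfun - L (y - x0)) (z - y)) \<le> K * norm (z - y) powr (1 + \<alpha>)"
      by simp
  qed
  show "C1_holder_on \<alpha> chart_ran chart_inv"
  proof (rule C1_holder_on_taylor[OF open_chart_ran K \<alpha>(1) R0])
    fix y z assume yz: "y \<in> chart_ran" "z \<in> chart_ran" "norm (z - y) \<le> R / 16"
    have "chart_inv z - chart_inv y - (id_blinfun + L y) (z - y) = height z - height y - L y (z - y)"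
      by (simp add: chart_inv_def blinfun.add_left)
    then show "norm (chart_inv z - chart_inv y - (id_blinfun + L y) (z - y)) \<le> K * norm (z - y) powr (1 + \<alpha>)"
      using L[of y z] yz by (simp add: chart_ran_def)
  qed
qed

lemma chart_homeomorphism: "homeomorphism chart_dom chart_ran chart chart_inv"
proof (rule homeomorphismI)
  have "continuous_on chart_dom (\<lambda>w. height (w - x0))"
    by (rule continuous_on_compose2[OF continuous_on_height]) (auto simp: chart_dom_def intro!: continuous_intros)
  then show "continuous_on chart_dom chart"
    unfolding chart_def by (intro continuous_intros)
  have "continuous_on chart_ran height"
    by (rule continuous_on_subset[OF continuous_on_height]) (auto simp: chart_ran_def)
  then show "continuous_on chart_ran chart_inv"
    unfolding chart_inv_def by (intro continuous_intros)
  show "chart ` chart_dom \<subseteq> chart_ran" using chart_mem by blast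
  show "chart_inv ` chart_ran \<subseteq> chart_dom" using chart_inv_mem by blast
  show "chart_inv (chart w) = w" if "w \<in> chart_dom" for w
    using that by (intro chart_inv_chart) (simp add: chart_dom_def)
  show "chart (chart_inv v) = v" if "v \<in> chart_ran" for v
    using that by (intro chart_chart_inv) (simp add: chart_ran_def)
qed

text \<open>A point of \<Sigma> in the domain is the lift of its own projection, so the shear sends
  it to that projection; conversely a vector of \<open>H0\<close> is sheared back to its lift, which
  lies on \<Sigma>.\<close>

lemma chart_slice: "chart ` (\<Sigma> \<inter> chart_dom) = H0 \<inter> chart_ran"
proof
  show "chart ` (\<Sigma> \<inter> chart_dom) \<subseteq> H0 \<inter> chart_ran"
  proof
    fix v assume "v \<in> chart ` (\<Sigma> \<inter> chart_dom)"
    then obtain w where w: "w \<in> \<Sigma>" "w \<in> chart_dom" "v = chart w" by blast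
    have n: "norm (P (w - x0)) < R / 16" "norm (w - x0 - P (w - x0)) < R / 16"
      using w(2) by (auto simp: chart_dom_def)
    then have "norm (w - x0) \<le> R / 2"
      using norm_triangle_ineq[of "P (w - x0)" "w - x0 - P (w - x0)"] R by simp
    then have "lift (w - x0) = w"
      using w(1) n(1) by (intro lift_unique R16) (auto simp: dist_norm norm_minus_commute)
    then have "chart w = P (w - x0)" by (simp add: chart_def height_def)
    then show "v \<in> H0 \<inter> chart_ran" using w(3) P(2)[of "w - x0"] chart_mem[OF w(2)] by simp
  qed
  show "H0 \<inter> chart_ran \<subseteq> chart ` (\<Sigma> \<inter> chart_dom)"
  proof
    fix v assume v: "v \<in> H0 \<inter> chart_ran"
    then have n: "norm (P v) < R / 16" by (simp add: chart_ran_def)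
    have "P v = v" using v P(3) by simp
    then have "chart_inv v = lift v" by (simp add: chart_inv_def height_def)
    then have "chart_inv v \<in> \<Sigma>" using lift(1)[OF R16[OF n]] by simp
    then show "v \<in> chart ` (\<Sigma> \<inter> chart_dom)"
      using chart_chart_inv[OF n] chart_inv_mem[of v] v by (intro image_eqI[of _ _ "chart_inv v"]) auto
  qed
qed

end

section \<open>From power decay of flatness to a submanifold\<close>

lemma flat_at_near_dyadic:
  assumes H: "\<And>j. H j \<in> grassmannian m" "\<And>j. flat_at \<Sigma> y (R / 2 ^ j) (c * q ^ j) (H j)"
    and y: "y \<in> \<Sigma>" and R: "0 < R" and c: "0 \<le> c" and q: "0 \<le> q" "q \<le> 1"
  shows "near_subspace (\<Sum>i<j. 5 * c * q ^ i) (H j) (H 0)"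
proof (induction j)
  case 0
  then show ?case by (auto simp: near_subspace_def)
next
  case (Suc j)
  \<comment> \<open>Consecutive scales have ratio 2, so the plane changes by at most
    \<open>c * q ^ Suc j + 4 * (c * q ^ j)\<close>, hence by at most
    \<open>5 * c * q ^ j\<close>.\<close>
  have "near_subspace (c * q ^ Suc j + 2 * (c * q ^ j) * (R / 2 ^ j) / (R / 2 ^ Suc j)) (H (Suc j)) (H j)"
    using H(1) R y
    by (intro flat_at_near_subspace[OF H(2) H(2)]) (simp_all add: grassmannian_def field_simps)
  then have "near_subspace (5 * c * q ^ j) (H (Suc j)) (H j)"
  proof (rule near_subspace_mono)
    have "c * q ^ Suc j \<le> c * q ^ j" using c q by (intro mult_left_mono power_decreasing) auto
    moreover have "2 * (c * q ^ j) * (R / 2 ^ j) / (R / 2 ^ Suc j) = 4 * (c * q ^ j)" using R by simp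
    ultimately show "c * q ^ Suc j + 2 * (c * q ^ j) * (R / 2 ^ j) / (R / 2 ^ Suc j) \<le> 5 * c * q ^ j" by simp
  qed
  moreover have "0 \<le> (\<Sum>i<j. 5 * c * q ^ i)" using c q by (intro sum_nonneg) auto
  ultimately have "near_subspace (5 * c * q ^ j + (\<Sum>i<j. 5 * c * q ^ i)) (H (Suc j)) (H 0)"
    using Suc by (intro near_subspace_trans)
  then show ?case by (simp add: add.commute)
qed

lemma embedded_submanifold_of_flat:
  fixes \<Sigma> :: "'a::euclidean_space set"
  assumes \<Sigma>: "compact \<Sigma>" and C: "0 < C" and \<alpha>: "0 < \<alpha>" and r0: "0 < r0"
    and flat: "\<And>x r. x \<in> \<Sigma> \<Longrightarrow> 0 < r \<Longrightarrow> r \<le> r0 \<Longrightarrow> \<exists>H\<in>grassmannian m. flat_at \<Sigma> x r (C * r powr \<alpha>) H"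
  shows "embedded_submanifold_C1_holder m \<alpha> \<Sigma>"
  unfolding embedded_submanifold_C1_holder_def
proof
  fix x0 assume x0: "x0 \<in> \<Sigma>"
  define q where "q = 2 powr (- \<alpha>)"
  have q: "0 < q" "q < 1" using \<alpha> by (auto simp: q_def powr_less_one)
  \<comment> \<open>Collects the tilts against \<open>H0\<close>: \<open>5 / (1 - q)\<close> bounds
    the sum over all dyadic scales at one point, and \<open>1 + 4 * 2 powr \<alpha>\<close> comes
    from passing from the plane at \<open>y\<close> and scale \<open>R\<close> to the one at
    \<open>x0\<close> and scale \<open>2 * R\<close>.\<close>
  define M where "M = C * (5 / (1 - q) + 1 + 4 * 2 powr \<alpha>)"
  have M: "C \<le> M" "0 < M"
  proof -
    have "C * 1 \<le> M" unfolding M_def using C q by (intro mult_left_mono) auto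
    then show "C \<le> M" "0 < M" using C by auto
  qed
  \<comment> \<open>Small enough for \<open>M * R powr \<alpha> \<le> 1 / 20\<close>, which bounds
    both \<open>c\<close> and every tilt.\<close>
  define R where "R = min (r0 / 2) ((1 / (20 * M)) powr (1 / \<alpha>))"
  have R: "0 < R" "2 * R \<le> r0" using r0 M by (auto simp: R_def)
  have "R powr \<alpha> \<le> ((1 / (20 * M)) powr (1 / \<alpha>)) powr \<alpha>"
    using R(1) \<alpha> by (intro powr_mono2) (auto simp: R_def)
  also have "\<dots> = 1 / (20 * M)" using \<alpha> M by (simp add: powr_powr)
  finally have MR: "M * R powr \<alpha> \<le> 1 / 20" using M by (simp add: field_simps)
  define c where "c = C * R powr \<alpha>"
  have c: "0 \<le> c" "c \<le> 1 / 20"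
  proof -
    have "c \<le> M * R powr \<alpha>" unfolding c_def using M by (intro mult_right_mono) auto
    then show "c \<le> 1 / 20" using MR by simp
  qed (use C in \<open>simp add: c_def\<close>)
  \<comment> \<open>The reference scale is \<open>2 * R\<close>, since the balls of radius
    \<open>R\<close> about points at distance at most \<open>R\<close> from \<open>x0\<close> must
    fit in.\<close>
  obtain H0 where H0: "H0 \<in> grassmannian m" "flat_at \<Sigma> x0 (2 * R) (C * (2 * R) powr \<alpha>) H0"
    using flat[OF x0, of "2 * R"] R by auto
  have subH0: "subspace H0" using H0(1) by (simp add: grassmannian_def)
  have "\<exists>P. linear P \<and> (\<forall>v. P v \<in> H0) \<and> (\<forall>v. v \<in> H0 \<longrightarrow> P v = v) \<and> (\<forall>v. norm (P v) \<le> norm v) \<and>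
      (\<forall>v. norm (v - P v) \<le> norm v) \<and> (\<forall>v w. w \<in> H0 \<longrightarrow> norm (v - P v) \<le> norm (v - w))"
    by (rule orthogonal_projection_exists[OF subH0]) blast
  then obtain P where "linear P \<and> (\<forall>v. P v \<in> H0) \<and> (\<forall>v. v \<in> H0 \<longrightarrow> P v = v) \<and> (\<forall>v. norm (P v) \<le> norm v) \<and>
      (\<forall>v. norm (v - P v) \<le> norm v) \<and> (\<forall>v w. w \<in> H0 \<longrightarrow> norm (v - P v) \<le> norm (v - w))"
    by (elim exE)
  then have P: "linear P" "\<And>v. P v \<in> H0" "\<And>v. v \<in> H0 \<Longrightarrow> P v = v" "\<And>v. norm (P v) \<le> norm v"
      "\<And>v. norm (v - P v) \<le> norm v" "\<And>v w. w \<in> H0 \<Longrightarrow> norm (v - P v) \<le> norm (v - w)"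
    by blast+
  have fl: "\<exists>H\<in>grassmannian m. flat_at \<Sigma> y (R / 2 ^ j) (c * q ^ j) H \<and> near_subspace (1 / 20) H H0"
    if y: "y \<in> \<Sigma>" "dist x0 y \<le> R" for y j
  proof -
    have "\<exists>H. H \<in> grassmannian m \<and> flat_at \<Sigma> y (R / 2 ^ j) (c * q ^ j) H" for j
    proof -
      have "R / 2 ^ j \<le> R / 1" using R(1) by (intro divide_left_mono) auto
      then obtain H where H: "H \<in> grassmannian m" "flat_at \<Sigma> y (R / 2 ^ j) (C * (R / 2 ^ j) powr \<alpha>) H"
        using flat[OF y(1), of "R / 2 ^ j"] R by auto
      have "(R / 2 ^ j) powr \<alpha> = R powr \<alpha> * q ^ j"
      proof -
        have "R / 2 ^ j = R * 2 powr (- real j)" by (simp add: powr_minus_divide powr_realpow)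
        then have "(R / 2 ^ j) powr \<alpha> = R powr \<alpha> * (2 powr (- real j)) powr \<alpha>" by (simp only: powr_mult)
        also have "(2 powr (- real j)) powr \<alpha> = (2 powr (- \<alpha>)) powr real j" by (simp add: powr_powr mult.commute)
        also have "\<dots> = q ^ j" by (simp add: q_def powr_realpow)
        finally show ?thesis .
      qed
      then show ?thesis using H by (auto simp: c_def mult.assoc)
    qed
    then have "\<forall>j. \<exists>H. H \<in> grassmannian m \<and> flat_at \<Sigma> y (R / 2 ^ j) (c * q ^ j) H" by blast
    then obtain H where H: "\<forall>j. H j \<in> grassmannian m \<and> flat_at \<Sigma> y (R / 2 ^ j) (c * q ^ j) (H j)"
      by (rule choice[THEN exE])
    have "near_subspace (\<Sum>i<j. 5 * c * q ^ i) (H j) (H 0)"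
      using H y(1) R(1) c(1) q by (intro flat_at_near_dyadic) auto
    moreover have "near_subspace (c + 2 * (C * (2 * R) powr \<alpha>) * (2 * R) / R) (H 0) H0"
      using H[rule_format, of 0] subH0 y R by (intro flat_at_near_subspace[OF H0(2)]) (auto simp: grassmannian_def)
    ultimately have "near_subspace ((\<Sum>i<j. 5 * c * q ^ i) + (c + 2 * (C * (2 * R) powr \<alpha>) * (2 * R) / R)) (H j) H0"
      by (rule near_subspace_trans) (use c C R in auto)
    moreover have "(\<Sum>i<j. 5 * c * q ^ i) + (c + 2 * (C * (2 * R) powr \<alpha>) * (2 * R) / R) \<le> 1 / 20"
    proof -
      have "(\<Sum>i<j. q ^ i) \<le> 1 / (1 - q)"
        using q sum_le_suminf[OF summable_geometric, of q "{..<j}"] suminf_geometric[of q] by simp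
      then have "5 * c * (\<Sum>i<j. q ^ i) \<le> 5 * c * (1 / (1 - q))" using c by (intro mult_left_mono) auto
      then have "(\<Sum>i<j. 5 * c * q ^ i) \<le> 5 * c / (1 - q)" by (simp add: sum_distrib_left)
      moreover have "2 * (C * (2 * R) powr \<alpha>) * (2 * R) / R = c * (4 * 2 powr \<alpha>)"
        using R(1) by (simp add: c_def powr_mult)
      moreover have "5 * c / (1 - q) + (c + c * (4 * 2 powr \<alpha>)) = M * R powr \<alpha>"
        by (simp add: M_def c_def algebra_simps)
      ultimately show ?thesis using MR by linarith
    qed
    ultimately show ?thesis using H near_subspace_mono by blast
  qed
  interpret flat_graph \<Sigma> m x0 R c q H0 P
    by (rule flat_graph.intro[OF \<Sigma> x0 R(1) c q H0(1) P fl])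
  have "x0 \<in> chart_dom" using R(1) by (simp add: chart_dom_def P_0)
  then have "open chart_dom \<and> x0 \<in> chart_dom \<and> open chart_ran \<and> homeomorphism chart_dom chart_ran chart chart_inv \<and>
      C1_holder_on \<alpha> chart_dom chart \<and> C1_holder_on \<alpha> chart_ran chart_inv \<and>
      chart ` (\<Sigma> \<inter> chart_dom) = H0 \<inter> chart_ran"
    by (intro conjI open_chart_dom open_chart_ran chart_homeomorphism chart_C1_holder[OF \<alpha> q_def] chart_slice)
  with H0(1) show "\<exists>U V :: 'a set. \<exists>\<Phi> \<Psi> :: 'a \<Rightarrow> 'a. \<exists>H\<in>grassmannian m. open U \<and> x0 \<in> U \<and> open V \<and> homeomorphism U V \<Phi> \<Psi> \<and>
      C1_holder_on \<alpha> U \<Phi> \<and> C1_holder_on \<alpha> V \<Psi> \<and> \<Phi> ` (\<Sigma> \<inter> U) = H \<inter> V"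
    by blast
qed

theorem theorem1:
  fixes \<Sigma> :: "(real ^ 'n) set" and m l :: nat and p \<kappa> lam :: real
  assumes "1 \<le> m" and "m \<le> CARD('n)"
    and "l \<in> {1..m + 2}"
    and "compact \<Sigma>"
    and "\<exists>R_Ahl>0. \<exists>A_Ahl>0. \<forall>x\<in>\<Sigma>. \<forall>r. 0 < r \<and> r \<le> R_Ahl \<longrightarrow>
           hausdorff m (\<Sigma> \<inter> ball x r) \<ge> ennreal (A_Ahl * r ^ m)"
    and "\<exists>R_tb>0. \<exists>M_tb>1. \<forall>x\<in>\<Sigma>. \<forall>r. 0 < r \<and> r \<le> R_tb \<longrightarrow>
           theta_number m \<Sigma> x r \<le> M_tb * beta_number m \<Sigma> x r"
    and "p > real (m * l)"
    and "menger_energy m l p \<Sigma> < \<infinity>"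
    and "\<kappa> = (p + real (m * l)) * real (m + 1)"
    and "lam = p - real (m * l)"
  shows "closed_embedded_manifold_C1_holder m (lam / \<kappa>) \<Sigma>"
proof -
  have m: "m \<le> DIM(real ^ 'n)" using assms(2) by simp
  have l: "l \<le> m + 2" using assms(3) by simp
  obtain Ra A where Ra: "0 < Ra" and A: "0 < A" and Ahl: "\<forall>x\<in>\<Sigma>. \<forall>r. 0 < r \<and> r \<le> Ra \<longrightarrow>
           hausdorff m (\<Sigma> \<inter> ball x r) \<ge> ennreal (A * r ^ m)"
    using assms(5) by (elim exE conjE)
  obtain Rt M where Rt: "0 < Rt" and M: "1 < M" and tb: "\<forall>x\<in>\<Sigma>. \<forall>r. 0 < r \<and> r \<le> Rt \<longrightarrow>
           theta_number m \<Sigma> x r \<le> M * beta_number m \<Sigma> x r"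
    using assms(6) by (elim exE conjE)
  define \<alpha> where "\<alpha> = lam / \<kappa>"
  have p0: "0 < p" using assms(7) by (rule le_less_trans[rotated]) simp
  have \<alpha>: "0 < \<alpha>"
    unfolding \<alpha>_def assms(9,10) using assms(7) p0
    by (intro divide_pos_pos mult_pos_pos add_pos_nonneg) auto
  have "\<exists>C>0. \<forall>x\<in>\<Sigma>. \<forall>r. 0 < r \<longrightarrow> r \<le> min Ra 1 \<longrightarrow>
    beta_number m \<Sigma> x r \<le> C * r powr ((p - real (m * l)) / ((p + real (m * l)) * real (m + 1)))"
    by (rule beta_number_decay[OF m l assms(4) A Ra _ assms(7,8)]) (simp add: Ahl)
  then obtain C where C: "0 < C" and \<beta>: "\<forall>x\<in>\<Sigma>. \<forall>r. 0 < r \<longrightarrow> r \<le> min Ra 1 \<longrightarrow>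
    beta_number m \<Sigma> x r \<le> C * r powr \<alpha>"
    unfolding \<alpha>_def assms(9,10) by (elim exE conjE)
  have "embedded_submanifold_C1_holder m \<alpha> \<Sigma>"
  proof (rule embedded_submanifold_of_flat[OF assms(4)])
    show "0 < 2 * M * C" using M C by simp
    show "0 < min (min Ra 1) Rt" using Ra Rt by simp
    fix x r assume x: "x \<in> \<Sigma>" and r: "0 < r" "r \<le> min (min Ra 1) Rt"
    have "theta_number m \<Sigma> x r \<le> M * beta_number m \<Sigma> x r" using tb x r by simp
    also have "\<dots> \<le> M * (C * r powr \<alpha>)" using \<beta> x r M by (intro mult_left_mono) auto
    \<comment> \<open>The doubled constant gives the strict inequality from which a plane can be
      extracted.\<close>
    also have "\<dots> < 2 * M * C * r powr \<alpha>" using M C r by simp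
    finally show "\<exists>H\<in>grassmannian m. flat_at \<Sigma> x r (2 * M * C * r powr \<alpha>) H"
      using theta_number_flat[OF m assms(4) x r(1)] by metis
  qed (rule \<alpha>)
  then show ?thesis
    using assms(4) by (simp add: closed_embedded_manifold_C1_holder_def \<alpha>_def)
qed

end
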